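(* Let $(X,\|\cdot\|)$ be a real normed space, let $f:X\to\overline{\mathbb R}$, and suppose that $f(x_0)\in\mathbb R$ for some $x_0\in X$. (a) One has $\widehat\partial f(x_0)\subset\eth f(x_0)$. (b) If, in addition, $X$ is a Banach space, $f$ is lower semicontinuous near $x_0$, and the Fréchet subdifferential $\widehat\partial$ is an abstract subdifferential on some class $\mathcal F\subset\overline{\mathbb R}^X$ containing $f$, then $$\eth f(x_0)\subset\partial_L f(x_0).$$ In particular, this applies (and the inclusion holds) when $X$ is an Asplund Banach space and $f$ is proper and lower semicontinuous, since in that setting the Fréchet subdifferential is an abstract subdifferential on the class of proper lower semicontinuous functions.
   Context: $\overline{\mathbb R}=[-\infty,+\infty]$; $s$ is the norm topology of $X$, $w^*$ the weak-star topology of $X^*$, and $\langle x,x^*\rangle:=x^*(x)$. $\overline B(x_0;r)$ is the closed norm ball. Core subdifferential (for the norm metric): for $f:X\to\overline{\mathbb R}$ and $x_0\in X$, $x_0^*\in X^*$ belongs to $\eth f(x_0)$ if $f(x_0)\in\mathbb R$ and there is a family $(\delta_\varepsilon)_{\varepsilon>0}\subset(0,+\infty)$ with $\limsup_{\varepsilon\downarrow0}\delta_\varepsilon/\varepsilon=+\infty$ such that $f(x_0)+\langle x-x_0,x_0^*\rangle\le f(x)+\varepsilon$ for every $\varepsilon>0$ and every $x\in\overline B(x_0;\delta_\varepsilon)$. If $f(x_0)\notin\mathbb R$, then $\eth f(x_0)=\emptyset$. Fréchet (regular) subdifferential: $\widehat\partial f(x):=\bigl\{x^*\in X^*\mid \liminf_{u\to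 x,\,u\ne x}\frac{f(u)-f(x)-\langle u-x,x^*\rangle}{\|u-x\|}\ge0\bigr\}$, with $\widehat\partial f(x)=\emptyset$ if $f(x)\notin\mathbb R$. Outer limit: for a multifunction $(f,x)\mapsto\partial f(x)\subset X^*$, $x^*\in s\times w^*\text{-}\operatorname{Limsup}_{y\to x}\partial f(y)$ means that there is a net $((y_i,y_i^* ))_i$ with $y_i^*\in\partial f(y_i)$ for all $i$, $y_i\to x$ in norm, $y_i^*\to x^*$ weak-star, and $f(y_i)\to f(x)$. Limiting (Mordukhovich) subdifferential: $\partial_L f(x):=s\times w^*\text{-}\operatorname{Limsup}_{y\to x}\widehat\partial f(y)$. Abstract subdifferential: a multifunction $\partial:\overline{\mathbb R}^{X}\times X\rightrightarrows X^*$ is an abstract subdifferential on a class $\mathcal F$ if the following property [P] holds: whenever $f\in\mathcal F$, $g:X\to\mathbb R$ is convex and continuous, $x\in X$, $f(x)$ is finite, $f$ is lower semicontinuous near $x$, and $x$ is a local minimum point of $f+g$, then $0\in s\times w^*\text{-}\operatorname{Limsup}_{y\to x}\partial f(y)+\partial_F g(x)$, where $\partial_F g(x)=\{x^*\in X^*\mid g(x)+\langle u-x,x^*\rangle\le g(u)\ \forall u\in X\}$. *)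

theory Defs
  imports "HOL-Analysis.Analysis"
begin

(* The topological dual X^* of a real normed space 'a is the type 'a \<Rightarrow>\<^sub>L real. On operators into
   the scalars the strong operator topology is pointwise convergence, i.e. the weak-star topology. *)
abbreviation weak_star_topology :: "('a::real_normed_vector \<Rightarrow>\<^sub>L real) topology" where
  "weak_star_topology \<equiv> strong_operator_topology"

lemma limitin_weak_star_iff:
  "limitin weak_star_topology Y l F \<longleftrightarrow>
    (\<forall>u. ((\<lambda>i. blinfun_apply (Y i) u) \<longlongrightarrow> blinfun_apply l u) F)"
proof
  assume "limitin weak_star_topology Y l F"
  then show "\<forall>u. ((\<lambda>i. blinfun_apply (Y i) u) \<longlongrightarrow> blinfun_apply l u) F"
    using continuous_map_limit[OF strong_operator_topology_continuous_evaluation]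
    by (fastforce simp: comp_def)
next
  assume *: "\<forall>u. ((\<lambda>i. blinfun_apply (Y i) u) \<longlongrightarrow> blinfun_apply l u) F"
  have fn: "((\<lambda>i. blinfun_apply (Y i)) \<longlongrightarrow> blinfun_apply l) F"
    using * limitin_componentwise[of "\<lambda>_. euclidean" UNIV "\<lambda>i. blinfun_apply (Y i)" "blinfun_apply l" F]
    by (simp add: euclidean_product_topology extensional_def)
  show "limitin weak_star_topology Y l F"
    unfolding limitin_def
  proof (intro conjI allI impI)
    show "l \<in> topspace weak_star_topology"
      by (simp add: strong_operator_topology_topspace)
    fix U :: "('a \<Rightarrow>\<^sub>L real) set"
    assume U: "openin weak_star_topology U \<and> l \<in> U"
    then obtain V where V: "open V" "U = blinfun_apply -` V"
      unfolding strong_operator_topology_def openin_pullback_topology by auto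
    then have "eventually (\<lambda>i. blinfun_apply (Y i) \<in> V) F"
      using fn U by (auto intro: topological_tendstoD)
    then show "eventually (\<lambda>i. Y i \<in> U) F"
      using V by simp
  qed
qed


definition lsc_at :: "('a::topological_space \<Rightarrow> ereal) \<Rightarrow> 'a \<Rightarrow> bool" where
  "lsc_at f x \<longleftrightarrow> f x \<le> Liminf (at x) f"

definition lsc_near :: "('a::topological_space \<Rightarrow> ereal) \<Rightarrow> 'a \<Rightarrow> bool" where
  "lsc_near f x \<longleftrightarrow> eventually (lsc_at f) (nhds x)"

definition lsc :: "('a::topological_space \<Rightarrow> ereal) \<Rightarrow> bool" where
  "lsc f \<longleftrightarrow> (\<forall>x. lsc_at f x)"

definition proper :: "('a \<Rightarrow> ereal) \<Rightarrow> bool" where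
  "proper f \<longleftrightarrow> (\<forall>x. f x \<noteq> -\<infinity>) \<and> (\<exists>x. f x \<noteq> \<infinity>)"


definition core_subdiff ::
  "('a::real_normed_vector \<Rightarrow> ereal) \<Rightarrow> 'a \<Rightarrow> ('a \<Rightarrow>\<^sub>L real) set" where
  "core_subdiff f x0 = {xs. \<bar>f x0\<bar> \<noteq> \<infinity> \<and>
     (\<exists>\<delta> :: real \<Rightarrow> real. (\<forall>\<epsilon>>0. \<delta> \<epsilon> > 0) \<and>
        Limsup (at_right 0) (\<lambda>\<epsilon>. ereal (\<delta> \<epsilon> / \<epsilon>)) = \<infinity> \<and>
        (\<forall>\<epsilon>>0. \<forall>x \<in> cball x0 (\<delta> \<epsilon>).
           f x0 + ereal (blinfun_apply xs (x - x0)) \<le> f x + ereal \<epsilon>))}"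

definition frechet_subdiff ::
  "('a::real_normed_vector \<Rightarrow> ereal) \<Rightarrow> 'a \<Rightarrow> ('a \<Rightarrow>\<^sub>L real) set" where
  "frechet_subdiff f x = {xs. \<bar>f x\<bar> \<noteq> \<infinity> \<and>
     Liminf (at x) (\<lambda>u. (f u - f x - ereal (blinfun_apply xs (u - x))) / ereal (norm (u - x))) \<ge> 0}"

definition fenchel_subdiff ::
  "('a::real_normed_vector \<Rightarrow> real) \<Rightarrow> 'a \<Rightarrow> ('a \<Rightarrow>\<^sub>L real) set" where
  "fenchel_subdiff g x = {xs. \<forall>u. g x + blinfun_apply xs (u - x) \<le> g u}"


definition directed_set :: "'i set \<Rightarrow> ('i \<Rightarrow> 'i \<Rightarrow> bool) \<Rightarrow> bool" where
  "directed_set I le \<longleftrightarrow> I \<noteq> {} \<and> reflp_on I le \<and> transp_on I le \<and>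
     (\<forall>i\<in>I. \<forall>j\<in>I. \<exists>k\<in>I. le i k \<and> le j k)"

definition net_filter :: "'i set \<Rightarrow> ('i \<Rightarrow> 'i \<Rightarrow> bool) \<Rightarrow> 'i filter" where
  "net_filter I le = (INF i\<in>I. principal {j \<in> I. le i j})"

lemma eventually_net_filter:
  assumes "directed_set I le"
  shows "eventually P (net_filter I le) \<longleftrightarrow> (\<exists>i\<in>I. \<forall>j\<in>I. le i j \<longrightarrow> P j)"
proof -
  have "eventually P (net_filter I le) \<longleftrightarrow> (\<exists>i\<in>I. eventually P (principal {j \<in> I. le i j}))"
    unfolding net_filter_def
  proof (rule eventually_INF_base)
    show "I \<noteq> {}"
      using assms by (simp add: directed_set_def)
    fix a b assume ab: "a \<in> I" "b \<in> I"
    then obtain k where "k \<in> I" "le a k" "le b k"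
      using assms by (auto simp: directed_set_def)
    moreover have "transp_on I le"
      using assms by (simp add: directed_set_def)
    ultimately show "\<exists>x\<in>I. principal {j \<in> I. le x j}
        \<le> inf (principal {j \<in> I. le a j}) (principal {j \<in> I. le b j})"
      using ab by (intro bexI[of _ k]) (auto dest: transp_onD)
  qed
  then show ?thesis
    by (auto simp: eventually_principal)
qed

(* (y, ys) is a net over the directed set (I, le), contained in the graph of D f, that converges
   to (x, xs) in s \<times> w^* with convergence of the values of f. *)
definition outer_limit_net ::
  "(('a::real_normed_vector \<Rightarrow> ereal) \<Rightarrow> 'a \<Rightarrow> ('a \<Rightarrow>\<^sub>L real) set) \<Rightarrow> ('a \<Rightarrow> ereal) \<Rightarrow> 'a \<Rightarrow>
   ('a \<Rightarrow>\<^sub>L real) \<Rightarrow> 'i set \<Rightarrow> ('i \<Rightarrow> 'i \<Rightarrow> bool) \<Rightarrow> ('i \<Rightarrow> 'a) \<Rightarrow> ('i \<Rightarrow> 'a \<Rightarrow>\<^sub>L real) \<Rightarrow> bool" where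
  "outer_limit_net D f x xs I le y ys \<longleftrightarrow>
     directed_set I le \<and>
     (\<forall>i\<in>I. ys i \<in> D f (y i)) \<and>
     (y \<longlongrightarrow> x) (net_filter I le) \<and>
     limitin weak_star_topology ys xs (net_filter I le) \<and>
     ((\<lambda>i. f (y i)) \<longlongrightarrow> f x) (net_filter I le)"

(* HOL cannot quantify over the index type inside a definition. Sets of pairs (y, ys) are enough
   as indices: outer_limitI below shows that a net over any index type yields membership. *)
definition outer_limit ::
  "(('a::real_normed_vector \<Rightarrow> ereal) \<Rightarrow> 'a \<Rightarrow> ('a \<Rightarrow>\<^sub>L real) set) \<Rightarrow> ('a \<Rightarrow> ereal) \<Rightarrow> 'a \<Rightarrow>
   ('a \<Rightarrow>\<^sub>L real) set" where
  "outer_limit D f x = {xs.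
     \<exists>(I :: ('a \<times> ('a \<Rightarrow>\<^sub>L real)) set set) le y ys. outer_limit_net D f x xs I le y ys}"

lemma outer_limitI:
  fixes I :: "'i set"
  assumes net: "outer_limit_net D f x xs I le y ys"
  shows "xs \<in> outer_limit D f x"
proof -
  define F where "F = net_filter I le"
  have dir: "directed_set I le" and D: "\<And>i. i \<in> I \<Longrightarrow> ys i \<in> D f (y i)"
    and y: "(y \<longlongrightarrow> x) F" and ys: "limitin weak_star_topology ys xs F"
    and fy: "((\<lambda>i. f (y i)) \<longlongrightarrow> f x) F"
    using net by (auto simp: outer_limit_net_def F_def)
  define N where "N A B C = {p. fst p \<in> A \<and> snd p \<in> B \<and> f (fst p) \<in> C \<and> snd p \<in> D f (fst p)}"
    for A B C
  define J where "J = {N A B C |A B C. open A \<and> x \<in> A \<and> openin weak_star_topology B \<and> xs \<in> B \<and>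
    open C \<and> f x \<in> C}"
  define ge where "ge = (\<lambda>V W :: ('a \<times> ('a \<Rightarrow>\<^sub>L real)) set. W \<subseteq> V)"
  define c where "c V = (SOME p. p \<in> V)" for V :: "('a \<times> ('a \<Rightarrow>\<^sub>L real)) set"
  have NJ: "N A B C \<in> J" if "open A" "x \<in> A" "openin weak_star_topology B" "xs \<in> B" "open C" "f x \<in> C"
    for A B C using that unfolding J_def by blast
  have uni: "openin weak_star_topology UNIV"
    by (metis openin_topspace strong_operator_topology_topspace)
  have dJ: "directed_set J ge"
    unfolding directed_set_def
  proof (intro conjI ballI)
    show "J \<noteq> {}"
      using NJ[of UNIV UNIV UNIV] uni by auto
    show "reflp_on J ge" "transp_on J ge"
      by (auto simp: ge_def reflp_on_def transp_on_def)
    fix V W assume "V \<in> J" "W \<in> J"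
    then obtain A B C A' B' C' where *: "V = N A B C" "W = N A' B' C'"
      "open A" "x \<in> A" "openin weak_star_topology B" "xs \<in> B" "open C" "f x \<in> C"
      "open A'" "x \<in> A'" "openin weak_star_topology B'" "xs \<in> B'" "open C'" "f x \<in> C'"
      unfolding J_def by blast
    then have "N (A \<inter> A') (B \<inter> B') (C \<inter> C') \<in> J"
      by (intro NJ) auto
    then show "\<exists>k\<in>J. ge V k \<and> ge W k"
      by (rule bexI[rotated]) (auto simp: ge_def * N_def)
  qed
  have c: "c V \<in> V" if V: "V \<in> J" for V
  proof -
    obtain A B C where *: "V = N A B C"
      "open A" "x \<in> A" "openin weak_star_topology B" "xs \<in> B" "open C" "f x \<in> C"
      using V unfolding J_def by blast
    have "eventually (\<lambda>i. y i \<in> A) F" "eventually (\<lambda>i. f (y i) \<in> C) F"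
      using y fy * by (auto intro: topological_tendstoD)
    moreover have "eventually (\<lambda>i. ys i \<in> B) F"
      using ys * by (auto simp: limitin_def)
    ultimately have "eventually (\<lambda>i. y i \<in> A \<and> f (y i) \<in> C \<and> ys i \<in> B) F"
      by (auto intro: eventually_conj)
    then obtain i where i: "i \<in> I" "\<And>j. j \<in> I \<Longrightarrow> le i j \<Longrightarrow> y j \<in> A \<and> f (y j) \<in> C \<and> ys j \<in> B"
      unfolding F_def eventually_net_filter[OF dir] by blast
    moreover have "le i i"
      using i(1) dir by (auto simp: directed_set_def dest: reflp_onD)
    ultimately have "(y i, ys i) \<in> V"
      using D by (auto simp: * N_def)
    then show ?thesis
      unfolding c_def by (rule someI)
  qed
  have ev: "eventually P (net_filter J ge)"
    if "open A" "x \<in> A" "openin weak_star_topology B" "xs \<in> B" "open C" "f x \<in> C"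
      and P: "\<And>V. c V \<in> N A B C \<Longrightarrow> P V" for A B C P
    unfolding eventually_net_filter[OF dJ]
  proof (intro bexI ballI impI)
    show "N A B C \<in> J"
      using that by (intro NJ)
    fix V assume "V \<in> J" "ge (N A B C) V"
    then show "P V"
      using c P by (auto simp: ge_def)
  qed
  have "outer_limit_net D f x xs J ge (\<lambda>V. fst (c V)) (\<lambda>V. snd (c V))"
    unfolding outer_limit_net_def
  proof (intro conjI ballI)
    show "directed_set J ge"
      by (fact dJ)
    show "snd (c V) \<in> D f (fst (c V))" if "V \<in> J" for V
      using c[OF that] that by (auto simp: J_def N_def)
    show "((\<lambda>V. fst (c V)) \<longlongrightarrow> x) (net_filter J ge)"
    proof (rule topological_tendstoI)
      fix S assume "open S" "x \<in> S"
      then show "eventually (\<lambda>V. fst (c V) \<in> S) (net_filter J ge)"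
        by (intro ev[of S UNIV UNIV]) (auto simp: uni N_def)
    qed
    show "((\<lambda>V. f (fst (c V))) \<longlongrightarrow> f x) (net_filter J ge)"
    proof (rule topological_tendstoI)
      fix S assume "open S" "f x \<in> S"
      then show "eventually (\<lambda>V. f (fst (c V)) \<in> S) (net_filter J ge)"
        by (intro ev[of UNIV UNIV S]) (auto simp: uni N_def)
    qed
    show "limitin weak_star_topology (\<lambda>V. snd (c V)) xs (net_filter J ge)"
      unfolding limitin_def
    proof (intro conjI allI impI)
      show "xs \<in> topspace weak_star_topology"
        by (simp add: strong_operator_topology_topspace)
      fix S assume "openin weak_star_topology S \<and> xs \<in> S"
      then show "eventually (\<lambda>V. snd (c V) \<in> S) (net_filter J ge)"
        by (intro ev[of UNIV S UNIV]) (auto simp: N_def)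
    qed
  qed
  then show ?thesis
    unfolding outer_limit_def by blast
qed

definition limiting_subdiff ::
  "('a::real_normed_vector \<Rightarrow> ereal) \<Rightarrow> 'a \<Rightarrow> ('a \<Rightarrow>\<^sub>L real) set" where
  "limiting_subdiff f x = outer_limit frechet_subdiff f x"

(* The sum in the conclusion is the Minkowski sum of two subsets of the dual. *)
definition abstract_subdifferential_on ::
  "(('a::real_normed_vector \<Rightarrow> ereal) \<Rightarrow> 'a \<Rightarrow> ('a \<Rightarrow>\<^sub>L real) set) \<Rightarrow> ('a \<Rightarrow> ereal) set \<Rightarrow> bool" where
  "abstract_subdifferential_on D \<F> \<longleftrightarrow>
     (\<forall>f\<in>\<F>. \<forall>(g :: 'a \<Rightarrow> real) x.
        convex_on UNIV g \<and> continuous_on UNIV g \<and> \<bar>f x\<bar> \<noteq> \<infinity> \<and> lsc_near f x \<and>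
        eventually (\<lambda>u. f x + ereal (g x) \<le> f u + ereal (g u)) (nhds x)
        \<longrightarrow> 0 \<in> outer_limit D f x + fenchel_subdiff g x)"

(* Asplund space: a Banach space on which every continuous convex function on a nonempty open convex
   set is Frechet differentiable at the points of a dense G_delta subset of that set. On normed
   spaces, differentiable means Frechet differentiable with a bounded linear derivative. *)
definition asplund_space :: "'a::real_normed_vector itself \<Rightarrow> bool" where
  "asplund_space T \<longleftrightarrow> complete (UNIV :: 'a set) \<and>
     (\<forall>(U :: 'a set) (\<phi> :: 'a \<Rightarrow> real).
        open U \<and> U \<noteq> {} \<and> convex_on U \<phi> \<and> continuous_on U \<phi> \<longrightarrow>
        (\<exists>G. gdelta_in euclidean G \<and> G \<subseteq> U \<and> U \<subseteq> closure G \<and>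
             (\<forall>x\<in>G. \<phi> differentiable (at x))))"

end

theory Submission
  imports Defs
begin

text \<open>
  Part (a) is a rescaling. If the error of the Frechet inequality is at most \<open>k * norm (u - x0)\<close> on
  some ball around \<open>x0\<close>, then it is at most \<open>\<epsilon>\<close> on the ball of radius \<open>\<epsilon> / k\<close> as soon as \<open>\<epsilon>\<close> is
  small, and \<open>k\<close> is arbitrary (\<open>frechet_subset_core\<close>).

  For part (b) let \<open>xs\<close> be a core subgradient and take \<open>\<epsilon>\<close> with \<open>\<delta> \<epsilon> / \<epsilon>\<close> large. Up to \<open>\<epsilon>\<close>, the point
  \<open>x0\<close> minimizes \<open>f - xs\<close> on a ball whose radius is large compared with \<open>\<epsilon>\<close>. A variational principle
  (\<open>smooth_variational_principle\<close>, used with the norm as gauge) gives an interior point \<open>z\<close> that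
  minimizes \<open>f - xs\<close> plus a convex function with a small Lipschitz constant, and property [P] at \<open>z\<close>
  produces a limiting subgradient at \<open>z\<close> close to \<open>xs\<close> (\<open>core_subdiff_approx\<close>). A diagonal argument
  over weak-star neighbourhoods finishes the proof (\<open>core_subset_limiting\<close>).

  The Asplund case needs property [P] for the Frechet subdifferential, which is a theorem of Fabian
  (\<open>asplund_abstract_subdifferential\<close>). The proof is a separable reduction.

  \<^item> Differentiability of support functions gives slices of small diameter in the dual ball, and these
    force every separable subspace \<open>Y\<close> to have a separable dual (\<open>asplund_separable_dual\<close>).

  \<^item> A countable dense set in the dual of \<open>Y\<close> allows one to write down a function \<open>p\<close>, comparable to the
    squared norm on \<open>Y\<close>, that has a Frechet supergradient along \<open>Y\<close> at every point of \<open>Y\<close>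
    (\<open>p_superdiff\<close>). It is the conjugate of a strictly convex dual gauge with the Kadec property.

  \<^item> The variational principle with gauge \<open>p\<close>, applied to \<open>f u + g w + lam * p (u - w)\<close>, decouples the
    sum \<open>f + g\<close>: at the minimizing pair, \<open>f\<close> and \<open>g\<close> have subgradients along \<open>Y\<close> whose sum is small
    (\<open>fuzzy_sum_on_subspace\<close>).

  \<^item> If \<open>Y\<close> is the closure of a countable set that contains approximate solutions of countably many
    systems of inequalities (\<open>reflects\<close>), then each subgradient along \<open>Y\<close> extends to a subgradient on
    the whole space (\<open>subgradient_extension\<close>), by a Hahn-Banach argument.

  \<^item> Choosing \<open>Y\<close> so that it contains a given finite set \<open>Ls\<close> makes the sum of the two subgradients small
    on \<open>Ls\<close> only, not in norm (\<open>asplund_weak_fuzzy_sum\<close>). This is enough for a weak-star limit: the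
    subgradients of \<open>g\<close> are bounded, so they have a weak-star cluster point.

  Functionals on a subspace \<open>Y\<close> are represented throughout by functionals on the whole space, compared
  by their restrictions to \<open>Y\<close>. In this way everything takes place in the one type \<open>'a\<close>, although \<open>Y\<close>
  depends on the function under consideration.
\<close>

section \<open>Extension of functionals\<close>

lemma mult_divide_cancel: "c \<noteq> 0 \<Longrightarrow> c * (x / c) = (x::real)"
  by simp

definition sublinear :: "('a::real_vector \<Rightarrow> real) \<Rightarrow> bool" where
  "sublinear q \<longleftrightarrow> (\<forall>x y. q (x + y) \<le> q x + q y) \<and> (\<forall>t x. 0 \<le> t \<longrightarrow> q (t *\<^sub>R x) = t * q x)"

lemma sublinearD:
  assumes "sublinear q"
  shows "q (x + y) \<le> q x + q y" and "0 \<le> t \<Longrightarrow> q (t *\<^sub>R x) = t * q x" and "q 0 = 0"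
    and "- q (- x) \<le> q x"
proof -
  show "q (x + y) \<le> q x + q y" and *: "0 \<le> t \<Longrightarrow> q (t *\<^sub>R x) = t * q x" for t x y
    using assms by (auto simp: sublinear_def)
  show 0: "q 0 = 0" using *[of 0 0] by simp
  have "q (x + - x) \<le> q x + q (- x)" using assms unfolding sublinear_def by blast
  then show "- q (- x) \<le> q x" using 0 by simp
qed

text \<open>
  The infimum over \<open>t \<ge> 0\<close> of \<open>p (x + t *\<^sub>R v) - t * p v\<close> is again sublinear and lies below \<open>p\<close>, so it
  equals \<open>p\<close>. Its value at \<open>- v\<close>, bounded by the choice \<open>t = 1\<close>, gives \<open>p (- v) \<le> - p v\<close>.
\<close>

lemma minimal_sublinear_odd:
  fixes p :: "'a::real_vector \<Rightarrow> real"
  assumes p: "sublinear p" and min: "\<And>r. sublinear r \<Longrightarrow> r \<le> p \<Longrightarrow> r = p"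
  shows "p (- v) = - p v"
proof -
  define r where "r x = (INF t\<in>{0..}. p (x + t *\<^sub>R v) - t * p v)" for x
  have bdd: "bdd_below ((\<lambda>t. p (x + t *\<^sub>R v) - t * p v) ` {0..})" for x
  proof (rule bdd_belowI2)
    fix t :: real assume t: "t \<in> {0..}"
    have "t * p v = p ((x + t *\<^sub>R v) + - x)"
      using sublinearD(2)[OF p, of t v] t by simp
    also have "\<dots> \<le> p (x + t *\<^sub>R v) + p (- x)" by (rule sublinearD(1)[OF p])
    finally show "- p (- x) \<le> p (x + t *\<^sub>R v) - t * p v" by simp
  qed
  have rle: "r x \<le> p (x + t *\<^sub>R v) - t * p v" if "0 \<le> t" for x t
    unfolding r_def using that by (intro cINF_lower bdd) auto
  have rge: "s \<le> r x" if "\<And>t. 0 \<le> t \<Longrightarrow> s \<le> p (x + t *\<^sub>R v) - t * p v" for x s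
    unfolding r_def using that by (intro cINF_greatest) auto
  have hom_le: "r (s *\<^sub>R x) \<le> s * r x" if s: "0 < s" for s x
  proof -
    have "r (s *\<^sub>R x) / s \<le> r x"
    proof (rule rge)
      fix t :: real assume t: "0 \<le> t"
      have "r (s *\<^sub>R x) \<le> p (s *\<^sub>R x + (s * t) *\<^sub>R v) - (s * t) * p v"
        using s t by (intro rle) simp
      also have "s *\<^sub>R x + (s * t) *\<^sub>R v = s *\<^sub>R (x + t *\<^sub>R v)" by (simp add: scaleR_add_right)
      also have "p (s *\<^sub>R (x + t *\<^sub>R v)) = s * p (x + t *\<^sub>R v)"
        using s by (intro sublinearD(2)[OF p]) simp
      finally show "r (s *\<^sub>R x) / s \<le> p (x + t *\<^sub>R v) - t * p v"
        using s by (simp add: field_simps)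
    qed
    then show ?thesis using s by (simp add: field_simps)
  qed
  have "sublinear r"
    unfolding sublinear_def
  proof (intro conjI allI impI)
    fix x y
    have "r (x + y) - r y \<le> r x"
    proof (rule rge)
      fix t :: real assume t: "0 \<le> t"
      have "r (x + y) - (p (x + t *\<^sub>R v) - t * p v) \<le> r y"
      proof (rule rge)
        fix s :: real assume s: "0 \<le> s"
        have "r (x + y) \<le> p (x + y + (t + s) *\<^sub>R v) - (t + s) * p v"
          using s t by (intro rle) simp
        also have "x + y + (t + s) *\<^sub>R v = (x + t *\<^sub>R v) + (y + s *\<^sub>R v)" by (simp add: scaleR_add_left)
        also have "p \<dots> \<le> p (x + t *\<^sub>R v) + p (y + s *\<^sub>R v)" by (rule sublinearD(1)[OF p])
        finally show "r (x + y) - (p (x + t *\<^sub>R v) - t * p v) \<le> p (y + s *\<^sub>R v) - s * p v"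
          by (simp add: algebra_simps)
      qed
      then show "r (x + y) - r y \<le> p (x + t *\<^sub>R v) - t * p v" by simp
    qed
    then show "r (x + y) \<le> r x + r y" by simp
  next
    fix s :: real and x assume s: "0 \<le> s"
    show "r (s *\<^sub>R x) = s * r x"
    proof (cases "s = 0")
      case True
      have "r 0 \<le> 0" using rle[of 0 0] sublinearD(3)[OF p] by simp
      moreover have "0 \<le> r 0"
        by (rule rge) (use sublinearD(2)[OF p] in simp)
      ultimately show ?thesis using True by simp
    next
      case False
      then have s0: "0 < s" using s by simp
      have "r ((1/s) *\<^sub>R (s *\<^sub>R x)) \<le> (1/s) * r (s *\<^sub>R x)" using s0 by (intro hom_le) simp
      then have "s * r x \<le> r (s *\<^sub>R x)" using s0 by (simp add: field_simps)
      then show ?thesis using hom_le[OF s0, of x] by simp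
    qed
  qed
  moreover have "r \<le> p"
    using rle[of 0] by (simp add: le_fun_def)
  ultimately have "r = p" by (rule min)
  then have "p (- v) \<le> - p v"
    using rle[of 1 "- v"] sublinearD(3)[OF p] by simp
  moreover have "- p v \<le> p (- v)" using sublinearD(4)[OF p, of "- v"] by simp
  ultimately show ?thesis by simp
qed

text \<open>
  This is the algebraic core of the Hahn-Banach theorem. Zorn's lemma provides a minimal sublinear
  functional below \<open>q\<close> (the pointwise infimum of a chain is sublinear), and a minimal one is odd,
  hence linear.
\<close>

lemma ex_linear_le_sublinear:
  fixes q :: "'a::real_vector \<Rightarrow> real"
  assumes q: "sublinear q"
  obtains L where "linear L" "\<And>x. L x \<le> q x"
proof -
  define A where "A = {p. sublinear p \<and> p \<le> q}"
  define P where "P = (\<lambda>a b :: 'a \<Rightarrow> real. b \<le> a)"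
  have "\<exists>m\<in>A. \<forall>a\<in>A. P m a \<longrightarrow> a = m"
  proof (rule predicate_Zorn)
    show "partial_order_on A (relation_of P A)"
      unfolding P_def by (rule partial_order_on_relation_ofI) auto
    fix C assume C: "C \<in> Chains (relation_of P A)"
    then have CA: "C \<subseteq> A" and lin: "\<And>a b. a \<in> C \<Longrightarrow> b \<in> C \<Longrightarrow> a \<le> b \<or> b \<le> a"
      unfolding Chains_def relation_of_def P_def by auto
    show "\<exists>u\<in>A. \<forall>a\<in>C. P a u"
    proof (cases "C = {}")
      case True
      then show ?thesis using q by (auto simp: A_def)
    next
      case False
      define u where "u x = (INF p\<in>C. p x)" for x
      have subl: "sublinear p" and leq: "p x \<le> q x" if "p \<in> C" for p x
        using that CA by (auto simp: A_def le_fun_def)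
      have bdd: "bdd_below ((\<lambda>p. p x) ` C)" for x
      proof (rule bdd_belowI2)
        fix p assume "p \<in> C"
        then show "- q (- x) \<le> p x"
          using sublinearD(4)[OF subl, of p x] leq[of p "- x"] by simp
      qed
      have ule: "u x \<le> p x" if "p \<in> C" for p x
        unfolding u_def using that by (intro cINF_lower bdd)
      have uge: "s \<le> u x" if "\<And>p. p \<in> C \<Longrightarrow> s \<le> p x" for s x
        unfolding u_def using that False by (intro cINF_greatest) auto
      have "sublinear u"
        unfolding sublinear_def
      proof (intro conjI allI impI)
        fix x y
        have "u (x + y) - u y \<le> u x"
        proof (rule uge)
          fix p assume p: "p \<in> C"
          have "u (x + y) - p x \<le> u y"
          proof (rule uge)
            fix p' assume p': "p' \<in> C"
            obtain r where r: "r \<in> C" "r \<le> p" "r \<le> p'"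
              using lin[OF p p'] p p' by blast
            have "u (x + y) \<le> r x + r y"
              using ule[OF r(1)] sublinearD(1)[OF subl[OF r(1)], of x y] order_trans by blast
            also have "\<dots> \<le> p x + p' y" using r by (intro add_mono) (auto simp: le_fun_def)
            finally show "u (x + y) - p x \<le> p' y" by simp
          qed
          then show "u (x + y) - u y \<le> p x" by simp
        qed
        then show "u (x + y) \<le> u x + u y" by simp
      next
        fix t :: real and x assume t: "0 \<le> t"
        show "u (t *\<^sub>R x) = t * u x"
        proof (cases "t = 0")
          case True
          have "u 0 = 0"
          proof -
            have "(\<lambda>p. p 0) ` C = (\<lambda>p. 0) ` C"
              by (intro image_cong refl sublinearD(3)[OF subl])
            then have "(\<lambda>p. p 0) ` C = {0}" using False by (simp add: image_constant_conv)
            then show ?thesis by (simp add: u_def)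
          qed
          then show ?thesis using True by simp
        next
          case f: False
          with t have t: "0 < t" by simp
          show ?thesis
          proof (rule antisym)
            have "u (t *\<^sub>R x) / t \<le> u x"
            proof (rule uge)
              fix p assume p: "p \<in> C"
              show "u (t *\<^sub>R x) / t \<le> p x"
                using ule[OF p, of "t *\<^sub>R x"] sublinearD(2)[OF subl[OF p], of t x] t
                by (simp add: field_simps)
            qed
            then show "u (t *\<^sub>R x) \<le> t * u x" using t by (simp add: field_simps)
            show "t * u x \<le> u (t *\<^sub>R x)"
            proof (rule uge)
              fix p assume p: "p \<in> C"
              show "t * u x \<le> p (t *\<^sub>R x)"
                using ule[OF p, of x] sublinearD(2)[OF subl[OF p], of t x] t by simp
            qed
          qed
        qed
      qed
      moreover have "u \<le> q"
      proof (rule le_funI)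
        fix x
        obtain p where "p \<in> C" using False by blast
        then show "u x \<le> q x" using ule leq order_trans by blast
      qed
      ultimately have "u \<in> A" by (simp add: A_def)
      then show ?thesis using ule by (auto simp: P_def le_fun_def)
    qed
  qed
  then obtain m where mA: "m \<in> A" and mmin: "\<And>a. a \<in> A \<Longrightarrow> a \<le> m \<Longrightarrow> a = m"
    unfolding P_def by blast
  have m: "sublinear m" and mq: "m \<le> q" using mA by (auto simp: A_def)
  have odd: "m (- v) = - m v" for v
    by (rule minimal_sublinear_odd[OF m]) (use mmin mq in \<open>auto simp: A_def\<close>)
  have "linear m"
  proof (rule linearI)
    fix x y
    have "m (- x + - y) \<le> m (- x) + m (- y)" by (rule sublinearD(1)[OF m])
    moreover have "m (- x + - y) = - m (x + y)" using odd[of "x + y"] by simp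
    ultimately show "m (x + y) = m x + m y"
      using sublinearD(1)[OF m, of x y] by (simp add: odd)
  next
    fix r :: real and x
    show "m (r *\<^sub>R x) = r *\<^sub>R m x"
    proof (cases "0 \<le> r")
      case True
      then show ?thesis using sublinearD(2)[OF m] by simp
    next
      case False
      then have "m ((- r) *\<^sub>R x) = (- r) * m x" by (intro sublinearD(2)[OF m]) simp
      then show ?thesis using odd[of "r *\<^sub>R x"] by simp
    qed
  qed
  then show ?thesis using that mq by (auto simp: le_fun_def)
qed

text \<open>
  A form of the Hahn-Banach theorem suited to systems of inequalities. The elements \<open>(h, r)\<close> of the
  convex cone \<open>T\<close> are constraints \<open>a h \<le> r\<close>, and \<open>0 \<le> r + c * norm h\<close> is the obvious necessary
  condition for a solution with \<open>norm a \<le> c\<close>. It is also sufficient, because the infimum of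
  \<open>r + c * norm (v - h)\<close> over \<open>T\<close> is a sublinear functional of \<open>v\<close> and any linear functional below it
  is a solution.
\<close>

lemma functional_below_cone:
  fixes T :: "('a::real_normed_vector \<times> real) set"
  assumes zero: "(0, 0) \<in> T"
    and add: "\<And>h r k s. (h, r) \<in> T \<Longrightarrow> (k, s) \<in> T \<Longrightarrow> (h + k, r + s) \<in> T"
    and scale: "\<And>t h r. 0 < t \<Longrightarrow> (h, r) \<in> T \<Longrightarrow> (t *\<^sub>R h, t * r) \<in> T"
    and pos: "\<And>h r. (h, r) \<in> T \<Longrightarrow> 0 \<le> r + c * norm h" and c: "0 \<le> c"
  obtains a :: "'a \<Rightarrow>\<^sub>L real" where "norm a \<le> c" "\<And>h r. (h, r) \<in> T \<Longrightarrow> blinfun_apply a h \<le> r"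
proof -
  define q where "q v = (INF (h, r)\<in>T. r + c * norm (v - h))" for v
  have bdd: "bdd_below ((\<lambda>(h, r). r + c * norm (v - h)) ` T)" for v
  proof (rule bdd_belowI2)
    fix x assume x: "x \<in> T"
    obtain h r where [simp]: "x = (h, r)" by fastforce
    have "norm h \<le> norm v + norm (v - h)"
      by (metis norm_minus_commute norm_triangle_sub)
    then have "c * norm h \<le> c * norm v + c * norm (v - h)"
      using c by (metis distrib_left mult_left_mono)
    then show "- c * norm v \<le> (case x of (h, r) \<Rightarrow> r + c * norm (v - h))"
      using pos[of h r] x by simp
  qed
  have qle: "q v \<le> r + c * norm (v - h)" if "(h, r) \<in> T" for v h r
    unfolding q_def using cINF_lower[OF bdd that, of v] by simp
  have qge: "s \<le> q v" if "\<And>h r. (h, r) \<in> T \<Longrightarrow> s \<le> r + c * norm (v - h)" for s v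
    unfolding q_def using zero that by (intro cINF_greatest) auto
  have hom_le: "q (t *\<^sub>R v) \<le> t * q v" if t: "0 < t" for t v
  proof -
    have "q (t *\<^sub>R v) / t \<le> q v"
    proof (rule qge)
      fix h r assume "(h, r) \<in> T"
      then have "q (t *\<^sub>R v) \<le> t * r + c * norm (t *\<^sub>R v - t *\<^sub>R h)"
        by (intro qle scale t)
      also have "norm (t *\<^sub>R v - t *\<^sub>R h) = t * norm (v - h)"
        using t by (metis abs_of_pos norm_scaleR scaleR_diff_right)
      finally show "q (t *\<^sub>R v) / t \<le> r + c * norm (v - h)"
        using t by (simp add: field_simps)
    qed
    then show ?thesis using t by (simp add: field_simps)
  qed
  have "sublinear q"
    unfolding sublinear_def
  proof (intro conjI allI impI)
    fix x y
    have "q (x + y) - q y \<le> q x"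
    proof (rule qge)
      fix h r assume hr: "(h, r) \<in> T"
      have "q (x + y) - (r + c * norm (x - h)) \<le> q y"
      proof (rule qge)
        fix k s assume ks: "(k, s) \<in> T"
        have "q (x + y) \<le> (r + s) + c * norm (x + y - (h + k))"
          by (intro qle add hr ks)
        also have "c * norm (x + y - (h + k)) \<le> c * (norm (x - h) + norm (y - k))"
          by (intro mult_left_mono c) (metis add_diff_add norm_triangle_ineq)
        finally show "q (x + y) - (r + c * norm (x - h)) \<le> s + c * norm (y - k)"
          by (simp add: algebra_simps)
      qed
      then show "q (x + y) - q y \<le> r + c * norm (x - h)" by simp
    qed
    then show "q (x + y) \<le> q x + q y" by simp
  next
    fix t :: real and x assume t: "0 \<le> t"
    show "q (t *\<^sub>R x) = t * q x"
    proof (cases "t = 0")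
      case True
      have "q 0 \<le> 0" using qle[OF zero, of 0] by simp
      moreover have "0 \<le> q 0" by (rule qge) (use pos in simp)
      ultimately show ?thesis using True by simp
    next
      case False
      then have t0: "0 < t" using t by simp
      have "q ((1/t) *\<^sub>R (t *\<^sub>R x)) \<le> (1/t) * q (t *\<^sub>R x)" using t0 by (intro hom_le) simp
      then have "t * q x \<le> q (t *\<^sub>R x)" using t0 by (simp add: field_simps)
      then show ?thesis using hom_le[OF t0, of x] by simp
    qed
  qed
  then obtain L where L: "linear L" and Lq: "\<And>x. L x \<le> q x"
    by (rule ex_linear_le_sublinear) blast
  have Lle: "L x \<le> c * norm x" for x
    using Lq[of x] qle[OF zero, of x] by simp
  have Labs: "\<bar>L x\<bar> \<le> c * norm x" for x
    using Lle[of x] Lle[of "- x"] linear_neg[OF L, of x] by simp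
  have bl: "bounded_linear L"
    using L by (rule linear_conv_bounded_linear[THEN iffD1, OF _, OF _] | intro bounded_linear_intro[where K=c])
      (use Labs L in \<open>auto simp: linear_add linear_scale mult.commute\<close>)
  define a where "a = Blinfun L"
  have ap: "blinfun_apply a = L" unfolding a_def by (rule bounded_linear_Blinfun_apply[OF bl])
  show ?thesis
  proof
    show "norm a \<le> c" using c Labs by (intro norm_blinfun_bound) (auto simp: ap)
    fix h r assume "(h, r) \<in> T"
    then show "blinfun_apply a h \<le> r" using Lq[of h] qle[of h r h] by (simp add: ap)
  qed
qed

lemma functional_extension:
  fixes Y :: "'a::real_normed_vector set"
  assumes Y: "subspace Y" and add: "\<And>x y. x \<in> Y \<Longrightarrow> y \<in> Y \<Longrightarrow> l (x + y) = l x + l y"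
    and scale: "\<And>t x. x \<in> Y \<Longrightarrow> l (t *\<^sub>R x) = t * l x"
    and bound: "\<And>x. x \<in> Y \<Longrightarrow> \<bar>l x\<bar> \<le> c * norm x" and c: "0 \<le> c"
  obtains a :: "'a \<Rightarrow>\<^sub>L real" where "norm a \<le> c" "\<And>x. x \<in> Y \<Longrightarrow> blinfun_apply a x = l x"
proof -
  define T where "T = {(x, l x) |x. x \<in> Y}"
  have 0: "0 \<in> Y" using Y by (rule subspace_0)
  have l0: "l 0 = 0" using scale[OF 0, of 0] by simp
  obtain a :: "'a \<Rightarrow>\<^sub>L real" where a: "norm a \<le> c" "\<And>h r. (h, r) \<in> T \<Longrightarrow> blinfun_apply a h \<le> r"
  proof (rule functional_below_cone[of T c])
    show "(0, 0) \<in> T" using 0 l0 by (auto simp: T_def)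
    show "(h + k, r + s) \<in> T" if "(h, r) \<in> T" "(k, s) \<in> T" for h r k s
      using that Y add by (auto simp: T_def subspace_add)
    show "(t *\<^sub>R h, t * r) \<in> T" if "0 < t" "(h, r) \<in> T" for t h r
      using that Y scale by (auto simp: T_def subspace_scale)
    show "0 \<le> r + c * norm h" if "(h, r) \<in> T" for h r
      using that bound[of h] by (auto simp: T_def)
  qed (use c in auto)
  show ?thesis
  proof
    show "norm a \<le> c" by fact
    fix x assume x: "x \<in> Y"
    have le: "blinfun_apply a y \<le> l y" if "y \<in> Y" for y
      using a(2)[of y "l y"] that by (auto simp: T_def)
    have "l (- x) = - l x" using scale[OF x, of "-1"] by simp
    then show "blinfun_apply a x = l x"
      using le[OF x] le[of "- x"] Y x by (simp add: subspace_neg blinfun.minus_right)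
  qed
qed

section \<open>Small slices of the dual ball\<close>

definition dual_ball :: "real \<Rightarrow> ('a::real_normed_vector \<Rightarrow> real) set" where
  "dual_ball c = {\<phi>. linear \<phi> \<and> (\<forall>x. \<bar>\<phi> x\<bar> \<le> c * norm x)}"

lemma closed_coordinate_set:
  assumes "closed S"
  shows "closed {\<phi> :: 'i \<Rightarrow> 'b::topological_space. \<phi> x \<in> S}"
  using continuous_closed_preimage[OF continuous_on_product_coordinates closed_UNIV assms]
  by (simp add: vimage_def)

lemma closed_dual_ball: "closed (dual_ball c :: ('a::real_normed_vector \<Rightarrow> real) set)"
proof -
  have ev: "continuous_on UNIV (\<lambda>\<phi> :: 'a \<Rightarrow> real. \<phi> x)" for x by simp
  have "dual_ball c = (\<Inter>x. \<Inter>y. {\<phi> :: 'a \<Rightarrow> real. \<phi> (x + y) = \<phi> x + \<phi> y})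
    \<inter> (\<Inter>r. \<Inter>x. {\<phi>. \<phi> (r *\<^sub>R x) = r *\<^sub>R \<phi> x}) \<inter> (\<Inter>x. {\<phi>. \<bar>\<phi> x\<bar> \<le> c * norm x})"
    by (auto simp: dual_ball_def linear_iff)
  moreover have "closed \<dots>"
    by (intro closed_Int closed_INT ballI closed_Collect_eq closed_Collect_le continuous_intros ev)
  ultimately show ?thesis by simp
qed

text \<open>
  Weak-star convergence on bounded sets of functionals is convergence in the product topology of the
  function type, so the Banach-Alaoglu theorem becomes a case of Tychonoff's theorem.
\<close>

lemma compact_dual_ball: "compact (dual_ball c :: ('a::real_normed_vector \<Rightarrow> real) set)"
proof -
  let ?P = "PiE UNIV (\<lambda>x::'a. {- (c * norm x)..c * norm x})"
  have "compactin (product_topology (\<lambda>_::'a. euclidean :: real topology) UNIV) ?P"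
    by (subst compactin_PiE) auto
  then have "compact ?P"
    by (simp add: euclidean_product_topology)
  moreover have "dual_ball c \<subseteq> ?P"
    by (auto simp: dual_ball_def PiE_UNIV_domain abs_le_iff minus_le_iff)
  ultimately show ?thesis by (metis closed_dual_ball compact_Int_closed inf.absorb2)
qed

lemma dual_ballD:
  assumes "\<phi> \<in> dual_ball c"
  shows "linear \<phi>" "\<bar>\<phi> x\<bar> \<le> c * norm x" "\<bar>\<phi> x - \<phi> y\<bar> \<le> c * norm (x - y)"
  using assms linear_diff[of \<phi> x y] unfolding dual_ball_def by (auto simp: simp flip: linear_diff)

lemma blinfun_mem_dual_ball: "norm a \<le> c \<Longrightarrow> blinfun_apply a \<in> dual_ball c"
  for a :: "'a::real_normed_vector \<Rightarrow>\<^sub>L real"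
  unfolding dual_ball_def
  by (auto intro: blinfun.bounded_linear_right bounded_linear.linear
        order_trans[OF norm_blinfun[of a, unfolded real_norm_def] mult_right_mono])

lemma dual_ball_blinfun:
  assumes "\<phi> \<in> dual_ball c" "0 \<le> c"
  obtains a where "norm a \<le> c" "blinfun_apply a = \<phi>"
proof -
  have bl: "bounded_linear \<phi>"
    using dual_ballD[OF assms(1)]
    by (intro bounded_linear_intro[where K=c]) (auto simp: linear_add linear_scale mult.commute)
  show ?thesis
  proof
    show ap: "blinfun_apply (Blinfun \<phi>) = \<phi>" by (rule bounded_linear_Blinfun_apply[OF bl])
    show "norm (Blinfun \<phi>) \<le> c"
      using assms(2) dual_ballD(2)[OF assms(1)] by (intro norm_blinfun_bound) (auto simp: ap)
  qed
qed

text \<open>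
  The support function \<open>\<sigma>\<close> of \<open>A\<close> is convex and Lipschitz, so it has a point \<open>x\<close> of Frechet
  differentiability. If \<open>\<phi> x\<close> is within \<open>k * r\<close> of \<open>\<sigma> x\<close>, then \<open>\<phi> (x + h) \<le> \<sigma> (x + h)\<close> with
  \<open>norm h = r\<close> shows that \<open>\<phi>\<close> differs from the derivative by at most \<open>2 * k\<close> in norm. So all members of
  the slice are close to one functional.
\<close>

lemma asplund_small_slice:
  fixes A :: "('a::real_normed_vector \<Rightarrow> real) set"
  assumes asp: "asplund_space TYPE('a)" and A: "A \<subseteq> dual_ball 1" "A \<noteq> {}" and e: "0 < e"
  obtains x s where "\<exists>\<phi>\<in>A. s < \<phi> x"
    "\<And>\<phi> \<psi> y. \<phi> \<in> A \<Longrightarrow> \<psi> \<in> A \<Longrightarrow> s < \<phi> x \<Longrightarrow> s < \<psi> x \<Longrightarrow> \<bar>\<phi> y - \<psi> y\<bar> \<le> e * norm y"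
proof -
  define \<sigma> where "\<sigma> x = (SUP \<phi>\<in>A. \<phi> x)" for x
  have lin: "linear \<phi>" and nb: "\<bar>\<phi> x\<bar> \<le> norm x" if "\<phi> \<in> A" for \<phi> x
    using dual_ballD(1,2)[of \<phi> 1] A that by auto
  have bdd: "bdd_above ((\<lambda>\<phi>. \<phi> x) ` A)" for x
    using nb[of _ x] by (intro bdd_aboveI2[of _ _ "norm x"]) (auto simp: abs_le_iff)
  have up: "\<phi> x \<le> \<sigma> x" if "\<phi> \<in> A" for \<phi> x
    unfolding \<sigma>_def using that by (intro cSUP_upper bdd)
  have lst: "\<sigma> x \<le> b" if "\<And>\<phi>. \<phi> \<in> A \<Longrightarrow> \<phi> x \<le> b" for x b
    unfolding \<sigma>_def using that A by (intro cSUP_least) auto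
  have "convex_on UNIV \<sigma>"
  proof (rule convex_onI)
    fix t :: real and x y :: 'a assume t: "0 < t" "t < 1"
    show "\<sigma> ((1 - t) *\<^sub>R x + t *\<^sub>R y) \<le> (1 - t) * \<sigma> x + t * \<sigma> y"
    proof (rule lst)
      fix \<phi> assume \<phi>: "\<phi> \<in> A"
      have "\<phi> ((1 - t) *\<^sub>R x + t *\<^sub>R y) = (1 - t) * \<phi> x + t * \<phi> y"
        using lin[OF \<phi>] by (simp add: linear_add linear_scale)
      also have "\<dots> \<le> (1 - t) * \<sigma> x + t * \<sigma> y"
        using t up[OF \<phi>] by (intro add_mono mult_left_mono) auto
      finally show "\<phi> ((1 - t) *\<^sub>R x + t *\<^sub>R y) \<le> (1 - t) * \<sigma> x + t * \<sigma> y" .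
    qed
  qed simp
  moreover have "continuous_on UNIV \<sigma>"
  proof -
    have lip: "\<sigma> x \<le> \<sigma> y + norm (x - y)" for x y
    proof (rule lst)
      fix \<phi> assume \<phi>: "\<phi> \<in> A"
      have "\<phi> x = \<phi> y + \<phi> (x - y)" using lin[OF \<phi>] by (simp add: linear_diff)
      then show "\<phi> x \<le> \<sigma> y + norm (x - y)"
        using up[OF \<phi>, of y] nb[OF \<phi>, of "x - y"] by linarith
    qed
    have "1-lipschitz_on UNIV \<sigma>"
    proof (rule lipschitz_onI)
      fix x y
      show "dist (\<sigma> x) (\<sigma> y) \<le> 1 * dist x y"
        using lip[of x y] lip[of y x] by (auto simp: dist_norm norm_minus_commute abs_le_iff)
    qed simp
    then show ?thesis by (rule lipschitz_on_continuous_on)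
  qed
  ultimately obtain G where "UNIV \<subseteq> closure G" and G: "\<forall>x\<in>G. \<sigma> differentiable (at x)"
    using asp unfolding asplund_space_def by (metis UNIV_not_empty open_UNIV)
  then obtain x where "x \<in> G" by (metis closure_eq_empty UNIV_not_empty ex_in_conv subset_empty)
  then obtain D where D: "(\<sigma> has_derivative D) (at x)" using G differentiable_def by blast
  define k where "k = e / 4"
  have k: "0 < k" using e by (simp add: k_def)
  obtain d where d: "0 < d" and Dd: "\<And>y. norm (y - x) < d \<Longrightarrow> \<bar>\<sigma> y - \<sigma> x - D (y - x)\<bar> \<le> k * norm (y - x)"
    using D k unfolding has_derivative_at_alt by (metis real_norm_def)
  have Dlin: "linear D" using D by (rule has_derivative_linear)
  define r where "r = d / 2"
  have r: "0 < r" "r < d" using d by (auto simp: r_def)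
  define s where "s = \<sigma> x - k * r"
  have one: "\<phi> y - D y \<le> 2 * k * norm y" if \<phi>: "\<phi> \<in> A" "s < \<phi> x" for \<phi> y
  proof (cases "y = 0")
    case True
    then show ?thesis using lin[OF \<phi>(1)] Dlin by (simp add: linear_0)
  next
    case False
    define t where "t = r / norm y"
    have t: "0 < t" using False r by (simp add: t_def)
    have nh: "norm (t *\<^sub>R y) = r" using False r by (simp add: t_def)
    have "\<phi> (x + t *\<^sub>R y) \<le> \<sigma> (x + t *\<^sub>R y)" using up \<phi> by blast
    also have "\<dots> \<le> \<sigma> x + D (t *\<^sub>R y) + k * r"
      using Dd[of "x + t *\<^sub>R y"] nh r by (simp add: abs_le_iff)
    finally have "t * \<phi> y \<le> t * D y + 2 * k * r"
      using \<phi>(2) lin[OF \<phi>(1)] Dlin by (simp add: linear_add linear_scale s_def)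
    then have "t * (\<phi> y - D y) \<le> t * (2 * k * norm y)"
      using False by (simp add: t_def algebra_simps)
    then show ?thesis using t by simp
  qed
  have two: "\<bar>\<phi> y - D y\<bar> \<le> 2 * k * norm y" if \<phi>: "\<phi> \<in> A" "s < \<phi> x" for \<phi> y
    using one[OF \<phi>, of y] one[OF \<phi>, of "- y"] lin[OF \<phi>(1)] Dlin by (simp add: linear_neg)
  show ?thesis
  proof
    have "\<exists>\<phi>\<in>A. s < \<phi> x"
    proof (rule ccontr)
      assume "\<not> ?thesis"
      then have "\<sigma> x \<le> s" by (intro lst) auto
      then show False using mult_pos_pos[OF k r(1)] by (simp add: s_def)
    qed
    then show "\<exists>\<phi>\<in>A. s < \<phi> x" .
    show "\<bar>\<phi> y - \<psi> y\<bar> \<le> e * norm y" if "\<phi> \<in> A" "\<psi> \<in> A" "s < \<phi> x" "s < \<psi> x" for \<phi> \<psi> y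
    proof -
      have "\<bar>\<phi> y - \<psi> y\<bar> \<le> \<bar>\<phi> y - D y\<bar> + \<bar>\<psi> y - D y\<bar>" by linarith
      then show ?thesis using two[of \<phi> y] two[of \<psi> y] that by (simp add: k_def)
    qed
  qed
qed

section \<open>Separable subspaces of Asplund spaces have separable duals\<close>

definition near_on :: "'a::real_normed_vector set \<Rightarrow> real \<Rightarrow> ('a \<Rightarrow> real) \<Rightarrow> ('a \<Rightarrow> real) \<Rightarrow> bool" where
  "near_on Y e \<phi> \<psi> \<longleftrightarrow> (\<forall>y\<in>Y. \<bar>\<phi> y - \<psi> y\<bar> \<le> e * norm y)"

text \<open>
  By Zorn's lemma there is a minimal weak-star closed subset of \<open>K1\<close> with the same restrictions to
  \<open>Y\<close> as \<open>K1\<close>; compactness is what makes intersections of chains keep the restrictions. Minimality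
  means that every nonempty slice of \<open>K\<close> by an arbitrary \<open>x\<close>, which need not belong to \<open>Y\<close>, already
  controls a set of restrictions that is open as seen from \<open>Y\<close>.
\<close>

lemma minimal_lift:
  fixes K1 :: "('a::real_normed_vector \<Rightarrow> real) set"
  assumes K1: "K1 \<subseteq> dual_ball 1" "closed K1"
  obtains K where "closed K" "K \<subseteq> K1" "\<forall>\<phi>\<in>K1. \<exists>\<psi>\<in>K. \<forall>y\<in>Y. \<psi> y = \<phi> y"
    "\<And>L. closed L \<Longrightarrow> L \<subseteq> K \<Longrightarrow> \<forall>\<phi>\<in>K1. \<exists>\<psi>\<in>L. \<forall>y\<in>Y. \<psi> y = \<phi> y \<Longrightarrow> L = K"
proof -
  define A where "A = {K. closed K \<and> K \<subseteq> K1 \<and> (\<forall>\<phi>\<in>K1. \<exists>\<psi>\<in>K. \<forall>y\<in>Y. \<psi> y = \<phi> y)}"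
  define P where "P = (\<lambda>a b :: ('a \<Rightarrow> real) set. b \<subseteq> a)"
  have "\<exists>m\<in>A. \<forall>a\<in>A. P m a \<longrightarrow> a = m"
  proof (rule predicate_Zorn)
    show "partial_order_on A (relation_of P A)"
      unfolding P_def by (rule partial_order_on_relation_ofI) auto
    fix C assume C: "C \<in> Chains (relation_of P A)"
    then have CA: "C \<subseteq> A" and lin: "\<And>a b. a \<in> C \<Longrightarrow> b \<in> C \<Longrightarrow> a \<subseteq> b \<or> b \<subseteq> a"
      unfolding Chains_def relation_of_def P_def by auto
    show "\<exists>u\<in>A. \<forall>a\<in>C. P a u"
    proof (cases "C = {}")
      case True
      then show ?thesis using K1 by (intro bexI[of _ K1]) (auto simp: A_def)
    next
      case False
      then obtain K0 where K0: "K0 \<in> C" by blast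
      have least: "\<exists>M\<in>C. \<forall>K\<in>F. M \<subseteq> K" if "finite F" "F \<subseteq> C" for F
        using that
      proof (induction F rule: finite_induct)
        case empty
        then show ?case using K0 by blast
      next
        case (insert K F)
        then obtain M where "M \<in> C" "\<forall>K\<in>F. M \<subseteq> K" by blast
        moreover have "M \<subseteq> K \<or> K \<subseteq> M" using lin \<open>M \<in> C\<close> insert.prems by simp
        ultimately show ?case
        proof (elim disjE)
          assume "M \<subseteq> K"
          then show ?thesis using \<open>M \<in> C\<close> \<open>\<forall>K\<in>F. M \<subseteq> K\<close> by (intro bexI[of _ M]) auto
        next
          assume "K \<subseteq> M"
          then show ?thesis using insert.prems \<open>\<forall>K\<in>F. M \<subseteq> K\<close> by (intro bexI[of _ K]) auto
        qed
      qed
      have "\<exists>\<psi>\<in>\<Inter>C. \<forall>y\<in>Y. \<psi> y = \<phi> y" if \<phi>: "\<phi> \<in> K1" for \<phi>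
      proof -
        define E where "E = {\<psi>. \<forall>y\<in>Y. \<psi> y = \<phi> y}"
        have "E = (\<Inter>y\<in>Y. {\<psi>. \<psi> y \<in> {\<phi> y}})" by (auto simp: E_def)
        then have E: "closed E" by (simp only:) (intro closed_INT ballI closed_coordinate_set closed_singleton)
        have "dual_ball 1 \<inter> (\<Inter>K\<in>C. K \<inter> E) \<noteq> {}"
        proof (rule compact_imp_fip_image[OF compact_dual_ball])
          show "closed (K \<inter> E)" if "K \<in> C" for K
            using that CA E by (auto simp: A_def)
          fix F assume "finite F" "F \<subseteq> C"
          then obtain M where M: "M \<in> C" "\<forall>K\<in>F. M \<subseteq> K" using least by blast
          then obtain \<psi> where "\<psi> \<in> M" "\<psi> \<in> E" "M \<subseteq> K1" using CA \<phi> unfolding A_def E_def by blast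
          then show "dual_ball 1 \<inter> (\<Inter>K\<in>F. K \<inter> E) \<noteq> {}" using M K1 by blast
        qed
        then show ?thesis using False by (auto simp: E_def)
      qed
      moreover have "closed (\<Inter>C)" using CA by (auto simp: A_def)
      moreover have "\<Inter>C \<subseteq> K1" using CA K0 by (auto simp: A_def)
      ultimately have "\<Inter>C \<in> A" by (simp add: A_def)
      then show ?thesis by (auto simp: P_def)
    qed
  qed
  then obtain K where KA: "K \<in> A" and Kmin: "\<And>L. L \<in> A \<Longrightarrow> L \<subseteq> K \<Longrightarrow> L = K"
    unfolding P_def by blast
  show ?thesis
  proof (rule that[of K])
    show "L = K" if "closed L" "L \<subseteq> K" "\<forall>\<phi>\<in>K1. \<exists>\<psi>\<in>L. \<forall>y\<in>Y. \<psi> y = \<phi> y" for L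
      using that KA by (intro Kmin) (auto simp: A_def)
  qed (use KA in \<open>auto simp: A_def\<close>)
qed

lemma dual_ball_eq_on_closure:
  fixes \<phi> \<psi> :: "'a::real_normed_vector \<Rightarrow> real"
  assumes "\<phi> \<in> dual_ball c" "\<psi> \<in> dual_ball c" "\<And>x. x \<in> S \<Longrightarrow> \<phi> x = \<psi> x" "y \<in> closure S"
  shows "\<phi> y = \<psi> y"
proof -
  have cont: "continuous_on UNIV \<phi>" if "\<phi> \<in> dual_ball c" for \<phi> :: "'a \<Rightarrow> real"
  proof -
    have "\<bar>c\<bar>-lipschitz_on UNIV \<phi>"
    proof (rule lipschitz_onI)
      fix x y :: 'a
      have "c * norm (x - y) \<le> \<bar>c\<bar> * norm (x - y)" by (intro mult_right_mono) auto
      then show "dist (\<phi> x) (\<phi> y) \<le> \<bar>c\<bar> * dist x y"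
        using dual_ballD(3)[OF that, of x y] by (simp add: dist_norm)
    qed simp
    then show ?thesis by (rule lipschitz_on_continuous_on)
  qed
  have "closed {y. \<phi> y = \<psi> y}"
    using cont assms by (intro closed_Collect_eq) auto
  then have "closure S \<subseteq> {y. \<phi> y = \<psi> y}" using assms(3) by (intro closure_minimal) auto
  then show ?thesis using assms(4) by blast
qed

text \<open>
  Suppose that the dual ball has no countable \<open>e\<close>-net for the distance of restrictions to \<open>Y\<close>. As
  pointwise convergence on \<open>Y\<close> has a countable base, the relatively open sets with a countable net can
  be removed all at once. In the remaining set \<open>K1\<close> every nonempty relatively open set contains two
  functionals that are more than \<open>e\<close> apart on \<open>Y\<close>. A small slice of a minimal lift of \<open>K1\<close>
  contradicts this.
\<close>

lemma asplund_countable_net: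
  fixes Y X0 :: "'a::real_normed_vector set"
  assumes asp: "asplund_space TYPE('a)" and X0: "countable X0" "X0 \<subseteq> Y" "Y \<subseteq> closure X0" and e: "0 < e"
  shows "\<exists>D. countable D \<and> D \<subseteq> dual_ball 1 \<and> (\<forall>\<phi>\<in>dual_ball 1. \<exists>\<psi>\<in>D. near_on Y e \<phi> \<psi>)"
proof (rule ccontr)
  assume not: "\<not> ?thesis"
  define cov where "cov S \<longleftrightarrow> (\<exists>D. countable D \<and> D \<subseteq> dual_ball 1 \<and> (\<forall>\<phi>\<in>S. \<exists>\<psi>\<in>D. near_on Y e \<phi> \<psi>))"
    for S :: "('a \<Rightarrow> real) set"
  define U where "U l = {\<phi> :: 'a \<Rightarrow> real. \<forall>(x, p, q)\<in>set l. of_rat p < \<phi> x \<and> \<phi> x < of_rat q}"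
    for l :: "('a \<times> rat \<times> rat) list"
  define Ls where "Ls = lists (X0 \<times> (UNIV :: (rat \<times> rat) set))"
  define Lc where "Lc = {l\<in>Ls. cov (dual_ball 1 \<inter> U l)}"
  define K1 where "K1 = dual_ball 1 - (\<Union>l\<in>Lc. U l)"
  have cLs: "countable Ls"
    unfolding Ls_def using X0 by (intro countable_lists countable_SIGMA) auto
  then have cLc: "countable Lc" unfolding Lc_def by (rule countable_subset[rotated]) auto
  have oU: "open (U l)" for l
  proof -
    have "U l = (\<Inter>z\<in>set l. {\<phi>. \<phi> (fst z) \<in> {of_rat (fst (snd z))<..<of_rat (snd (snd z))}})"
      by (fastforce simp: U_def)
    moreover have op: "open {\<phi> :: 'a \<Rightarrow> real. \<phi> x \<in> S}" if "open S" for x and S :: "real set"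
      using open_vimage[OF that continuous_on_product_coordinates] by (simp add: vimage_def)
    ultimately show ?thesis by (simp only:) (intro open_INT finite_set ballI op open_greaterThanLessThan)
  qed
  have K1B: "K1 \<subseteq> dual_ball 1" by (auto simp: K1_def)
  have cB: "closed (dual_ball 1 :: ('a \<Rightarrow> real) set)"
    by (rule closed_dual_ball)
  have clK1: "closed K1"
    unfolding K1_def using oU cB by (intro closed_Diff open_UN) auto
  have covUN: "cov (\<Union>i\<in>I. S i)" if cI: "countable I" and cS: "\<And>i. i \<in> I \<Longrightarrow> cov (S i)" for I :: "('a \<times> rat \<times> rat) list set" and S
  proof -
    obtain D where D: "\<And>i. i \<in> I \<Longrightarrow> countable (D i) \<and> D i \<subseteq> dual_ball 1 \<and> (\<forall>\<phi>\<in>S i. \<exists>\<psi>\<in>D i. near_on Y e \<phi> \<psi>)"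
      using cS unfolding cov_def by metis
    show ?thesis unfolding cov_def
    proof (intro exI[of _ "\<Union>i\<in>I. D i"] conjI ballI)
      fix \<phi> assume "\<phi> \<in> (\<Union>i\<in>I. S i)"
      then show "\<exists>\<psi>\<in>\<Union>i\<in>I. D i. near_on Y e \<phi> \<psi>" using D by blast
    qed (use cI D in auto)
  qed
  have covUn: "cov (S \<union> T)" if "cov S" "cov T" for S T
    using that unfolding cov_def by (metis (no_types, lifting) Un_iff countable_Un Un_least)
  have covsub: "cov S" if "cov T" "S \<subseteq> T" for S T
    using that unfolding cov_def by blast
  (* The removed part has a countable net, being a countable union of sets with countable nets. *)
  define R where "R = (\<Union>l\<in>Lc. dual_ball 1 \<inter> U l)"
  have covR: "cov R"
    unfolding R_def by (intro covUN cLc) (auto simp: Lc_def)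
  have notB: "\<not> cov (dual_ball 1)" using not by (simp add: cov_def)
  have K1ne: "K1 \<noteq> {}"
  proof
    assume "K1 = {}"
    then have "dual_ball 1 \<subseteq> R" by (auto simp: K1_def R_def)
    then show False using covsub covR notB by blast
  qed
  have far: "\<exists>\<phi>\<in>K1 \<inter> U l. \<exists>\<psi>\<in>K1 \<inter> U l. \<not> near_on Y e \<phi> \<psi>" if l: "l \<in> Ls" and ne: "K1 \<inter> U l \<noteq> {}" for l
  proof (rule ccontr)
    assume n: "\<not> ?thesis"
    obtain \<psi> where \<psi>: "\<psi> \<in> K1 \<inter> U l" using ne by blast
    then have "cov (K1 \<inter> U l)"
      unfolding cov_def using n K1B by (intro exI[of _ "{\<psi>}"]) auto
    then have "cov ((K1 \<inter> U l) \<union> R)" by (rule covUn[OF _ covR])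
    moreover have "dual_ball 1 \<inter> U l \<subseteq> (K1 \<inter> U l) \<union> R" by (auto simp: K1_def R_def)
    ultimately have "l \<in> Lc" using l covsub by (auto simp: Lc_def)
    then show False using \<psi> by (auto simp: K1_def)
  qed
  obtain K where K: "closed K" "K \<subseteq> K1" "\<forall>\<phi>\<in>K1. \<exists>\<psi>\<in>K. \<forall>y\<in>Y. \<psi> y = \<phi> y"
    and Kmin: "\<And>L. closed L \<Longrightarrow> L \<subseteq> K \<Longrightarrow> \<forall>\<phi>\<in>K1. \<exists>\<psi>\<in>L. \<forall>y\<in>Y. \<psi> y = \<phi> y \<Longrightarrow> L = K"
    by (rule minimal_lift[OF K1B clK1, of Y]) blast
  have "K \<noteq> {}" "K \<subseteq> dual_ball 1" using K K1ne K1B by blast+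
  then have KB: "K \<subseteq> dual_ball 1" "K \<noteq> {}" by auto
  obtain x s where ex: "\<exists>\<phi>\<in>K. s < \<phi> x"
    and small: "\<And>\<phi> \<psi> y. \<phi> \<in> K \<Longrightarrow> \<psi> \<in> K \<Longrightarrow> s < \<phi> x \<Longrightarrow> s < \<psi> x \<Longrightarrow> \<bar>\<phi> y - \<psi> y\<bar> \<le> e * norm y"
    by (rule asplund_small_slice[OF asp KB e]) blast
  (* L is a proper closed subset of K, so by minimality some restriction \<phi>0 is missed by L. *)
  define L where "L = K \<inter> {\<phi>. \<phi> x \<in> {..s}}"
  have clL: "closed L"
    unfolding L_def using K(1) by (intro closed_Int closed_coordinate_set) auto
  have LB: "L \<subseteq> dual_ball 1" using K(2) K1B by (auto simp: L_def)
  have "L \<noteq> K"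
  proof
    assume "L = K"
    then obtain \<phi> where "\<phi> \<in> L" "s < \<phi> x" using ex by blast
    then show False by (auto simp: L_def)
  qed
  then obtain \<phi>0 where \<phi>0: "\<phi>0 \<in> K1" and nol: "\<And>\<psi>. \<psi> \<in> L \<Longrightarrow> \<exists>y\<in>Y. \<psi> y \<noteq> \<phi>0 y"
  proof -
    have "L \<subseteq> K" by (auto simp: L_def)
    then have "\<not> (\<forall>\<phi>\<in>K1. \<exists>\<psi>\<in>L. \<forall>y\<in>Y. \<psi> y = \<phi> y)" using Kmin[OF clL] \<open>L \<noteq> K\<close> by blast
    then show ?thesis using that by blast
  qed
  (* By compactness of L, a whole basic neighbourhood of \<phi>0 is missed by L. *)
  have "\<exists>l\<in>Ls. \<phi>0 \<in> U l \<and> (\<forall>\<phi>\<in>K1 \<inter> U l. \<not> (\<exists>\<psi>\<in>L. \<forall>y\<in>Y. \<psi> y = \<phi> y))"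
  proof (rule ccontr)
    assume nl: "\<not> ?thesis"
    have "dual_ball 1 \<inter> (\<Inter>z\<in>X0 \<times> UNIV. L \<inter> {\<psi>. \<psi> (fst z) \<in> cball (\<phi>0 (fst z)) (1 / Suc (snd z))}) \<noteq> {}"
    proof (rule compact_imp_fip_image[OF compact_dual_ball])
      show "closed (L \<inter> {\<psi>. \<psi> (fst z) \<in> cball (\<phi>0 (fst z)) (1 / Suc (snd z))})" for z :: "'a \<times> nat"
        by (intro closed_Int clL closed_coordinate_set) auto
      fix F :: "('a \<times> nat) set" assume F: "finite F" "F \<subseteq> X0 \<times> UNIV"
      have "\<exists>p q. \<phi>0 (fst z) - 1 / Suc (snd z) < of_rat p \<and> of_rat p < \<phi>0 (fst z) \<and>
        \<phi>0 (fst z) < of_rat q \<and> of_rat q < \<phi>0 (fst z) + 1 / Suc (snd z)" for z :: "'a \<times> nat"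
        using of_rat_dense[of "\<phi>0 (fst z) - 1 / Suc (snd z)" "\<phi>0 (fst z)"]
          of_rat_dense[of "\<phi>0 (fst z)" "\<phi>0 (fst z) + 1 / Suc (snd z)"] by auto
      then obtain p q where pq: "\<And>z :: 'a \<times> nat. \<phi>0 (fst z) - 1 / Suc (snd z) < of_rat (p z) \<and> of_rat (p z) < \<phi>0 (fst z) \<and>
        \<phi>0 (fst z) < of_rat (q z) \<and> of_rat (q z) < \<phi>0 (fst z) + 1 / Suc (snd z)" by metis
      obtain l where l: "set l = (\<lambda>z. (fst z, p z, q z)) ` F"
        using finite_list[of "(\<lambda>z. (fst z, p z, q z)) ` F"] F(1) by auto
      have FX: "fst z \<in> X0" if "z \<in> F" for z
        using subsetD[OF F(2) that] by (simp add: mem_Times_iff)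
      have "l \<in> Ls" using l FX by (auto simp: Ls_def)
      moreover have "\<phi>0 \<in> U l" using l pq by (auto simp: U_def)
      ultimately obtain \<phi> \<psi> where \<phi>: "\<phi> \<in> K1" "\<phi> \<in> U l" and \<psi>: "\<psi> \<in> L" "\<And>y. y \<in> Y \<Longrightarrow> \<psi> y = \<phi> y"
        using nl by blast
      have "\<psi> (fst z) \<in> cball (\<phi>0 (fst z)) (1 / Suc (snd z))" if z: "z \<in> F" for z
      proof -
        have "fst z \<in> Y" using FX[OF z] X0(2) by blast
        moreover have "of_rat (p z) < \<phi> (fst z) \<and> \<phi> (fst z) < of_rat (q z)"
          using \<phi>(2) z l by (auto simp: U_def)
        ultimately show ?thesis
          using \<psi>(2)[of "fst z"] pq[of z] by (simp add: dist_real_def abs_le_iff del: of_nat_Suc)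
      qed
      then show "dual_ball 1 \<inter> (\<Inter>z\<in>F. L \<inter> {\<psi>. \<psi> (fst z) \<in> cball (\<phi>0 (fst z)) (1 / Suc (snd z))}) \<noteq> {}"
        using \<psi>(1) LB by blast
    qed
    then obtain \<psi> where \<psi>B: "\<psi> \<in> dual_ball 1"
      and \<psi>I: "\<psi> \<in> (\<Inter>z\<in>X0 \<times> UNIV. L \<inter> {\<psi>. \<psi> (fst z) \<in> cball (\<phi>0 (fst z)) (1 / Suc (snd z))})"
      by (meson IntD1 IntD2 ex_in_conv)
    have \<psi>: "\<psi> \<in> L \<and> \<bar>\<phi>0 x - \<psi> x\<bar> \<le> 1 / Suc n" if "x \<in> X0" for x n
      using INT_D[OF \<psi>I, of "(x, n)"] that by (simp add: dist_real_def del: of_nat_Suc)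
    have eq: "\<psi> x = \<phi>0 x" if "x \<in> X0" for x
    proof (rule ccontr)
      assume "\<psi> x \<noteq> \<phi>0 x"
      then obtain n where "inverse (of_nat (Suc n)) < \<bar>\<phi>0 x - \<psi> x\<bar>"
        using reals_Archimedean[of "\<bar>\<phi>0 x - \<psi> x\<bar>"] by auto
      then show False using \<psi>[OF that, of n] by (simp add: inverse_eq_divide del: of_nat_Suc)
    qed
    have eqY: "\<psi> y = \<phi>0 y" if "y \<in> Y" for y
      using dual_ball_eq_on_closure[OF \<psi>B subsetD[OF K1B \<phi>0] eq subsetD[OF X0(3) that]] .
    have "X0 \<noteq> {}"
    proof
      assume "X0 = {}"
      then have "Y = {}" using X0 by simp
      then have "near_on Y e \<phi> \<psi>" for \<phi> \<psi> by (simp add: near_on_def)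
      then show False using far[of "[]"] K1ne by (auto simp: Ls_def U_def)
    qed
    then have "\<psi> \<in> L" using \<psi> by blast
    then show False using nol eqY by blast
  qed
  then obtain l where l: "l \<in> Ls" "\<phi>0 \<in> U l" and none: "\<And>\<phi> \<psi>. \<phi> \<in> K1 \<inter> U l \<Longrightarrow> \<psi> \<in> L \<Longrightarrow> \<exists>y\<in>Y. \<psi> y \<noteq> \<phi> y"
    by blast
  then obtain \<phi>1 \<phi>2 where \<phi>12: "\<phi>1 \<in> K1 \<inter> U l" "\<phi>2 \<in> K1 \<inter> U l" "\<not> near_on Y e \<phi>1 \<phi>2"
    using far[OF l(1)] \<phi>0 by blast
  have \<phi>K1: "\<phi>1 \<in> K1" "\<phi>2 \<in> K1" using \<phi>12 by auto
  obtain \<psi>1 where \<psi>1: "\<psi>1 \<in> K" "\<forall>y\<in>Y. \<psi>1 y = \<phi>1 y" using bspec[OF K(3) \<phi>K1(1)] ..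
  obtain \<psi>2 where \<psi>2: "\<psi>2 \<in> K" "\<forall>y\<in>Y. \<psi>2 y = \<phi>2 y" using bspec[OF K(3) \<phi>K1(2)] ..
  have "\<psi>1 \<notin> L" using none[OF \<phi>12(1), of \<psi>1] \<psi>1(2) by auto
  moreover have "\<psi>2 \<notin> L" using none[OF \<phi>12(2), of \<psi>2] \<psi>2(2) by auto
  ultimately have "s < \<psi>1 x" "s < \<psi>2 x" using \<psi>1(1) \<psi>2(1) by (auto simp: L_def)
  then have "near_on Y e \<psi>1 \<psi>2" using small[OF \<psi>1(1) \<psi>2(1)] by (simp add: near_on_def)
  then show False using \<phi>12(3) \<psi>1(2) \<psi>2(2) by (simp add: near_on_def)
qed

lemma asplund_separable_dual:
  fixes Y X0 :: "'a::real_normed_vector set"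
  assumes asp: "asplund_space TYPE('a)" and X0: "countable X0" "X0 \<subseteq> Y" "Y \<subseteq> closure X0"
  obtains D :: "('a \<Rightarrow>\<^sub>L real) set" where "countable D"
    "\<And>a e. 0 < e \<Longrightarrow> \<exists>d\<in>D. \<forall>y\<in>Y. \<bar>blinfun_apply a y - blinfun_apply d y\<bar> \<le> e * norm y"
proof -
  have "\<exists>D. \<forall>n. countable (D n) \<and> D n \<subseteq> dual_ball 1 \<and>
    (\<forall>\<phi>\<in>dual_ball 1. \<exists>\<psi>\<in>D n. near_on Y (1 / Suc n) \<phi> \<psi>)"
    using asplund_countable_net[OF asp X0] by (intro choice) auto
  then obtain D0 where D0_all: "\<forall>n. countable (D0 n) \<and> D0 n \<subseteq> dual_ball 1 \<and>
    (\<forall>\<phi>\<in>dual_ball 1. \<exists>\<psi>\<in>D0 n. near_on Y (1 / Suc n) \<phi> \<psi>)" ..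
  have D0: "countable (D0 n)" "D0 n \<subseteq> dual_ball 1"
    "\<phi> \<in> dual_ball 1 \<Longrightarrow> \<exists>\<psi>\<in>D0 n. near_on Y (1 / Suc n) \<phi> \<psi>" for n \<phi>
    using D0_all[rule_format, of n] by simp_all
  define D where "D = (\<Union>n. \<Union>m::nat. (\<lambda>\<phi>. real m *\<^sub>R Blinfun \<phi>) ` D0 n)"
  show ?thesis
  proof
    show "countable D" unfolding D_def using D0(1) by auto
    fix a :: "'a \<Rightarrow>\<^sub>L real" and e :: real assume e: "0 < e"
    obtain m where m: "norm a \<le> real m" "0 < m"
      using real_arch_simple[of "max 1 (norm a)"] by auto
    obtain n where n: "inverse (real (Suc n)) < e / m"
      using reals_Archimedean[of "e / m"] e m by auto
    have "norm ((1 / m) *\<^sub>R a) \<le> 1" using m by (simp add: field_simps)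
    then have "blinfun_apply ((1 / m) *\<^sub>R a) \<in> dual_ball 1" by (rule blinfun_mem_dual_ball)
    then obtain \<psi> where \<psi>: "\<psi> \<in> D0 n" "near_on Y (1 / Suc n) (blinfun_apply ((1 / m) *\<^sub>R a)) \<psi>"
      using D0(3) by blast
    obtain b where b: "blinfun_apply b = \<psi>" using dual_ball_blinfun[of \<psi> 1] D0(2) \<psi>(1) by auto
    have Bl: "blinfun_apply (Blinfun \<psi>) = \<psi>" using b by (metis blinfun_apply_inverse)
    show "\<exists>d\<in>D. \<forall>y\<in>Y. \<bar>blinfun_apply a y - blinfun_apply d y\<bar> \<le> e * norm y"
    proof (intro bexI ballI)
      show "real m *\<^sub>R Blinfun \<psi> \<in> D" using \<psi>(1) by (auto simp: D_def)
      fix y assume y: "y \<in> Y"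
      have "\<bar>(1/m) * blinfun_apply a y - \<psi> y\<bar> \<le> 1 / Suc n * norm y"
        using \<psi>(2) y by (simp add: near_on_def scaleR_blinfun.rep_eq del: of_nat_Suc)
      also have "\<dots> \<le> e / m * norm y"
        using n by (intro mult_right_mono) (auto simp: inverse_eq_divide simp del: of_nat_Suc)
      finally have le: "\<bar>(1/m) * blinfun_apply a y - \<psi> y\<bar> \<le> e / m * norm y" .
      have "blinfun_apply a y - m * \<psi> y = m * ((1/m) * blinfun_apply a y - \<psi> y)"
        using m by (simp only: right_diff_distrib) simp
      then have "\<bar>blinfun_apply a y - m * \<psi> y\<bar> = m * \<bar>(1/m) * blinfun_apply a y - \<psi> y\<bar>"
        by (simp only: abs_mult abs_of_nat)
      also have "\<dots> \<le> m * (e / m * norm y)"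
        by (intro mult_left_mono le) simp
      also have "\<dots> = e * norm y" using m by simp
      finally show "\<bar>blinfun_apply a y - blinfun_apply (real m *\<^sub>R Blinfun \<psi>) y\<bar> \<le> e * norm y"
        by (simp only: scaleR_blinfun.rep_eq Bl real_scaleR_def)
    qed
  qed
qed

section \<open>A substitute for the squared norm that is smooth along a subspace\<close>

text \<open>
  A separable subspace \<open>Y\<close> with separable dual: \<open>xs\<close> is dense in \<open>Y\<close>, and the restrictions of \<open>ds\<close> to
  \<open>Y\<close> are norm dense in the dual of \<open>Y\<close>.
\<close>

locale separable_dual_subspace =
  fixes Y :: "'a::real_normed_vector set" and xs :: "nat \<Rightarrow> 'a" and ds :: "nat \<Rightarrow> 'a \<Rightarrow>\<^sub>L real"
  assumes Y: "subspace Y" and xsY: "xs k \<in> Y" and xs_dense: "Y \<subseteq> closure (range xs)"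
    and ds_dense: "0 < e \<Longrightarrow> \<exists>n. \<forall>y\<in>Y. \<bar>blinfun_apply a y - blinfun_apply (ds n) y\<bar> \<le> e * norm y"
begin

text \<open>
  The norm of the restriction of \<open>a\<close> to \<open>Y\<close>.
\<close>

definition nY :: "('a \<Rightarrow>\<^sub>L real) \<Rightarrow> real" where
  "nY a = (SUP y\<in>{y\<in>Y. norm y \<le> 1}. \<bar>blinfun_apply a y\<bar>)"

lemma zero_Y: "0 \<in> Y"
  using Y by (rule subspace_0)

lemma abs_apply_le: "\<bar>blinfun_apply a y\<bar> \<le> norm a * norm y" for a :: "'a \<Rightarrow>\<^sub>L real"
  using norm_blinfun[of a y] by simp

lemma nY_bdd: "bdd_above ((\<lambda>y. \<bar>blinfun_apply a y\<bar>) ` {y\<in>Y. norm y \<le> 1})"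
  for a :: "'a \<Rightarrow>\<^sub>L real"
proof (rule bdd_aboveI2)
  fix y assume "y \<in> {y\<in>Y. norm y \<le> 1}"
  then have "norm a * norm y \<le> norm a * 1" by (intro mult_left_mono) auto
  then show "\<bar>blinfun_apply a y\<bar> \<le> norm a" using abs_apply_le[of a y] by simp
qed

lemma nY_nonneg: "0 \<le> nY a"
  unfolding nY_def using cSUP_upper[OF _ nY_bdd[of a], of 0] zero_Y by (simp add: blinfun.zero_right)

lemma nY_upper:
  assumes "y \<in> Y" shows "\<bar>blinfun_apply a y\<bar> \<le> nY a * norm y"
proof (cases "y = 0")
  case True
  then show ?thesis by (simp add: blinfun.zero_right)
next
  case False
  have "(1 / norm y) *\<^sub>R y \<in> {y\<in>Y. norm y \<le> 1}" using assms Y False by (simp add: subspace_scale)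
  then have "\<bar>blinfun_apply a ((1 / norm y) *\<^sub>R y)\<bar> \<le> nY a"
    unfolding nY_def by (rule cSUP_upper[OF _ nY_bdd])
  then show ?thesis using False by (simp add: blinfun.scaleR_right abs_mult field_simps)
qed

lemma nY_least:
  assumes "0 \<le> r" "\<And>y. y \<in> Y \<Longrightarrow> \<bar>blinfun_apply a y\<bar> \<le> r * norm y" shows "nY a \<le> r"
  unfolding nY_def
proof (rule cSUP_least)
  show "{y\<in>Y. norm y \<le> 1} \<noteq> {}" using zero_Y by auto
  fix y assume y: "y \<in> {y\<in>Y. norm y \<le> 1}"
  then have "r * norm y \<le> r * 1" using assms(1) by (intro mult_left_mono) auto
  then show "\<bar>blinfun_apply a y\<bar> \<le> r" using assms(2)[of y] y by simp
qed

lemma nY_le_norm: "nY a \<le> norm a"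
  by (rule nY_least) (auto simp: abs_apply_le)

lemma nY_triangle: "nY (a + b) \<le> nY a + nY b"
proof (rule nY_least)
  fix y assume y: "y \<in> Y"
  show "\<bar>blinfun_apply (a + b) y\<bar> \<le> (nY a + nY b) * norm y"
    using nY_upper[OF y, of a] nY_upper[OF y, of b] by (simp add: plus_blinfun.rep_eq distrib_right)
qed (simp add: nY_nonneg)

lemma nY_scale: "nY (t *\<^sub>R a) \<le> \<bar>t\<bar> * nY a"
proof (rule nY_least)
  fix y assume y: "y \<in> Y"
  show "\<bar>blinfun_apply (t *\<^sub>R a) y\<bar> \<le> (\<bar>t\<bar> * nY a) * norm y"
    using mult_left_mono[OF nY_upper[OF y, of a], of "\<bar>t\<bar>"] by (simp add: scaleR_blinfun.rep_eq abs_mult mult.assoc)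
qed (simp add: nY_nonneg)

lemma nY_minus: "nY (a - b) = nY (b - a)"
  unfolding nY_def by (simp add: minus_blinfun.rep_eq abs_minus_commute)

lemma nY_mid: "nY ((1/2) *\<^sub>R (a + b)) \<le> (nY a + nY b) / 2"
  using nY_scale[of "1/2" "a + b"] nY_triangle[of a b] by simp

text \<open>
  Norm compact convex sets whose union is dense with respect to \<open>nY\<close>. They take the place of the
  finite-dimensional subspaces in the classical construction of a dual norm with the Kadec property.
\<close>

definition Kh :: "nat \<Rightarrow> ('a \<Rightarrow>\<^sub>L real) set" where
  "Kh k = convex hull (insert 0 (ds ` {..k}))"

lemma Kh: "compact (Kh k)" "convex (Kh k)" "0 \<in> Kh k" "j \<le> k \<Longrightarrow> ds j \<in> Kh k"
  unfolding Kh_def by (auto intro: finite_imp_compact_convex_hull hull_inc)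

definition dK :: "nat \<Rightarrow> ('a \<Rightarrow>\<^sub>L real) \<Rightarrow> real" where
  "dK k a = (INF d\<in>Kh k. nY (a - d))"

lemma dK_bdd: "bdd_below ((\<lambda>d. nY (a - d)) ` Kh k)"
  by (rule bdd_belowI2[of _ 0]) (rule nY_nonneg)

lemma dK_lower: "d \<in> Kh k \<Longrightarrow> dK k a \<le> nY (a - d)"
  unfolding dK_def by (rule cINF_lower[OF dK_bdd])

lemma dK_greatest: "(\<And>d. d \<in> Kh k \<Longrightarrow> r \<le> nY (a - d)) \<Longrightarrow> r \<le> dK k a"
  unfolding dK_def using Kh(3) by (intro cINF_greatest) auto

lemma dK_lessE:
  assumes "dK k a < r" obtains d where "d \<in> Kh k" "nY (a - d) < r"
proof (rule ccontr)
  assume "\<not> thesis"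
  then have "r \<le> dK k a" using that by (intro dK_greatest) (meson not_le)
  then show False using assms by simp
qed

lemma dK_nonneg: "0 \<le> dK k a"
  by (rule dK_greatest) (rule nY_nonneg)

lemma dK_le: "dK k a \<le> nY a"
  using dK_lower[OF Kh(3), of k a] by simp

lemma dK_mid: "dK k ((1/2) *\<^sub>R (a + b)) \<le> (dK k a + dK k b) / 2"
proof (rule field_le_epsilon)
  fix e :: real assume e: "0 < e"
  obtain c where c: "c \<in> Kh k" "nY (a - c) < dK k a + e" using dK_lessE[of k a "dK k a + e"] e by auto
  obtain d where d: "d \<in> Kh k" "nY (b - d) < dK k b + e" using dK_lessE[of k b "dK k b + e"] e by auto
  have "(1/2) *\<^sub>R (c + d) \<in> Kh k"
    using convexD[OF Kh(2) c(1) d(1), of "1/2" "1/2"] by (simp add: scaleR_add_right)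
  then have "dK k ((1/2) *\<^sub>R (a + b)) \<le> nY ((1/2) *\<^sub>R (a + b) - (1/2) *\<^sub>R (c + d))" by (rule dK_lower)
  also have "(1/2) *\<^sub>R (a + b) - (1/2) *\<^sub>R (c + d) = (1/2) *\<^sub>R ((a - c) + (b - d))"
    by (simp add: algebra_simps)
  also have "nY \<dots> \<le> (nY (a - c) + nY (b - d)) / 2" by (rule nY_mid)
  finally show "dK k ((1/2) *\<^sub>R (a + b)) \<le> (dK k a + dK k b) / 2 + e" using c d by argo
qed

lemma dK_small:
  assumes "0 < e" obtains k where "dK k a < e"
proof -
  obtain n where n: "\<forall>y\<in>Y. \<bar>blinfun_apply a y - blinfun_apply (ds n) y\<bar> \<le> e / 2 * norm y"
    using ds_dense[of "e / 2" a] assms by auto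
  then have "nY (a - ds n) \<le> e / 2"
    using assms by (intro nY_least) (auto simp: minus_blinfun.rep_eq)
  then have "dK n a < e" using dK_lower[OF Kh(4)[of n n], of a] assms by simp
  then show ?thesis by (rule that)
qed

text \<open>
  The scaling makes \<open>ev k\<close> bounded by \<open>nY\<close>, uniformly in \<open>k\<close>.
\<close>

definition ev :: "nat \<Rightarrow> ('a \<Rightarrow>\<^sub>L real) \<Rightarrow> real" where
  "ev k a = blinfun_apply a (xs k) / (1 + norm (xs k))"

lemma ev_le: "\<bar>ev k a\<bar> \<le> nY a"
proof -
  have "nY a * norm (xs k) \<le> nY a * (1 + norm (xs k))" using nY_nonneg by (intro mult_left_mono) auto
  then have "\<bar>blinfun_apply a (xs k)\<bar> \<le> nY a * (1 + norm (xs k))" using nY_upper[OF xsY, of a k] by linarith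
  moreover have "0 < 1 + norm (xs k)" by (simp add: add_pos_nonneg)
  ultimately show ?thesis unfolding ev_def by (simp add: abs_div pos_divide_le_eq)
qed

lemma ev_mid: "ev k ((1/2) *\<^sub>R (a + b)) = (ev k a + ev k b) / 2"
  by (simp add: ev_def scaleR_blinfun.rep_eq plus_blinfun.rep_eq flip: add_divide_distrib)

definition sq :: "nat \<Rightarrow> ('a \<Rightarrow>\<^sub>L real) \<Rightarrow> real" where
  "sq k a = (1/2)^k * ((dK k a)\<^sup>2 + (ev k a)\<^sup>2)"

text \<open>
  The squared dual gauge. The summands \<open>ev k\<close> make it strictly convex on restrictions to \<open>Y\<close>, and the
  distances \<open>dK k\<close> force sequences along which \<open>M\<close> converges to its value at the weak limit to be
  relatively compact in norm.
\<close>

definition M :: "('a \<Rightarrow>\<^sub>L real) \<Rightarrow> real" where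
  "M a = (nY a)\<^sup>2 + (\<Sum>k. sq k a)"

lemma sq_nonneg: "0 \<le> sq k a" by (simp add: sq_def)

lemma sq_le: "sq k a \<le> (1/2)^k * (2 * (nY a)\<^sup>2)"
proof -
  have "(dK k a)\<^sup>2 \<le> (nY a)\<^sup>2" using dK_le dK_nonneg by (intro power_mono) auto
  moreover have "(ev k a)\<^sup>2 \<le> (nY a)\<^sup>2"
    using ev_le[of k a] nY_nonneg[of a] by (metis abs_ge_zero power2_abs power_mono)
  ultimately show ?thesis unfolding sq_def by (intro mult_left_mono) auto
qed

lemma geo: "(\<lambda>k. (1/2)^k * (c::real)) sums (2 * c)"
  using sums_mult2[OF geometric_sums[of "1/2::real"], of c] by simp

lemma sq_summable: "summable (\<lambda>k. sq k a)"
proof (rule summable_comparison_test')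
  show "summable (\<lambda>k. (1/2)^k * (2 * (nY a)\<^sup>2))" by (rule sums_summable[OF geo])
  show "norm (sq k a) \<le> (1/2)^k * (2 * (nY a)\<^sup>2)" for k using sq_le[of k a] sq_nonneg[of k a] by simp
qed

lemma M_ge: "(nY a)\<^sup>2 \<le> M a"
  unfolding M_def using suminf_nonneg[OF sq_summable] sq_nonneg by simp

lemma M_le: "M a \<le> 5 * (nY a)\<^sup>2"
proof -
  have "(\<Sum>k. sq k a) \<le> (\<Sum>k. (1/2)^k * (2 * (nY a)\<^sup>2))"
    by (intro suminf_le sq_le sq_summable sums_summable[OF geo])
  also have "\<dots> = 2 * (2 * (nY a)\<^sup>2)" by (rule sums_unique[OF geo, symmetric])
  finally show ?thesis by (simp add: M_def)
qed

lemma square_mid: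
  fixes s r m :: real
  assumes "\<bar>m\<bar> \<le> \<bar>s + r\<bar> / 2" shows "m\<^sup>2 + (s - r)\<^sup>2 / 4 \<le> (s\<^sup>2 + r\<^sup>2) / 2"
proof -
  have "m\<^sup>2 \<le> ((s + r) / 2)\<^sup>2"
    using assms by (metis abs_divide abs_numeral abs_le_square_iff)
  then show ?thesis by (simp add: power2_eq_square algebra_simps field_simps)
qed

text \<open>
  A quantitative form of strict convexity: each single term of the series measures how far \<open>a\<close> and
  \<open>b\<close> are apart.
\<close>

lemma M_mid:
  "M ((1/2) *\<^sub>R (a + b)) + (1/2)^k * ((dK k a - dK k b)\<^sup>2 + (ev k a - ev k b)\<^sup>2) / 4 \<le> (M a + M b) / 2"
proof -
  let ?m = "(1/2) *\<^sub>R (a + b)"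
  define dl where "dl j = (1/2)^j * ((dK j a - dK j b)\<^sup>2 + (ev j a - ev j b)\<^sup>2) / 4" for j
  have sq: "sq j ?m + dl j \<le> (sq j a + sq j b) / 2" for j
  proof -
    have 1: "(dK j ?m)\<^sup>2 + (dK j a - dK j b)\<^sup>2 / 4 \<le> ((dK j a)\<^sup>2 + (dK j b)\<^sup>2) / 2"
      using dK_mid[of j a b] dK_nonneg[of j] by (intro square_mid) (simp add: abs_of_nonneg)
    have 2: "(ev j ?m)\<^sup>2 + (ev j a - ev j b)\<^sup>2 / 4 \<le> ((ev j a)\<^sup>2 + (ev j b)\<^sup>2) / 2"
      by (intro square_mid) (simp add: ev_mid)
    have "(1/2)^j * (((dK j ?m)\<^sup>2 + (dK j a - dK j b)\<^sup>2 / 4) + ((ev j ?m)\<^sup>2 + (ev j a - ev j b)\<^sup>2 / 4))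
      \<le> (1/2)^j * (((dK j a)\<^sup>2 + (dK j b)\<^sup>2) / 2 + ((ev j a)\<^sup>2 + (ev j b)\<^sup>2) / 2)"
      using 1 2 by (intro mult_left_mono add_mono) auto
    then show ?thesis by (simp add: sq_def dl_def algebra_simps add_divide_distrib)
  qed
  have dl0: "0 \<le> dl j" for j by (simp add: dl_def)
  have sm: "(\<lambda>j. sq j ?m + (if j = k then dl j else 0)) sums ((\<Sum>j. sq j ?m) + dl k)"
    by (intro sums_add summable_sums sq_summable sums_single)
  have sr: "(\<lambda>j. (sq j a + sq j b) / 2) sums (((\<Sum>j. sq j a) + (\<Sum>j. sq j b)) / 2)"
    by (intro sums_divide sums_add summable_sums sq_summable)
  have "(\<Sum>j. sq j ?m) + dl k \<le> ((\<Sum>j. sq j a) + (\<Sum>j. sq j b)) / 2"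
  proof (rule sums_le[OF _ sm sr])
    fix j show "sq j ?m + (if j = k then dl j else 0) \<le> (sq j a + sq j b) / 2"
      using sq[of j] dl0[of j] by auto
  qed
  moreover have "(nY ?m)\<^sup>2 \<le> ((nY a)\<^sup>2 + (nY b)\<^sup>2) / 2"
  proof -
    have "(nY ?m)\<^sup>2 + (nY a - nY b)\<^sup>2 / 4 \<le> ((nY a)\<^sup>2 + (nY b)\<^sup>2) / 2"
      using nY_mid[of a b] nY_nonneg by (intro square_mid) (simp add: abs_of_nonneg)
    then show ?thesis using zero_le_power2[of "nY a - nY b"] by linarith
  qed
  ultimately show ?thesis by (simp add: M_def dl_def add_divide_distrib)
qed

definition Phi :: "'a \<Rightarrow> ('a \<Rightarrow>\<^sub>L real) \<Rightarrow> real" where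
  "Phi u a = blinfun_apply a u - M a / 2"

text \<open>
  The conjugate of \<open>M / 2\<close>, a substitute for half the squared norm.
\<close>

definition p :: "'a \<Rightarrow> real" where
  "p u = (SUP a. Phi u a)"

lemma Phi_le: "u \<in> Y \<Longrightarrow> Phi u a \<le> nY a * norm u - (nY a)\<^sup>2 / 2"
  using nY_upper[of u a] M_ge[of a] by (simp add: Phi_def)

lemma Phi_bdd: assumes u: "u \<in> Y" shows "bdd_above (range (Phi u))"
proof (rule bdd_aboveI2)
  fix a
  have "0 \<le> (nY a - norm u)\<^sup>2" by simp
  then show "Phi u a \<le> (norm u)\<^sup>2 / 2" using Phi_le[OF u, of a] by (simp add: power2_eq_square algebra_simps)
qed

lemma p_upper: "u \<in> Y \<Longrightarrow> Phi u a \<le> p u"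
  unfolding p_def by (rule cSUP_upper[OF _ Phi_bdd]) auto

lemma p_least: "(\<And>a. Phi u a \<le> r) \<Longrightarrow> p u \<le> r"
  unfolding p_def by (rule cSUP_least) auto

lemma p_near: assumes "0 < e" obtains a where "p u - e < Phi u a"
proof (rule ccontr)
  assume "\<not> thesis"
  then have "p u \<le> p u - e" using that by (intro p_least) (meson not_le)
  then show False using assms by simp
qed

lemma p_nonneg: "u \<in> Y \<Longrightarrow> 0 \<le> p u"
proof -
  assume u: "u \<in> Y"
  have "nY 0 = 0" using nY_le_norm[of 0] nY_nonneg[of 0] by simp
  then have "M 0 = 0" using M_ge[of 0] M_le[of 0] by simp
  then show ?thesis using p_upper[OF u, of 0] by (simp add: Phi_def)
qed

lemma p_le: assumes u: "u \<in> Y" shows "p u \<le> (norm u)\<^sup>2 / 2"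
proof (rule p_least)
  fix a
  have "0 \<le> (nY a - norm u)\<^sup>2" by simp
  then show "Phi u a \<le> (norm u)\<^sup>2 / 2" using Phi_le[OF u, of a] by (simp add: power2_eq_square algebra_simps)
qed

text \<open>
  Test the supremum with a multiple of a functional that norms \<open>u\<close>; \<open>M \<le> 5 * nY\<^sup>2\<close> gives the constant.
\<close>

lemma p_ge: assumes u: "u \<in> Y" shows "(norm u)\<^sup>2 / 10 \<le> p u"
proof (cases "u = 0")
  case True
  then show ?thesis using p_nonneg[OF u] by simp
next
  case False
  obtain b where b: "norm b \<le> 1" "blinfun_apply b u = norm u"
  proof -
    define S where "S = range (\<lambda>t::real. t *\<^sub>R u)"
    have S: "subspace S" unfolding S_def by (auto simp: subspace_def scaleR_add_left[symmetric] intro!: image_eqI[of 0 _ 0])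
    define l where "l y = (THE t. y = t *\<^sub>R u) * norm u" for y
    have l: "l (t *\<^sub>R u) = t * norm u" for t unfolding l_def using False by simp
    obtain b :: "'a \<Rightarrow>\<^sub>L real" where "norm b \<le> 1" "\<And>x. x \<in> S \<Longrightarrow> blinfun_apply b x = l x"
    proof (rule functional_extension[OF S, of l 1])
      show "l (x + y) = l x + l y" if "x \<in> S" "y \<in> S" for x y
        using that l by (auto simp: S_def distrib_right simp flip: scaleR_add_left)
      show "l (t *\<^sub>R x) = t * l x" if "x \<in> S" for t x
        using that l by (auto simp: S_def)
      show "\<bar>l x\<bar> \<le> 1 * norm x" if "x \<in> S" for x
        using that l by (auto simp: S_def abs_mult)
    qed auto
    moreover have "u \<in> S" unfolding S_def by (rule image_eqI[of _ _ 1]) auto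
    ultimately show ?thesis using that[of b] l[of 1] by simp
  qed
  define t where "t = norm u / 5"
  have "nY (t *\<^sub>R b) \<le> t * 1"
  proof -
    have "nY (t *\<^sub>R b) \<le> norm (t *\<^sub>R b)" by (rule nY_le_norm)
    also have "\<dots> = t * norm b" by (simp add: t_def)
    also have "\<dots> \<le> t * 1" using b by (intro mult_left_mono) (auto simp: t_def)
    finally show ?thesis .
  qed
  then have "(nY (t *\<^sub>R b))\<^sup>2 \<le> t\<^sup>2" using nY_nonneg by (intro power_mono) auto
  then have "M (t *\<^sub>R b) \<le> 5 * t\<^sup>2" using M_le[of "t *\<^sub>R b"] by simp
  then have "t * norm u - 5 * t\<^sup>2 / 2 \<le> Phi u (t *\<^sub>R b)" by (simp add: Phi_def scaleR_blinfun.rep_eq b)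
  moreover have "t * norm u - 5 * t\<^sup>2 / 2 = (norm u)\<^sup>2 / 10" by (simp add: t_def power2_eq_square)
  ultimately show ?thesis using p_upper[OF u, of "t *\<^sub>R b"] by simp
qed

lemma Phi_bound:
  assumes u: "u \<in> Y" and a: "-1 \<le> Phi u a" shows "nY a \<le> 2 * norm u + 2"
proof (rule ccontr)
  assume n: "\<not> ?thesis"
  have "1 * 2 < (nY a / 2 - norm u) * nY a"
    using n norm_ge_zero[of u] by (intro mult_strict_mono) (linarith | simp)+
  then show False using Phi_le[OF u, of a] a by (simp add: power2_eq_square algebra_simps)
qed

lemma p_lipschitz:
  assumes u: "u \<in> Y" and v: "v \<in> Y" shows "p u \<le> p v + 2 * norm u * norm (u - v)"
proof (rule p_least)
  fix a
  show "Phi u a \<le> p v + 2 * norm u * norm (u - v)"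
  proof (cases "nY a \<le> 2 * norm u")
    case True
    have uv: "u - v \<in> Y" using Y u v by (rule subspace_diff)
    have "Phi u a = Phi v a + blinfun_apply a (u - v)" by (simp add: Phi_def blinfun.diff_right)
    also have "\<dots> \<le> p v + nY a * norm (u - v)"
      using p_upper[OF v, of a] nY_upper[OF uv, of a] by simp
    also have "\<dots> \<le> p v + 2 * norm u * norm (u - v)" using True by (intro add_left_mono mult_right_mono) auto
    finally show ?thesis .
  next
    case False
    have "0 \<le> nY a * (nY a / 2 - norm u)" using False nY_nonneg by (intro mult_nonneg_nonneg) auto
    then have "Phi u a \<le> 0" using Phi_le[OF u, of a] by (simp add: power2_eq_square algebra_simps)
    then show ?thesis using p_nonneg[OF v] by (smt (verit) mult_nonneg_nonneg norm_ge_zero)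
  qed
qed

end

lemma not_eventually_subseq:
  fixes P :: "nat \<Rightarrow> bool"
  assumes "\<not> eventually P sequentially"
  obtains r :: "nat \<Rightarrow> nat" where "strict_mono r" "\<And>n. \<not> P (r n)"
proof -
  have "infinite {n. \<not> P n}"
    using assms by (simp add: frequently_cofinite[symmetric] cofinite_eq_sequentially frequently_def)
  then obtain r :: "nat \<Rightarrow> nat" where "strict_mono r" "\<forall>n. r n \<in> {n. \<not> P n}"
    using infinite_enumerate by blast
  then show ?thesis using that[of r] by simp
qed

context separable_dual_subspace
begin

definition wconv :: "(nat \<Rightarrow> 'a \<Rightarrow>\<^sub>L real) \<Rightarrow> ('a \<Rightarrow>\<^sub>L real) \<Rightarrow> bool" where
  "wconv b a \<longleftrightarrow> (\<forall>y\<in>Y. (\<lambda>n. blinfun_apply (b n) y) \<longlonglongrightarrow> blinfun_apply a y)"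

lemma wconv_subseq: "wconv b a \<Longrightarrow> strict_mono r \<Longrightarrow> wconv (\<lambda>n. b (r n)) a"
  unfolding wconv_def using LIMSEQ_subseq_LIMSEQ[of _ _ r] by (auto simp: comp_def)

lemma Cauchy_on_Y:
  fixes b :: "nat \<Rightarrow> 'a \<Rightarrow>\<^sub>L real"
  assumes R: "\<And>n. nY (b n) \<le> R" and conv: "\<And>k. convergent (\<lambda>n. blinfun_apply (b n) (xs k))" and y: "y \<in> Y"
  shows "convergent (\<lambda>n. blinfun_apply (b n) y)"
proof -
  have R0: "0 \<le> R" using R[of 0] nY_nonneg[of "b 0"] by simp
  have "Cauchy (\<lambda>n. blinfun_apply (b n) y)"
    unfolding Cauchy_def
  proof (intro allI impI)
    fix e :: real assume e: "0 < e"
    define d where "d = e / 3 / (R + 1)"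
    have d: "0 < d" using e R0 by (simp add: d_def)
    obtain k where k: "norm (xs k - y) < d"
      using subsetD[OF xs_dense y] d unfolding closure_approachable by (auto simp: dist_norm)
    have "R * d \<le> (R + 1) * d" using d by (intro mult_right_mono) auto
    also have "\<dots> = e / 3" unfolding d_def using R0 by (intro mult_divide_cancel) linarith
    finally have Rd: "R * d \<le> e / 3" .
    have close: "\<bar>blinfun_apply (b n) y - blinfun_apply (b n) (xs k)\<bar> \<le> e / 3" for n
    proof -
      have yk: "y - xs k \<in> Y" using Y y xsY by (rule subspace_diff)
      have "\<bar>blinfun_apply (b n) (y - xs k)\<bar> \<le> nY (b n) * norm (y - xs k)" by (rule nY_upper[OF yk])
      also have "\<dots> \<le> R * d" using R[of n] R0 k by (intro mult_mono) (auto simp: norm_minus_commute)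
      finally show ?thesis using Rd by (simp add: blinfun.diff_right)
    qed
    have "Cauchy (\<lambda>n. blinfun_apply (b n) (xs k))" using conv by (rule convergent_Cauchy)
    then obtain N where N: "\<forall>m\<ge>N. \<forall>n\<ge>N. dist (blinfun_apply (b m) (xs k)) (blinfun_apply (b n) (xs k)) < e / 3"
      unfolding Cauchy_def using e by (metis divide_pos_pos zero_less_numeral)
    show "\<exists>N. \<forall>m\<ge>N. \<forall>n\<ge>N. dist (blinfun_apply (b m) y) (blinfun_apply (b n) y) < e"
    proof (intro exI[of _ N] allI impI)
      fix m n assume "N \<le> m" "N \<le> n"
      then have "\<bar>blinfun_apply (b m) (xs k) - blinfun_apply (b n) (xs k)\<bar> < e / 3"
        using N by (simp add: dist_real_def)
      then show "dist (blinfun_apply (b m) y) (blinfun_apply (b n) y) < e"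
        using close[of m] close[of n] unfolding dist_real_def by linarith
    qed
  qed
  then show ?thesis by (simp add: Cauchy_convergent_iff)
qed

text \<open>
  The coordinates on the countable dense set \<open>xs\<close> lie in a sequentially compact product of intervals.
  The pointwise limit is a bounded functional on \<open>Y\<close> and is extended to the whole space.
\<close>

lemma weak_subsequence:
  fixes b :: "nat \<Rightarrow> 'a \<Rightarrow>\<^sub>L real"
  assumes R: "\<And>n. nY (b n) \<le> R"
  obtains r a where "strict_mono r" "norm a \<le> R" "wconv (\<lambda>n. b (r n)) a"
proof -
  have R0: "0 \<le> R" using R[of 0] nY_nonneg[of "b 0"] by simp
  let ?P = "PiE UNIV (\<lambda>k::nat. {- (R * norm (xs k))..R * norm (xs k)})"
  define v where "v n = (\<lambda>k. blinfun_apply (b n) (xs k))" for n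
  have "compactin (product_topology (\<lambda>_::nat. euclidean :: real topology) UNIV) ?P"
    by (subst compactin_PiE) auto
  then have "compact ?P" by (simp add: euclidean_product_topology)
  then have "seq_compact ?P" by (rule compact_imp_seq_compact)
  moreover have "v n \<in> ?P" for n
  proof -
    have "\<bar>blinfun_apply (b n) (xs k)\<bar> \<le> R * norm (xs k)" for k
      using nY_upper[OF xsY[of k], of "b n"] mult_right_mono[OF R[of n], of "norm (xs k)"] by simp
    then show ?thesis by (auto simp: v_def abs_le_iff minus_le_iff)
  qed
  ultimately obtain g r where r: "strict_mono r" and g: "(v \<circ> r) \<longlonglongrightarrow> g"
    by (auto elim!: seq_compactE)
  have conv: "convergent (\<lambda>n. blinfun_apply (b (r n)) (xs k))" for k
  proof -
    have "continuous_on UNIV (\<lambda>x::nat \<Rightarrow> real. x k)" by (rule continuous_on_product_coordinates)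
    then have "isCont (\<lambda>x::nat \<Rightarrow> real. x k) g"
      by (simp add: continuous_on_eq_continuous_at[OF open_UNIV] del: continuous_on_product_coordinates)
    from isCont_tendsto_compose[OF this g] have "(\<lambda>n. blinfun_apply (b (r n)) (xs k)) \<longlonglongrightarrow> g k"
      by (simp add: v_def comp_def)
    then show ?thesis by (rule convergentI)
  qed
  define l where "l y = lim (\<lambda>n. blinfun_apply (b (r n)) y)" for y
  have l: "(\<lambda>n. blinfun_apply (b (r n)) y) \<longlonglongrightarrow> l y" if "y \<in> Y" for y
    unfolding l_def using Cauchy_on_Y[of "\<lambda>n. b (r n)", OF R conv that] by (simp add: convergent_LIMSEQ_iff)
  obtain a :: "'a \<Rightarrow>\<^sub>L real" where a: "norm a \<le> R" "\<And>x. x \<in> Y \<Longrightarrow> blinfun_apply a x = l x"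
  proof (rule functional_extension[OF Y, of l R])
    show "l (x + y) = l x + l y" if x: "x \<in> Y" and y: "y \<in> Y" for x y
      using l[OF subspace_add[OF Y x y]] tendsto_add[OF l[OF x] l[OF y]]
      by (simp add: blinfun.add_right LIMSEQ_unique)
    show "l (t *\<^sub>R x) = t * l x" if x: "x \<in> Y" for t x
      using l[OF subspace_scale[OF Y x, of t]] tendsto_mult_left[OF l[OF x], of t]
      by (simp add: blinfun.scaleR_right LIMSEQ_unique)
    show "\<bar>l x\<bar> \<le> R * norm x" if x: "x \<in> Y" for x
    proof (rule LIMSEQ_le_const2[OF tendsto_rabs[OF l[OF x]]], intro exI allI impI)
      fix n
      show "\<bar>blinfun_apply (b (r n)) x\<bar> \<le> R * norm x"
        using nY_upper[OF x, of "b (r n)"] mult_right_mono[OF R[of "r n"], of "norm x"] by simp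
    qed
  qed (use R0 in auto)
  show ?thesis
    by (rule that[OF r a(1)]) (use l a(2) in \<open>auto simp: wconv_def\<close>)
qed

text \<open>
  By compactness of \<open>Kh k\<close>, a uniform bound on the distance to \<open>Kh k\<close> survives the passage to a weak
  limit. It is used both for the lower semicontinuity of \<open>dK\<close> and for the norm convergence of maximizing
  sequences.
\<close>

lemma wconv_near_Kh:
  assumes w: "wconv b a" and e: "\<And>n. e n \<in> Kh k" and c: "\<And>n. nY (b n - e n) \<le> c"
  obtains r d where "strict_mono r" "d \<in> Kh k" "(\<lambda>n. e (r n)) \<longlonglongrightarrow> d" "nY (a - d) \<le> c"
proof -
  have "seq_compact (Kh k)" using Kh(1) by (rule compact_imp_seq_compact)
  then obtain d r where d: "d \<in> Kh k" and r: "strict_mono r" and lim: "(e \<circ> r) \<longlonglongrightarrow> d"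
    using e by (auto elim!: seq_compactE)
  have lim: "(\<lambda>n. e (r n)) \<longlonglongrightarrow> d" using lim by (simp add: comp_def)
  have "nY (a - d) \<le> c"
  proof (rule nY_least)
    show "0 \<le> c" using c[of 0] nY_nonneg[of "b 0 - e 0"] by simp
    fix y assume y: "y \<in> Y"
    have "(\<lambda>n. blinfun_apply (b (r n)) y) \<longlonglongrightarrow> blinfun_apply a y"
      using wconv_subseq[OF w r] y by (auto simp: wconv_def)
    moreover have "(\<lambda>n. blinfun_apply (e (r n)) y) \<longlonglongrightarrow> blinfun_apply d y"
      by (intro blinfun.tendsto lim tendsto_const)
    ultimately have "(\<lambda>n. blinfun_apply (b (r n) - e (r n)) y) \<longlonglongrightarrow> blinfun_apply (a - d) y"
      unfolding minus_blinfun.rep_eq by (rule tendsto_diff)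
    then show "\<bar>blinfun_apply (a - d) y\<bar> \<le> c * norm y"
    proof (rule LIMSEQ_le_const2[OF tendsto_rabs], intro exI allI impI)
      fix n
      show "\<bar>blinfun_apply (b (r n) - e (r n)) y\<bar> \<le> c * norm y"
        using nY_upper[OF y, of "b (r n) - e (r n)"] mult_right_mono[OF c[of "r n"], of "norm y"] by simp
    qed
  qed
  then show ?thesis by (rule that[OF r d lim])
qed

text \<open>
  Lower semicontinuity along a sequence, expressed by strict lower bounds because these pass through
  sums and squares without extended real arithmetic.
\<close>

definition lsc_seq :: "(nat \<Rightarrow> real) \<Rightarrow> real \<Rightarrow> bool" where
  "lsc_seq s l \<longleftrightarrow> (\<forall>c<l. eventually (\<lambda>n. c < s n) sequentially)"

lemma lsc_seq_add: "lsc_seq s l \<Longrightarrow> lsc_seq s' l' \<Longrightarrow> lsc_seq (\<lambda>n. s n + s' n) (l + l')"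
  unfolding lsc_seq_def
proof (intro allI impI)
  fix c assume s: "\<forall>c<l. eventually (\<lambda>n. c < s n) sequentially" "\<forall>c<l'. eventually (\<lambda>n. c < s' n) sequentially"
    and c: "c < l + l'"
  define h where "h = (l + l' - c) / 2"
  have "eventually (\<lambda>n. l - h < s n) sequentially" "eventually (\<lambda>n. l' - h < s' n) sequentially"
    using s c by (auto simp: h_def)
  then show "eventually (\<lambda>n. c < s n + s' n) sequentially"
  proof eventually_elim
    case (elim n)
    have "2 * h = l + l' - c" by (simp add: h_def)
    then show ?case using elim by linarith
  qed
qed

lemma lsc_seq_mult: "lsc_seq s l \<Longrightarrow> 0 < t \<Longrightarrow> lsc_seq (\<lambda>n. t * s n) (t * l)"
  unfolding lsc_seq_def
proof (intro allI impI)
  fix c assume s: "\<forall>c<l. eventually (\<lambda>n. c < s n) sequentially" and t: "0 < t" "c < t * l"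
  then have "c / t < l" by (simp add: pos_divide_less_eq mult.commute)
  then have "eventually (\<lambda>n. c / t < s n) sequentially" using s by blast
  then show "eventually (\<lambda>n. c < t * s n) sequentially"
    by eventually_elim (use t in \<open>simp add: pos_divide_less_eq mult.commute\<close>)
qed

lemma lsc_seq_sum: "(\<And>k. lsc_seq (s k) (l k)) \<Longrightarrow> lsc_seq (\<lambda>n. \<Sum>k<m::nat. s k n) (\<Sum>k<m. l k)"
  by (induction m) (auto simp: lsc_seq_add, simp add: lsc_seq_def)

lemma lsc_seq_square:
  assumes s: "lsc_seq s l" and l: "0 \<le> l" shows "lsc_seq (\<lambda>n. (s n)\<^sup>2) (l\<^sup>2)"
  unfolding lsc_seq_def
proof (intro allI impI)
  fix c assume c: "c < l\<^sup>2"
  show "eventually (\<lambda>n. c < (s n)\<^sup>2) sequentially"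
  proof (cases "c < 0")
    case True
    then show ?thesis by (intro always_eventually allI) (meson less_le_trans zero_le_power2)
  next
    case False
    then have "sqrt c < l" using c l by (metis not_less real_sqrt_less_iff real_sqrt_unique)
    then have "eventually (\<lambda>n. sqrt c < s n) sequentially" using s by (simp add: lsc_seq_def)
    then show ?thesis
    proof eventually_elim
      case (elim n)
      then have "(sqrt c)\<^sup>2 < (s n)\<^sup>2" using False by (intro power_strict_mono) auto
      then show ?case using False by simp
    qed
  qed
qed

lemma lsc_seq_le: assumes "lsc_seq s l" "\<And>n. s n \<le> c n" "c \<longlonglongrightarrow> C" shows "l \<le> C"
proof (rule ccontr)
  assume "\<not> l \<le> C"
  define d where "d = (C + l) / 2"
  have d: "C < d" "d < l" using \<open>\<not> l \<le> C\<close> by (auto simp: d_def)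
  have "eventually (\<lambda>n. d < s n) sequentially" "eventually (\<lambda>n. c n < d) sequentially"
    using assms(1) order_tendstoD(2)[OF assms(3) d(1)] d(2) by (auto simp: lsc_seq_def)
  then have "eventually (\<lambda>n. False) sequentially"
  proof eventually_elim
    case (elim n)
    then show ?case using assms(2)[of n] by linarith
  qed
  then show False by simp
qed

lemma nY_lsc: assumes w: "wconv b a" shows "lsc_seq (\<lambda>n. nY (b n)) (nY a)"
  unfolding lsc_seq_def
proof (intro allI impI, rule ccontr)
  fix c assume c: "c < nY a" and "\<not> eventually (\<lambda>n. c < nY (b n)) sequentially"
  then obtain r where r: "strict_mono (r :: nat \<Rightarrow> nat)" "\<And>n. \<not> c < nY (b (r n))"
    using not_eventually_subseq[of "\<lambda>n. c < nY (b n)"] by auto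
  have "nY a \<le> c"
  proof (rule nY_least)
    show "0 \<le> c" using r(2)[of 0] nY_nonneg[of "b (r 0)"] by simp
    fix y assume y: "y \<in> Y"
    have "(\<lambda>n. blinfun_apply (b (r n)) y) \<longlonglongrightarrow> blinfun_apply a y"
      using wconv_subseq[OF w r(1)] y by (auto simp: wconv_def)
    then show "\<bar>blinfun_apply a y\<bar> \<le> c * norm y"
    proof (rule LIMSEQ_le_const2[OF tendsto_rabs], intro exI allI impI)
      fix n
      have "nY (b (r n)) * norm y \<le> c * norm y" using r(2)[of n] by (intro mult_right_mono) auto
      then show "\<bar>blinfun_apply (b (r n)) y\<bar> \<le> c * norm y"
        using nY_upper[OF y, of "b (r n)"] by simp
    qed
  qed
  then show False using c by simp
qed

lemma dK_lsc: assumes w: "wconv b a" shows "lsc_seq (\<lambda>n. dK k (b n)) (dK k a)"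
  unfolding lsc_seq_def
proof (intro allI impI, rule ccontr)
  fix c assume c: "c < dK k a" and "\<not> eventually (\<lambda>n. c < dK k (b n)) sequentially"
  then obtain r where r: "strict_mono (r :: nat \<Rightarrow> nat)" "\<And>n. \<not> c < dK k (b (r n))"
    using not_eventually_subseq[of "\<lambda>n. c < dK k (b n)"] by auto
  define c' where "c' = (c + dK k a) / 2"
  have c': "c < c'" "c' < dK k a" using c by (auto simp: c'_def)
  have "\<exists>e. e \<in> Kh k \<and> nY (b (r n) - e) \<le> c'" for n
  proof -
    have "dK k (b (r n)) < c'" using r(2)[of n] c' by simp
    then show ?thesis by (rule dK_lessE) (auto intro: less_imp_le)
  qed
  then obtain e where e: "\<And>n. e n \<in> Kh k" "\<And>n. nY (b (r n) - e n) \<le> c'" by metis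
  obtain r' d where "d \<in> Kh k" "nY (a - d) \<le> c'"
    using wconv_near_Kh[OF wconv_subseq[OF w r(1)] e] by blast
  then show False using dK_lower[of d k a] c' by simp
qed

lemma M_lsc:
  assumes w: "wconv b a" and le: "\<And>n. M (b n) \<le> c n" and c: "c \<longlonglongrightarrow> C"
  shows "M a \<le> C"
proof -
  have evl: "lsc_seq (\<lambda>n. \<bar>ev k (b n)\<bar>) \<bar>ev k a\<bar>" for k
  proof -
    have "(\<lambda>n. \<bar>ev k (b n)\<bar>) \<longlonglongrightarrow> \<bar>ev k a\<bar>"
      unfolding ev_def using w xsY[of k] add_nonneg_pos[OF norm_ge_zero zero_less_one, of "xs k"]
      by (intro tendsto_rabs tendsto_divide tendsto_const) (auto simp: wconv_def)
    then show ?thesis unfolding lsc_seq_def by (auto intro: order_tendstoD)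
  qed
  have sql: "lsc_seq (\<lambda>n. sq k (b n)) (sq k a)" for k
  proof -
    have "lsc_seq (\<lambda>n. (1/2)^k * ((dK k (b n))\<^sup>2 + \<bar>ev k (b n)\<bar>\<^sup>2)) ((1/2)^k * ((dK k a)\<^sup>2 + \<bar>ev k a\<bar>\<^sup>2))"
      by (intro lsc_seq_mult lsc_seq_add lsc_seq_square dK_lsc[OF w] evl dK_nonneg) auto
    then show ?thesis by (simp add: sq_def)
  qed
  have part: "(nY a)\<^sup>2 + (\<Sum>k<m. sq k a) \<le> C" for m
  proof (rule lsc_seq_le[OF _ _ c])
    show "lsc_seq (\<lambda>n. (nY (b n))\<^sup>2 + (\<Sum>k<m. sq k (b n))) ((nY a)\<^sup>2 + (\<Sum>k<m. sq k a))"
      by (intro lsc_seq_add lsc_seq_square lsc_seq_sum nY_lsc[OF w] sql nY_nonneg)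
    show "(nY (b n))\<^sup>2 + (\<Sum>k<m. sq k (b n)) \<le> c n" for n
      using le[of n] sum_le_suminf[OF sq_summable[of "b n"], of "{..<m}"] sq_nonneg by (simp add: M_def)
  qed
  have "(\<Sum>k. sq k a) \<le> C - (nY a)\<^sup>2"
    by (rule suminf_le_const[OF sq_summable]) (use part in \<open>simp add: le_diff_eq add.commute\<close>)
  then show ?thesis by (simp add: M_def)
qed

text \<open>
  \<open>M\<close> is lower semicontinuous for weak convergence on \<open>Y\<close>, so a weak limit of a maximizing sequence
  is a maximizer.
\<close>

lemma maximizer:
  assumes u: "u \<in> Y"
  obtains a where "norm a \<le> 2 * norm u + 2" "Phi u a = p u"
proof -
  have "\<exists>a. p u - 1 / Suc n < Phi u a" for n
    using p_near[of "1 / Suc n" u] by (metis of_nat_0_less_iff zero_less_Suc zero_less_divide_1_iff)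
  then obtain b where b: "\<And>n. p u - 1 / Suc n < Phi u (b n)" by metis
  have "nY (b n) \<le> 2 * norm u + 2" for n
  proof (rule Phi_bound[OF u])
    have "1 / real (Suc n) \<le> 1" by simp
    then show "-1 \<le> Phi u (b n)" using b[of n] p_nonneg[OF u] by linarith
  qed
  then obtain r a where r: "strict_mono r" and a: "norm a \<le> 2 * norm u + 2" and w: "wconv (\<lambda>n. b (r n)) a"
    by (rule weak_subsequence)
  have "M a \<le> 2 * (blinfun_apply a u - p u + 0)"
  proof (rule M_lsc[OF w])
    show "M (b (r n)) \<le> 2 * (blinfun_apply (b (r n)) u - p u + 1 / Suc (r n))" for n
      using b[of "r n"] by (simp add: Phi_def del: of_nat_Suc)
    have bu: "(\<lambda>n. blinfun_apply (b (r n)) u) \<longlonglongrightarrow> blinfun_apply a u" using w u by (simp add: wconv_def)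
    have "(\<lambda>n. 1 / real (Suc (r n))) \<longlonglongrightarrow> 0"
      using LIMSEQ_subseq_LIMSEQ[OF LIMSEQ_inverse_real_of_nat r] by (simp add: comp_def inverse_eq_divide)
    then show "(\<lambda>n. 2 * (blinfun_apply (b (r n)) u - p u + 1 / Suc (r n))) \<longlonglongrightarrow> 2 * (blinfun_apply a u - p u + 0)"
      by (intro tendsto_mult tendsto_add tendsto_diff tendsto_const bu)
  qed
  then have "p u \<le> Phi u a" by (simp add: Phi_def)
  then show ?thesis using that[OF a] p_upper[OF u, of a] by simp
qed

lemma Phi_gap:
  assumes u: "u \<in> Y" and a: "Phi u a = p u"
  shows "(1/2)^k * ((dK k a - dK k b)\<^sup>2 + (ev k a - ev k b)\<^sup>2) \<le> 4 * (p u - Phi u b)"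
proof -
  have "Phi u ((1/2) *\<^sub>R (a + b)) \<le> p u" by (rule p_upper[OF u])
  then have "(blinfun_apply a u + blinfun_apply b u) / 2 - M ((1/2) *\<^sub>R (a + b)) / 2 \<le> p u"
    by (simp add: Phi_def scaleR_blinfun.rep_eq plus_blinfun.rep_eq)
  then show ?thesis using M_mid[of a b k] a by (simp add: Phi_def) argo
qed

text \<open>
  Strong maximum at \<open>a\<close>: this is the Smulian criterion for Frechet differentiability of \<open>p\<close>. For a
  maximizing sequence \<open>b\<close>, the midpoint inequality forces \<open>ev k (b n)\<close> and \<open>dK k (b n)\<close> to converge to
  their values at \<open>a\<close>. The former give weak convergence to \<open>a\<close>. As \<open>dK k a\<close> is small for some \<open>k\<close>,
  the latter put \<open>b n\<close> close to a norm compact set, and weak convergence becomes norm convergence.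
\<close>

lemma maximizer_strong:
  assumes u: "u \<in> Y" and a: "Phi u a = p u" and e: "0 < e"
  shows "\<exists>h>0. \<forall>b. p u - h < Phi u b \<longrightarrow> nY (b - a) \<le> e"
proof (rule ccontr)
  assume "\<not> ?thesis"
  then have "\<exists>b. p u - h < Phi u b \<and> \<not> nY (b - a) \<le> e" if "0 < h" for h
    using that by blast
  then have "\<exists>b. p u - 1 / Suc n < Phi u b \<and> \<not> nY (b - a) \<le> e" for n by simp
  then obtain b where b: "\<And>n. p u - 1 / Suc n < Phi u (b n)" and far: "\<And>n. \<not> nY (b n - a) \<le> e" by metis
  have R: "nY (b n) \<le> 2 * norm u + 2" for n
  proof (rule Phi_bound[OF u])
    have "1 / real (Suc n) \<le> 1" by simp
    then show "-1 \<le> Phi u (b n)" using b[of n] p_nonneg[OF u] by linarith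
  qed
  have gap0: "(\<lambda>n. 4 * (1 / real (Suc n)) * 2^k) \<longlonglongrightarrow> 0" for k
    using tendsto_mult_left[OF tendsto_mult_right[OF LIMSEQ_inverse_real_of_nat, of 4], of "2^k"]
    by (simp add: inverse_eq_divide mult_ac)
  have gap: "(dK k a - dK k (b n))\<^sup>2 + (ev k a - ev k (b n))\<^sup>2 \<le> 4 * (1 / real (Suc n)) * 2^k" for k n
  proof -
    have "(1/2)^k * ((dK k a - dK k (b n))\<^sup>2 + (ev k a - ev k (b n))\<^sup>2) \<le> 4 * (1 / real (Suc n))"
    proof (rule order_trans[OF Phi_gap[OF u a]])
      have "p u - Phi u (b n) \<le> 1 / real (Suc n)" using b[of n] by linarith
      then show "4 * (p u - Phi u (b n)) \<le> 4 * (1 / real (Suc n))" by (rule mult_left_mono) simp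
    qed
    then show ?thesis by (simp add: power_divide field_simps del: of_nat_Suc)
  qed
  have sq0: "f \<longlonglongrightarrow> 0" if "\<And>n. (f n)\<^sup>2 \<le> 4 * (1 / real (Suc n)) * 2^k" for f k
  proof -
    have "(\<lambda>n. (f n)\<^sup>2) \<longlonglongrightarrow> 0"
      by (rule tendsto_sandwich[OF _ _ tendsto_const gap0[of k]]) (use that in auto)
    then have "(\<lambda>n. sqrt ((f n)\<^sup>2)) \<longlonglongrightarrow> sqrt 0" by (rule tendsto_real_sqrt)
    then show ?thesis by (simp add: tendsto_rabs_zero_iff)
  qed
  have dK0: "(\<lambda>n. dK k a - dK k (b n)) \<longlonglongrightarrow> 0" for k
    using gap[of k] by (intro sq0[of _ k]) (smt (verit) zero_le_power2)
  have ev0: "(\<lambda>n. ev k a - ev k (b n)) \<longlonglongrightarrow> 0" for k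
    using gap[of k] by (intro sq0[of _ k]) (smt (verit) zero_le_power2)
  have b_xs: "(\<lambda>n. blinfun_apply (b n) (xs k)) \<longlonglongrightarrow> blinfun_apply a (xs k)" for k
  proof -
    have n: "1 + norm (xs k) \<noteq> 0" using norm_ge_zero[of "xs k"] by linarith
    have "(\<lambda>n. blinfun_apply a (xs k) - (1 + norm (xs k)) * (ev k a - ev k (b n))) \<longlonglongrightarrow> blinfun_apply a (xs k) - (1 + norm (xs k)) * 0"
      by (intro tendsto_intros ev0)
    moreover have "(1 + norm (xs k)) * (ev k a - ev k (b n)) = blinfun_apply a (xs k) - blinfun_apply (b n) (xs k)" for n
      unfolding ev_def using n by (simp add: right_diff_distrib)
    ultimately show ?thesis by simp
  qed
  obtain r0 a' where r0: "strict_mono r0" and w0: "wconv (\<lambda>n. b (r0 n)) a'"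
    by (rule weak_subsequence[OF R])
  have a'_xs: "blinfun_apply a' (xs k) = blinfun_apply a (xs k)" for k
  proof (rule LIMSEQ_unique)
    show "(\<lambda>n. blinfun_apply (b (r0 n)) (xs k)) \<longlonglongrightarrow> blinfun_apply a' (xs k)"
      using w0 xsY by (simp add: wconv_def)
    show "(\<lambda>n. blinfun_apply (b (r0 n)) (xs k)) \<longlonglongrightarrow> blinfun_apply a (xs k)"
      using LIMSEQ_subseq_LIMSEQ[OF b_xs r0] by (simp add: comp_def)
  qed
  have "blinfun_apply a' y = blinfun_apply a y" if "y \<in> Y" for y
    by (rule dual_ball_eq_on_closure[where c="norm a + norm a'" and S="range xs"])
      (use a'_xs subsetD[OF xs_dense that] in \<open>auto intro: blinfun_mem_dual_ball\<close>)
  then have w: "wconv (\<lambda>n. b (r0 n)) a" using w0 by (simp add: wconv_def)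
  obtain k where k: "dK k a < e / 4" using dK_small[of "e / 4" a] e by auto
  have "(\<lambda>n. dK k (b n)) \<longlonglongrightarrow> dK k a"
    using tendsto_diff[OF tendsto_const[of "dK k a"] dK0[of k]] by simp
  from LIMSEQ_subseq_LIMSEQ[OF this r0] have "(\<lambda>n. dK k (b (r0 n))) \<longlonglongrightarrow> dK k a" by (simp add: comp_def)
  then have "eventually (\<lambda>n. dK k (b (r0 n)) < e / 4) sequentially" using k by (rule order_tendstoD)
  then obtain N where N: "\<And>n. N \<le> n \<Longrightarrow> dK k (b (r0 n)) < e / 4" unfolding eventually_sequentially by blast
  define b' where "b' n = b (r0 (n + N))" for n
  have w': "wconv b' a"
    unfolding b'_def by (rule wconv_subseq[OF w]) (simp add: strict_mono_def)
  have "\<exists>d. d \<in> Kh k \<and> nY (b' n - d) \<le> e / 4" for n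
    by (rule dK_lessE[OF N[of "n + N"]]) (auto simp: b'_def intro: less_imp_le)
  then obtain d where d: "\<And>n. d n \<in> Kh k" "\<And>n. nY (b' n - d n) \<le> e / 4" by metis
  obtain r d' where r: "strict_mono r" and d': "d' \<in> Kh k" "(\<lambda>n. d (r n)) \<longlonglongrightarrow> d'" "nY (a - d') \<le> e / 4"
    by (rule wconv_near_Kh[OF w' d])
  obtain n where n: "norm (d (r n) - d') < e / 4"
    using LIMSEQ_D[OF d'(2), of "e / 4"] e by auto
  have "b' (r n) - a = (b' (r n) - d (r n)) + ((d (r n) - d') + (d' - a))" by simp
  then have "nY (b' (r n) - a) \<le> nY (b' (r n) - d (r n)) + (nY (d (r n) - d') + nY (d' - a))"
    by (metis (no_types, lifting) nY_triangle add_left_mono order_trans)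
  also have "\<dots> \<le> e / 4 + (e / 4 + e / 4)"
    using d(2)[of "r n"] n nY_le_norm[of "d (r n) - d'"] d'(3) nY_minus[of d' a] by linarith
  also have "\<dots> \<le> e" using e by simp
  finally show False using far[of "r0 (r n + N)"] by (simp add: b'_def)
qed

text \<open>
  A functional that nearly attains \<open>p (u + h)\<close> nearly attains \<open>p u\<close> as well, hence it is close to the
  maximizer \<open>a\<close> at \<open>u\<close>.
\<close>

lemma p_superdiff:
  assumes u: "u \<in> Y"
  obtains a where "norm a \<le> 2 * norm u + 2"
    "\<And>e. 0 < e \<Longrightarrow> \<exists>d>0. \<forall>h\<in>Y. norm h < d \<longrightarrow> p (u + h) \<le> p u + blinfun_apply a h + e * norm h"
proof -
  obtain a where a: "norm a \<le> 2 * norm u + 2" "Phi u a = p u" using u by (rule maximizer)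
  have "\<exists>d>0. \<forall>h\<in>Y. norm h < d \<longrightarrow> p (u + h) \<le> p u + blinfun_apply a h + e * norm h" if e: "0 < e" for e
  proof -
    obtain t where t: "0 < t" and near: "\<And>b. p u - t < Phi u b \<Longrightarrow> nY (b - a) \<le> e / 2"
      using maximizer_strong[OF u a(2), of "e / 2"] e by auto
    define C where "C = 4 * norm u + 4 + e"
    have C: "0 < C" using e by (simp add: C_def add_nonneg_pos)
    define d where "d = min 1 (min (1 / e) (t / C))"
    have d: "0 < d" using e t C by (simp add: d_def)
    show ?thesis
    proof (intro exI[of _ d] conjI ballI impI d)
      fix h assume h: "h \<in> Y" and hd: "norm h < d"
      show "p (u + h) \<le> p u + blinfun_apply a h + e * norm h"
      proof (cases "h = 0")
        case True
        then show ?thesis by (simp add: blinfun.zero_right)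
      next
        case False
        have uh: "u + h \<in> Y" using Y u h by (rule subspace_add)
        have h1: "norm h < 1" "norm h < 1 / e" "norm h < t / C" using hd by (auto simp: d_def)
        define m where "m = e / 2 * norm h"
        have m: "0 < m" "m \<le> 1" using False e h1(2) by (auto simp: m_def field_simps)
        obtain b where b: "p (u + h) - m < Phi (u + h) b" using p_near[OF m(1)] by blast
        have split: "Phi (u + h) b = Phi u b + blinfun_apply b h" by (simp add: Phi_def blinfun.add_right)
        have "nY b \<le> 2 * norm (u + h) + 2"
          using b m(2) p_nonneg[OF uh] by (intro Phi_bound[OF uh]) simp
        also have "\<dots> \<le> 2 * norm u + 4" using norm_triangle_ineq[of u h] h1(1) by simp
        finally have "nY b * norm h \<le> (2 * norm u + 4) * norm h" by (intro mult_right_mono) auto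
        then have bh: "blinfun_apply b h \<le> (2 * norm u + 4) * norm h" using nY_upper[OF h, of b] by simp
        have "p u \<le> p (u + h) + 2 * norm u * norm h"
          using p_lipschitz[OF u uh] by simp
        then have "p u - (2 * norm u * norm h + m + (2 * norm u + 4) * norm h) < Phi u b"
          using b bh split by simp
        moreover have "2 * norm u * norm h + m + (2 * norm u + 4) * norm h \<le> C * norm h"
          using e by (simp add: C_def m_def algebra_simps)
        moreover have "C * norm h < t" using h1(3) C by (simp add: field_simps)
        ultimately have "nY (b - a) \<le> e / 2" by (intro near) simp
        then have "nY (b - a) * norm h \<le> e / 2 * norm h" by (intro mult_right_mono) auto
        then have "blinfun_apply b h - blinfun_apply a h \<le> e / 2 * norm h"
          using nY_upper[OF h, of "b - a"] by (simp add: minus_blinfun.rep_eq)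
        then show ?thesis using b split p_upper[OF u, of b] unfolding m_def by linarith
      qed
    qed
  qed
  then show ?thesis using that[OF a(1)] by blast
qed

end

section \<open>A smooth variational principle\<close>

text \<open>
  The Borwein-Preiss variational principle, for a gauge \<open>\<theta>\<close> in place of a power of the distance. The
  sequence \<open>w\<close> is built by adding the penalty \<open>c n * \<theta> u (w n)\<close> to the current function \<open>H n\<close> and
  choosing the next point as an almost minimizer of \<open>H (Suc n)\<close> over the set where this function does
  not exceed \<open>H n (w n)\<close>. These sublevel sets are nested and their diameters tend to \<open>0\<close>, so they
  shrink to one point \<open>z\<close>; every other point leaves them at some stage, and its total value then
  exceeds the one of \<open>z\<close>.
\<close>

lemma smooth_variational_principle:
  fixes F :: "'b::metric_space \<Rightarrow> real" and \<theta> :: "'b \<Rightarrow> 'b \<Rightarrow> real" and c :: "nat \<Rightarrow> real"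
  assumes complete: "\<And>s. (\<forall>n. s n \<in> S) \<Longrightarrow> Cauchy s \<Longrightarrow> \<exists>z. s \<longlonglongrightarrow> z"
    and lsc: "\<And>s z a. (\<forall>n. s n \<in> S) \<Longrightarrow> s \<longlonglongrightarrow> z \<Longrightarrow> (\<forall>n. F (s n) \<le> a) \<Longrightarrow> z \<in> S \<and> F z \<le> a"
    and below: "\<And>u. u \<in> S \<Longrightarrow> m \<le> F u"
    and \<theta>_nonneg: "\<And>u v. u \<in> S \<Longrightarrow> v \<in> S \<Longrightarrow> 0 \<le> \<theta> u v"
    and \<theta>_zero: "\<And>u. u \<in> S \<Longrightarrow> \<theta> u u = 0"
    and \<theta>_cont: "\<And>s z v. (\<forall>n. s n \<in> S) \<Longrightarrow> s \<longlonglongrightarrow> z \<Longrightarrow> z \<in> S \<Longrightarrow> v \<in> S \<Longrightarrow> (\<lambda>n. \<theta> (s n) v) \<longlonglongrightarrow> \<theta> z v"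
    and \<theta>_sep: "\<And>e. 0 < e \<Longrightarrow> \<exists>d>0. \<forall>u\<in>S. \<forall>v\<in>S. \<theta> u v < d \<longrightarrow> dist u v < e"
    and \<theta>_bound: "\<And>u v. u \<in> S \<Longrightarrow> v \<in> S \<Longrightarrow> \<theta> u v \<le> B"
    and c_pos: "\<And>k. 0 < c k" and c_sum: "summable c" and z0: "z0 \<in> S"
  obtains z w where "z \<in> S" "\<And>k. w k \<in> S" "w 0 = z0"
    "F z + (\<Sum>k. c k * \<theta> z (w k)) \<le> F z0"
    "\<And>u. u \<in> S \<Longrightarrow> F z + (\<Sum>k. c k * \<theta> z (w k)) \<le> F u + (\<Sum>k. c k * \<theta> u (w k))"
proof -
  have "\<exists>d>0. \<forall>u\<in>S. \<forall>v\<in>S. \<theta> u v < d \<longrightarrow> dist u v < (1/2)^n" for n :: nat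
    by (rule \<theta>_sep) simp
  then obtain d where d_pos: "\<And>n::nat. 0 < d n"
    and d: "\<And>n. \<forall>u\<in>S. \<forall>v\<in>S. \<theta> u v < d n \<longrightarrow> dist u v < (1/2)^n" by metis
  (* With this tolerance, points of the n-th sublevel set have gauge less than d n from w n. *)
  define e where "e n = c n * d n / 2" for n
  have e_pos: "0 < e n" for n using c_pos d_pos by (simp add: e_def)
  define P where "P = (\<lambda>(n::nat) (zH :: 'b \<times> ('b \<Rightarrow> real)). fst zH \<in> S \<and> (\<forall>u\<in>S. m \<le> snd zH u) \<and> (n = 0 \<longrightarrow> zH = (z0, F)))"
  define Q where "Q = (\<lambda>(n::nat) (zH :: 'b \<times> ('b \<Rightarrow> real)) (zH' :: 'b \<times> ('b \<Rightarrow> real)).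
      snd zH' = (\<lambda>u. snd zH u + c n * \<theta> u (fst zH)) \<and> snd zH' (fst zH') \<le> snd zH (fst zH) \<and>
      (\<forall>u\<in>S. snd zH' u \<le> snd zH (fst zH) \<longrightarrow> snd zH' (fst zH') \<le> snd zH' u + e (Suc n)))"
  have "\<exists>f. \<forall>n. P n (f n) \<and> Q n (f n) (f (Suc n))"
  proof (rule dependent_nat_choice)
    show "\<exists>x. P 0 x" using z0 below by (intro exI[of _ "(z0, F)"]) (simp add: P_def)
    fix x n assume Px: "P n x"
    define H where "H = snd x"
    define z where "z = fst x"
    have z: "z \<in> S" and Hm: "\<And>u. u \<in> S \<Longrightarrow> m \<le> H u" using Px by (auto simp: P_def H_def z_def)
    define H' where "H' u = H u + c n * \<theta> u z" for u
    have H'm: "m \<le> H' u" if "u \<in> S" for u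
      using Hm[OF that] \<theta>_nonneg[OF that z] c_pos[of n] by (simp add: H'_def add_increasing2)
    (* The sublevel set contains z, because the new penalty vanishes there. *)
    define T where "T = {u\<in>S. H' u \<le> H z}"
    have zT: "z \<in> T" using z \<theta>_zero by (simp add: T_def H'_def)
    have bdd: "bdd_below (H' ` T)" using H'm by (intro bdd_belowI2[of _ m]) (auto simp: T_def)
    have "(INF u\<in>T. H' u) < (INF u\<in>T. H' u) + e (Suc n)" using e_pos by simp
    then obtain z' where z': "z' \<in> T" "H' z' < (INF u\<in>T. H' u) + e (Suc n)"
      using cINF_less_iff[OF _ bdd] zT by blast
    have "H' z' \<le> H' u + e (Suc n)" if "u \<in> T" for u
      using cINF_lower[OF bdd that] z'(2) by simp
    then have "P (Suc n) (z', H') \<and> Q n x (z', H')"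
      using z' H'm unfolding P_def Q_def by (auto simp: T_def H'_def[abs_def] H_def z_def)
    then show "\<exists>y. P (Suc n) y \<and> Q n x y" ..
  qed
  then obtain f where f: "\<And>n. P n (f n)" "\<And>n. Q n (f n) (f (Suc n))" by blast
  define w where "w n = fst (f n)" for n
  define H where "H n = snd (f n)" for n
  define a where "a n = H n (w n)" for n
  have wS: "w n \<in> S" for n using f(1)[of n] by (simp add: P_def w_def)
  have w0: "w 0 = z0" and H0: "H 0 = F" using f(1)[of 0] by (auto simp: P_def w_def H_def)
  have HS: "H (Suc n) u = H n u + c n * \<theta> u (w n)" for n u
    using f(2)[of n] by (simp add: Q_def H_def w_def)
  have aS: "a (Suc n) \<le> a n" for n
    using f(2)[of n] unfolding Q_def H_def w_def a_def by blast
  have near: "a (Suc n) \<le> H (Suc n) u + e (Suc n)" if "u \<in> S" "H (Suc n) u \<le> a n" for n u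
    using f(2)[of n] that unfolding Q_def H_def w_def a_def by blast
  have Hmono: "H n u \<le> H (Suc n) u" if "u \<in> S" for n u
    using \<theta>_nonneg[OF that wS] c_pos[of n] by (simp add: HS)
  define L where "L n = {u\<in>S. H (Suc n) u \<le> a n}" for n
  have LS: "L (Suc n) \<subseteq> L n" for n
  proof
    fix u assume u: "u \<in> L (Suc n)"
    then have "H (Suc n) u \<le> a (Suc n)" using Hmono[of u "Suc n"] by (simp add: L_def)
    then show "u \<in> L n" using u aS[of n] by (simp add: L_def)
  qed
  have Lanti: "L j \<subseteq> L n" if "n \<le> j" for j n
    using that LS by (rule lift_Suc_antimono_le[rotated])
  have aanti: "a j \<le> a n" if "n \<le> j" for j n
    using that aS by (rule lift_Suc_antimono_le[rotated])
  have wL: "w (Suc n) \<in> L n" for n using wS aS[of n] by (simp add: L_def a_def)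
  have close: "dist u (w (Suc n)) < (1/2)^(Suc n)" if u: "u \<in> L (Suc n)" for u n
  proof -
    have uS: "u \<in> S" and "H (Suc n) u \<le> a n" using u LS[of n] by (auto simp: L_def)
    then have "a (Suc n) \<le> H (Suc n) u + e (Suc n)" by (rule near)
    moreover have "H (Suc n) u + c (Suc n) * \<theta> u (w (Suc n)) \<le> a (Suc n)" using u HS[of "Suc n" u] by (simp add: L_def)
    ultimately have "c (Suc n) * \<theta> u (w (Suc n)) \<le> e (Suc n)" by simp
    also have "\<dots> < c (Suc n) * d (Suc n)" using mult_pos_pos[OF c_pos d_pos, of "Suc n" "Suc n"] by (simp add: e_def)
    finally have "\<theta> u (w (Suc n)) < d (Suc n)" using c_pos by (simp add: mult_less_cancel_left_pos)
    then show ?thesis using d uS wS by blast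
  qed
  have wL': "w (Suc j) \<in> L n" if "n \<le> j" for j n using wL[of j] Lanti[OF that] by blast
  have "Cauchy w"
  proof (rule metric_CauchyI)
    fix r :: real assume r: "0 < r"
    obtain n where n: "(1/2)^n < r / 2" using real_arch_pow_inv[of "r / 2" "1/2"] r by auto
    have dn: "dist (w j) (w (Suc n)) < r / 2" if "Suc (Suc n) \<le> j" for j
    proof -
      obtain i where i: "j = Suc i" "Suc n \<le> i" using \<open>Suc (Suc n) \<le> j\<close> by (cases j) auto
      have "dist (w j) (w (Suc n)) < (1/2)^(Suc n)" unfolding i(1) by (rule close[OF wL'[OF i(2)]])
      also have "\<dots> \<le> (1/2)^n" by simp
      finally show ?thesis using n by simp
    qed
    show "\<exists>N. \<forall>i\<ge>N. \<forall>j\<ge>N. dist (w i) (w j) < r"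
    proof (intro exI[of _ "Suc (Suc n)"] allI impI)
      fix i j assume "Suc (Suc n) \<le> i" "Suc (Suc n) \<le> j"
      then show "dist (w i) (w j) < r" using dn[of i] dn[of j] dist_triangle2[of "w i" "w j" "w (Suc n)"] by linarith
    qed
  qed
  then obtain z where z: "w \<longlonglongrightarrow> z" using complete[of w] wS by blast
  have Hlsc: "z \<in> S \<and> H k z \<le> b" if s: "\<forall>n. s n \<in> S" "s \<longlonglongrightarrow> z" "\<forall>n. H k (s n) \<le> b" for k s z b
    using s
  proof (induction k arbitrary: s b)
    case 0
    then show ?case using lsc[of s z b] by (simp add: H0)
  next
    case (Suc k)
    have "H k (s n) \<le> b" for n using Hmono[of "s n" k] Suc.prems(1,3) order_trans by blast
    then have zS: "z \<in> S" using Suc.IH[OF Suc.prems(1,2)] by blast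
    have "H k z \<le> (b - c k * \<theta> z (w k)) + r" if r: "0 < r" for r
    proof -
      have "(\<lambda>n. c k * \<theta> (s n) (w k)) \<longlonglongrightarrow> c k * \<theta> z (w k)"
        by (intro tendsto_mult_left \<theta>_cont Suc.prems zS wS)
      then have "eventually (\<lambda>n. c k * \<theta> z (w k) - r < c k * \<theta> (s n) (w k)) sequentially"
        using r by (intro order_tendstoD) auto
      then obtain N where N: "\<And>n. N \<le> n \<Longrightarrow> c k * \<theta> z (w k) - r < c k * \<theta> (s n) (w k)"
        unfolding eventually_sequentially by blast
      have "z \<in> S \<and> H k z \<le> (b - c k * \<theta> z (w k)) + r"
      proof (rule Suc.IH[of "\<lambda>n. s (n + N)"])
        show "\<forall>n. s (n + N) \<in> S" using Suc.prems(1) by simp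
        show "(\<lambda>n. s (n + N)) \<longlonglongrightarrow> z" using Suc.prems(2) by (rule LIMSEQ_ignore_initial_segment)
        show "\<forall>n. H k (s (n + N)) \<le> (b - c k * \<theta> z (w k)) + r"
        proof
          fix n
          have "H k (s (n + N)) + c k * \<theta> (s (n + N)) (w k) \<le> b" using spec[OF Suc.prems(3), of "n + N"] by (simp only: HS)
          then show "H k (s (n + N)) \<le> (b - c k * \<theta> z (w k)) + r" using N[of "n + N"] by simp
        qed
      qed
      then show ?thesis by simp
    qed
    then have "H k z \<le> b - c k * \<theta> z (w k)" by (rule field_le_epsilon)
    then show ?case using zS by (simp add: HS)
  qed
  have zL: "z \<in> L n" for n
  proof -
    have "z \<in> S \<and> H (Suc n) z \<le> a n"
    proof (rule Hlsc[of "\<lambda>j. w (j + Suc n)"])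
      show "(\<lambda>j. w (j + Suc n)) \<longlonglongrightarrow> z" using z by (rule LIMSEQ_ignore_initial_segment)
      show "\<forall>j. w (j + Suc n) \<in> S" using wS by simp
      show "\<forall>j. H (Suc n) (w (j + Suc n)) \<le> a n" using wL'[of n] by (auto simp: L_def)
    qed
    then show ?thesis by (simp add: L_def)
  qed
  have zS: "z \<in> S" using zL[of 0] by (simp add: L_def)
  have Hsum: "H n u = F u + (\<Sum>k<n. c k * \<theta> u (w k))" for n u
    by (induction n) (auto simp: H0 HS)
  have sm: "summable (\<lambda>k. c k * \<theta> u (w k))" if u: "u \<in> S" for u
  proof (rule summable_comparison_test)
    show "summable (\<lambda>k. c k * B)" using c_sum by (rule summable_mult2)
    show "\<exists>N. \<forall>n\<ge>N. norm (c n * \<theta> u (w n)) \<le> c n * B"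
      using \<theta>_bound[OF u wS] \<theta>_nonneg[OF u wS] c_pos by (intro exI[of _ 0] allI impI) (simp add: abs_mult less_imp_le)
  qed
  define T where "T u = F u + (\<Sum>k. c k * \<theta> u (w k))" for u
  have Hlim: "(\<lambda>n. H n u) \<longlonglongrightarrow> T u" if "u \<in> S" for u
    unfolding Hsum T_def by (intro tendsto_add tendsto_const summable_LIMSEQ sm that)
  have HT: "H n u \<le> T u" if "u \<in> S" for n u
    unfolding Hsum T_def using sum_le_suminf[OF sm[OF that], of "{..<n}"] \<theta>_nonneg[OF that wS] c_pos
    by (simp add: less_imp_le)
  have Tz: "T z \<le> a n" for n
  proof (rule LIMSEQ_le_const2[OF Hlim[OF zS]])
    show "\<exists>N. \<forall>j\<ge>N. H j z \<le> a n"
    proof (intro exI[of _ "Suc n"] allI impI)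
      fix j assume "Suc n \<le> j"
      then obtain i where i: "j = Suc i" "n \<le> i" by (cases j) auto
      have "H (Suc i) z \<le> a i" using zL[of i] by (simp add: L_def)
      then show "H j z \<le> a n" using aanti[OF i(2)] i(1) by simp
    qed
  qed
  show ?thesis
  proof (rule that[of z w])
    show "F z + (\<Sum>k. c k * \<theta> z (w k)) \<le> F z0" using Tz[of 0] by (simp add: T_def a_def H0 w0)
    fix u assume u: "u \<in> S"
    have "T z \<le> T u"
    proof (cases "\<forall>n. u \<in> L n")
      case True
      have "w \<longlonglongrightarrow> u"
      proof (rule metric_LIMSEQ_I)
        fix r :: real assume r: "0 < r"
        obtain n where n: "(1/2)^n < r" using real_arch_pow_inv[of r "1/2"] r by auto
        show "\<exists>N. \<forall>j\<ge>N. dist (w j) u < r"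
        proof (intro exI[of _ "Suc n"] allI impI)
          fix j assume "Suc n \<le> j"
          then obtain i where i: "j = Suc i" "n \<le> i" by (cases j) auto
          have "dist u (w j) < (1/2)^(Suc i)" unfolding i(1) using True by (intro close) auto
          also have "(1/2)^(Suc i) \<le> ((1/2)^n :: real)" using i(2) by (intro power_decreasing) auto
          finally show "dist (w j) u < r" using n by (simp add: dist_commute)
        qed
      qed
      then show ?thesis using LIMSEQ_unique[OF z] by simp
    next
      case False
      then obtain n where "a n < H (Suc n) u" using u by (auto simp: L_def not_le)
      then show ?thesis using Tz[of n] HT[OF u, of "Suc n"] by simp
    qed
    then show "F z + (\<Sum>k. c k * \<theta> z (w k)) \<le> F u + (\<Sum>k. c k * \<theta> u (w k))" by (simp add: T_def)
  qed (use zS wS w0 in auto)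
qed

section \<open>Supergradients along a subspace\<close>

text \<open>
  Only the upper half of differentiability is recorded: at a minimum of \<open>F + q\<close>, a supergradient of
  \<open>q\<close> is the negative of a subgradient of \<open>F\<close>.
\<close>

definition supergradient_on :: "'a::real_normed_vector set \<Rightarrow> ('a \<Rightarrow> real) \<Rightarrow> 'a \<Rightarrow> ('a \<Rightarrow>\<^sub>L real) \<Rightarrow> bool" where
  "supergradient_on Y q v a \<longleftrightarrow>
    (\<forall>e>0. \<exists>d>0. \<forall>h\<in>Y. norm h < d \<longrightarrow> q (v + h) \<le> q v + blinfun_apply a h + e * norm h)"

lemma supergradient_on_add:
  assumes "supergradient_on Y q v a" "supergradient_on Y q' v a'"
  shows "supergradient_on Y (\<lambda>u. q u + q' u) v (a + a')"
  unfolding supergradient_on_def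
proof (intro allI impI)
  fix e :: real assume e: "0 < e"
  obtain d where d: "0 < d" "\<forall>h\<in>Y. norm h < d \<longrightarrow> q (v + h) \<le> q v + blinfun_apply a h + e / 2 * norm h"
    using assms(1) e unfolding supergradient_on_def by (metis half_gt_zero)
  obtain d' where d': "0 < d'" "\<forall>h\<in>Y. norm h < d' \<longrightarrow> q' (v + h) \<le> q' v + blinfun_apply a' h + e / 2 * norm h"
    using assms(2) e unfolding supergradient_on_def by (metis half_gt_zero)
  show "\<exists>d>0. \<forall>h\<in>Y. norm h < d \<longrightarrow> q (v + h) + q' (v + h) \<le> q v + q' v + blinfun_apply (a + a') h + e * norm h"
  proof (intro exI[of _ "min d d'"] conjI ballI impI)
    fix h assume h: "h \<in> Y" "norm h < min d d'"
    then have "q (v + h) \<le> q v + blinfun_apply a h + e / 2 * norm h"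
      "q' (v + h) \<le> q' v + blinfun_apply a' h + e / 2 * norm h" using d d' by auto
    then show "q (v + h) + q' (v + h) \<le> q v + q' v + blinfun_apply (a + a') h + e * norm h"
      by (simp add: plus_blinfun.rep_eq)
  qed (use d d' in auto)
qed

lemma supergradient_on_scale:
  assumes "supergradient_on Y q v a" "0 < t"
  shows "supergradient_on Y (\<lambda>u. t * q u) v (t *\<^sub>R a)"
  unfolding supergradient_on_def
proof (intro allI impI)
  fix e :: real assume e: "0 < e"
  then have "0 < e / t" using assms(2) by simp
  then obtain d where d: "0 < d" "\<forall>h\<in>Y. norm h < d \<longrightarrow> q (v + h) \<le> q v + blinfun_apply a h + e / t * norm h"
    using assms(1) unfolding supergradient_on_def by blast
  show "\<exists>d>0. \<forall>h\<in>Y. norm h < d \<longrightarrow> t * q (v + h) \<le> t * q v + blinfun_apply (t *\<^sub>R a) h + e * norm h"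
  proof (intro exI[of _ d] conjI ballI impI d(1))
    fix h assume h: "h \<in> Y" "norm h < d"
    then have "t * q (v + h) \<le> t * (q v + blinfun_apply a h + e / t * norm h)"
      using d assms(2) by (intro mult_left_mono) auto
    then show "t * q (v + h) \<le> t * q v + blinfun_apply (t *\<^sub>R a) h + e * norm h"
      using assms(2) by (simp add: scaleR_blinfun.rep_eq distrib_left)
  qed
qed

text \<open>
  Finitely many terms are treated by their own supergradients, and the common Lipschitz bound makes
  the rest of the series smaller than any prescribed multiple of \<open>norm h\<close>.
\<close>

lemma supergradient_on_suminf:
  fixes a :: "nat \<Rightarrow> 'a::real_normed_vector \<Rightarrow>\<^sub>L real"
  assumes sup: "\<And>k. supergradient_on Y (q k) v (a k)" and A: "\<And>k. norm (a k) \<le> A"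
    and lip: "\<And>k h. h \<in> Y \<Longrightarrow> norm h \<le> 1 \<Longrightarrow> q k (v + h) \<le> q k v + A * norm h"
    and c: "\<And>k. 0 \<le> c k" "summable c" and Y: "0 \<in> Y"
    and sm: "\<And>h. h \<in> Y \<Longrightarrow> norm h \<le> 1 \<Longrightarrow> summable (\<lambda>k. c k * q k (v + h))"
  shows "supergradient_on Y (\<lambda>u. \<Sum>k. c k * q k u) v (\<Sum>k. c k *\<^sub>R a k)"
  unfolding supergradient_on_def
proof (intro allI impI)
  fix e :: real assume e: "0 < e"
  have A0: "0 \<le> A" using A[of 0] norm_ge_zero[of "a 0"] by linarith
  have sma: "summable (\<lambda>k. c k *\<^sub>R a k)"
  proof (rule summable_comparison_test)
    show "summable (\<lambda>k. c k * A)" using c(2) by (rule summable_mult2)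
    show "\<exists>N. \<forall>n\<ge>N. norm (c n *\<^sub>R a n) \<le> c n * A"
      using A c(1) by (intro exI[of _ 0] allI impI) (simp add: mult_left_mono)
  qed
  have apply_sum: "blinfun_apply (\<Sum>k. c k *\<^sub>R a k) h = (\<Sum>k. c k * blinfun_apply (a k) h)"
    and apply_summable: "summable (\<lambda>k. c k * blinfun_apply (a k) h)" for h
    using bounded_linear.suminf[OF blinfun.bounded_linear_left sma, of h]
      bounded_linear.summable[OF blinfun.bounded_linear_left sma, of h] by (simp_all add: scaleR_blinfun.rep_eq)
  define C where "C = suminf c"
  have C0: "0 \<le> C" unfolding C_def by (rule suminf_nonneg[OF c(2) c(1)])
  define e1 where "e1 = e / 2 / (C + 1)"
  have e1: "0 < e1" using e C0 by (simp add: e1_def)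
  have "C * e1 \<le> (C + 1) * e1" using e1 by (intro mult_right_mono) auto
  also have "\<dots> = e / 2" unfolding e1_def using C0 by (intro mult_divide_cancel) linarith
  finally have Ce1: "C * e1 \<le> e / 2" .
  define e2 where "e2 = e / 2 / (2 * A + 1)"
  have e2: "0 < e2" using e A0 by (simp add: e2_def)
  have "e2 * (2 * A) \<le> (2 * A + 1) * e2" using e2 by (simp add: algebra_simps)
  also have "\<dots> = e / 2" unfolding e2_def using A0 by (intro mult_divide_cancel) linarith
  finally have e2A: "e2 * (2 * A) \<le> e / 2" .
  obtain N where "\<forall>n\<ge>N. norm (\<Sum>i. c (i + n)) < e2" using suminf_exist_split[OF e2 c(2)] by blast
  then have N: "\<bar>\<Sum>i. c (i + N)\<bar> < e2" by auto
  (* The tail of the series, where only the Lipschitz bound is used. *)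
  define t where "t k = (if k < N then 0 else c k)" for k
  have t0: "0 \<le> t k" for k using c(1) by (simp add: t_def)
  have smt: "summable t"
    by (rule summable_comparison_test[OF _ c(2)]) (use c(1) in \<open>auto simp: t_def\<close>)
  have "suminf t = (\<Sum>k. t (k + N)) + sum t {..<N}" by (rule suminf_split_initial_segment[OF smt])
  then have "suminf t = (\<Sum>i. c (i + N))" by (simp add: t_def)
  then have tl: "suminf t \<le> e2" using N by linarith
  have "\<exists>d>0. \<forall>h\<in>Y. norm h < d \<longrightarrow> q k (v + h) \<le> q k v + blinfun_apply (a k) h + e1 * norm h" for k
    using sup[of k] e1 unfolding supergradient_on_def by blast
  then obtain d where d: "\<And>k. 0 < d k"
    "\<And>k. \<forall>h\<in>Y. norm h < d k \<longrightarrow> q k (v + h) \<le> q k v + blinfun_apply (a k) h + e1 * norm h" by metis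
  define D where "D = Min (insert 1 (d ` {..<N}))"
  have D: "0 < D" "D \<le> 1" "\<And>k. k < N \<Longrightarrow> D \<le> d k" using d(1) by (auto simp: D_def)
  show "\<exists>d>0. \<forall>h\<in>Y. norm h < d \<longrightarrow> (\<Sum>k. c k * q k (v + h))
      \<le> (\<Sum>k. c k * q k v) + blinfun_apply (\<Sum>k. c k *\<^sub>R a k) h + e * norm h"
  proof (intro exI[of _ D] conjI ballI impI D(1))
    fix h assume h: "h \<in> Y" "norm h < D"
    have h1: "norm h \<le> 1" using h D(2) by simp
    have termwise: "c k * q k (v + h) \<le> c k * q k v + c k * blinfun_apply (a k) h + (c k * (e1 * norm h) + t k * (2 * A * norm h))" for k
    proof -
      have "q k (v + h) \<le> q k v + blinfun_apply (a k) h + (e1 * norm h + (if k < N then 0 else 2 * A * norm h))"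
      proof (cases "k < N")
        case True
        then show ?thesis using d(2)[of k] h D(3)[OF True] by auto
      next
        case False
        have "norm (a k) * norm h \<le> A * norm h" using A[of k] by (intro mult_right_mono) auto
        then have "- blinfun_apply (a k) h \<le> A * norm h" using norm_blinfun[of "a k" h] by (simp add: abs_le_iff)
        moreover have "0 \<le> e1 * norm h" using e1 by simp
        ultimately show ?thesis using lip[OF h(1) h1, of k] False by simp
      qed
      then have "c k * q k (v + h) \<le> c k * (q k v + blinfun_apply (a k) h + (e1 * norm h + (if k < N then 0 else 2 * A * norm h)))"
        by (rule mult_left_mono[OF _ c(1)])
      then show ?thesis by (cases "k < N") (simp_all add: t_def distrib_left)
    qed
    have sv: "summable (\<lambda>k. c k * q k v)" using sm[OF Y] by simp
    have "(\<lambda>k. c k * q k v + c k * blinfun_apply (a k) h + (c k * (e1 * norm h) + t k * (2 * A * norm h)))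
      sums ((\<Sum>k. c k * q k v) + (\<Sum>k. c k * blinfun_apply (a k) h) + (C * (e1 * norm h) + suminf t * (2 * A * norm h)))"
      unfolding C_def by (intro sums_add sums_mult2 summable_sums sv apply_summable smt c(2))
    then have "(\<Sum>k. c k * q k (v + h)) \<le> (\<Sum>k. c k * q k v) + (\<Sum>k. c k * blinfun_apply (a k) h) + (C * (e1 * norm h) + suminf t * (2 * A * norm h))"
      by (rule sums_le[OF termwise summable_sums[OF sm[OF h(1) h1]]])
    moreover have "C * (e1 * norm h) \<le> e / 2 * norm h"
      using mult_right_mono[OF Ce1, of "norm h"] by (simp add: mult.assoc)
    moreover have "suminf t * (2 * A * norm h) \<le> e / 2 * norm h"
    proof -
      have "suminf t * (2 * A) \<le> e2 * (2 * A)" using tl A0 by (intro mult_right_mono) auto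
      then have "suminf t * (2 * A) \<le> e / 2" using e2A by simp
      from mult_right_mono[OF this, of "norm h"] show ?thesis by (simp add: mult.assoc)
    qed
    ultimately show "(\<Sum>k. c k * q k (v + h)) \<le> (\<Sum>k. c k * q k v) + blinfun_apply (\<Sum>k. c k *\<^sub>R a k) h + e * norm h"
      unfolding apply_sum by simp
  qed
qed

section \<open>The fuzzy sum rule along a subspace\<close>

text \<open>
  A Frechet subgradient at \<open>v\<close> for increments in \<open>Y\<close>, of the function that is \<open>F\<close> on \<open>S0\<close> and
  \<open>\<infinity>\<close> elsewhere.
\<close>

definition subgradient_on :: "('a::real_normed_vector \<Rightarrow> real) \<Rightarrow> 'a set \<Rightarrow> 'a set \<Rightarrow> 'a \<Rightarrow> ('a \<Rightarrow>\<^sub>L real) \<Rightarrow> bool" where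
  "subgradient_on F S0 Y v a \<longleftrightarrow>
    (\<forall>e>0. \<exists>d>0. \<forall>h\<in>Y. norm h < d \<longrightarrow> v + h \<in> S0 \<longrightarrow> F v + blinfun_apply a h - e * norm h \<le> F (v + h))"

lemma subgradient_on_of_min:
  assumes sup: "supergradient_on Y q v a" and r: "0 < r"
    and min: "\<And>h. h \<in> Y \<Longrightarrow> norm h < r \<Longrightarrow> v + h \<in> S0 \<Longrightarrow> F v + q v \<le> F (v + h) + q (v + h)"
  shows "subgradient_on F S0 Y v (- a)"
  unfolding subgradient_on_def
proof (intro allI impI)
  fix e :: real assume "0 < e"
  then obtain d where d: "0 < d" "\<forall>h\<in>Y. norm h < d \<longrightarrow> q (v + h) \<le> q v + blinfun_apply a h + e * norm h"
    using sup unfolding supergradient_on_def by blast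
  show "\<exists>d>0. \<forall>h\<in>Y. norm h < d \<longrightarrow> v + h \<in> S0 \<longrightarrow> F v + blinfun_apply (- a) h - e * norm h \<le> F (v + h)"
  proof (intro exI[of _ "min d r"] conjI ballI impI)
    fix h assume h: "h \<in> Y" "norm h < min d r" "v + h \<in> S0"
    then show "F v + blinfun_apply (- a) h - e * norm h \<le> F (v + h)"
      using d(2) min[of h] by (simp add: uminus_blinfun.rep_eq) (smt (verit))
  qed (use d r in auto)
qed

lemma supergradient_on_reflect:
  assumes "supergradient_on Y q (c - v) a" "subspace Y"
  shows "supergradient_on Y (\<lambda>w. q (c - w)) v (- a)"
  unfolding supergradient_on_def
proof (intro allI impI)
  fix e :: real assume "0 < e"
  then obtain d where d: "0 < d" "\<And>h. h \<in> Y \<Longrightarrow> norm h < d \<Longrightarrow> q (c - v + h) \<le> q (c - v) + blinfun_apply a h + e * norm h"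
    using assms(1) unfolding supergradient_on_def by blast
  show "\<exists>d>0. \<forall>h\<in>Y. norm h < d \<longrightarrow> q (c - (v + h)) \<le> q (c - v) + blinfun_apply (- a) h + e * norm h"
  proof (intro exI[of _ d] conjI ballI impI d(1))
    fix h assume "h \<in> Y" "norm h < d"
    then show "q (c - (v + h)) \<le> q (c - v) + blinfun_apply (- a) h + e * norm h"
      using d(2)[of "- h"] assms(2) by (simp add: subspace_neg uminus_blinfun.rep_eq blinfun.minus_right algebra_simps)
  qed
qed

lemma supergradient_on_shift:
  assumes "supergradient_on Y q (v - c) a"
  shows "supergradient_on Y (\<lambda>w. q (w - c)) v a"
  using assms unfolding supergradient_on_def by (simp add: algebra_simps)

context separable_dual_subspace
begin

lemma p_supergradient:
  assumes "u \<in> Y"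
  obtains a where "norm a \<le> 2 * norm u + 2" "supergradient_on Y p u a"
  by (rule p_superdiff[OF assms]) (auto simp: supergradient_on_def intro: that)

lemma p_tendsto:
  assumes s: "s \<longlonglongrightarrow> z" and sY: "\<And>n. s n \<in> Y" "z \<in> Y"
  shows "(\<lambda>n. p (s n)) \<longlonglongrightarrow> p z"
proof -
  have d0: "(\<lambda>n. norm (s n - z)) \<longlonglongrightarrow> 0"
    using s by (simp add: LIM_zero tendsto_norm_zero)
  have b: "\<bar>p (s n) - p z\<bar> \<le> 2 * (norm z + norm (s n - z)) * norm (s n - z)" for n
  proof -
    have ns: "norm (s n) \<le> norm z + norm (s n - z)" by (metis norm_triangle_sub)
    have "p (s n) \<le> p z + 2 * norm (s n) * norm (s n - z)" by (rule p_lipschitz[OF sY])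
    moreover have "p z \<le> p (s n) + 2 * norm z * norm (s n - z)"
      using p_lipschitz[OF sY(2,1), of n] by (simp add: norm_minus_commute)
    moreover have "2 * norm (s n) * norm (s n - z) \<le> 2 * (norm z + norm (s n - z)) * norm (s n - z)"
      using ns by (intro mult_right_mono) auto
    moreover have "2 * norm z * norm (s n - z) \<le> 2 * (norm z + norm (s n - z)) * norm (s n - z)"
      by (intro mult_right_mono) auto
    ultimately show ?thesis unfolding abs_le_iff by linarith
  qed
  have "(\<lambda>n. 2 * (norm z + norm (s n - z)) * norm (s n - z)) \<longlonglongrightarrow> 2 * (norm z + 0) * 0"
    by (intro tendsto_intros d0)
  then have "(\<lambda>n. p (s n) - p z) \<longlonglongrightarrow> 0"
    by (intro Lim_null_comparison[of "\<lambda>n. p (s n) - p z" "\<lambda>n. 2 * (norm z + norm (s n - z)) * norm (s n - z)"])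
      (use b in auto)
  then show ?thesis by (rule LIM_zero_cancel)
qed

text \<open>
  The bound on the supergradient depends on the weight \<open>t\<close> alone and not on the points \<open>w k\<close>, over
  which the variational principle gives no control.
\<close>

lemma perturbation_supergradient:
  assumes w: "\<And>k. w k \<in> Y" "\<And>k. norm (w k - x) \<le> 1" and v: "v \<in> Y" "norm (v - x) \<le> 1" and t: "0 < t"
  obtains a where "norm a \<le> 16 * t" "supergradient_on Y (\<lambda>u. \<Sum>k. t * (1/2)^k * p (u - w k)) v a"
proof -
  have vw: "v - w k \<in> Y" for k using Y v(1) w(1) by (rule subspace_diff)
  have nvw: "norm (v - w k) \<le> 2" for k
    using norm_triangle_ineq4[of "v - x" "w k - x"] v(2) w(2)[of k] by simp
  have "\<exists>a. norm a \<le> 8 \<and> supergradient_on Y p (v - w k) a" for k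
  proof -
    obtain a where "norm a \<le> 2 * norm (v - w k) + 2" "supergradient_on Y p (v - w k) a"
      using vw by (rule p_supergradient)
    then show ?thesis using nvw[of k] by (intro exI[of _ a]) auto
  qed
  then obtain a where a: "\<And>k. norm (a k) \<le> 8" "\<And>k. supergradient_on Y p (v - w k) (a k)" by metis
  define c where "c k = t * (1/2)^k" for k :: nat
  have c0: "0 \<le> c k" for k using t by (simp add: c_def)
  have cs: "c sums (2 * t)"
    unfolding c_def using sums_mult[OF geometric_sums[of "1/2::real"], of t] by (simp add: mult.commute[of 2 t])
  have smc: "summable c" using cs by (rule sums_summable)
  have p2: "p z \<le> 5" "0 \<le> p z" if "z \<in> Y" "norm z \<le> 3" for z
  proof -
    have "(norm z)\<^sup>2 \<le> 3\<^sup>2" using that by (intro power_mono) auto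
    then show "p z \<le> 5" using p_le[OF that(1)] by simp
    show "0 \<le> p z" by (rule p_nonneg[OF that(1)])
  qed
  have hn: "norm (v - w k + h) \<le> 3" if "norm h \<le> 1" for h k
    using norm_triangle_ineq[of "v - w k" h] nvw[of k] that by simp
  have "supergradient_on Y (\<lambda>u. \<Sum>k. c k * p (u - w k)) v (\<Sum>k. c k *\<^sub>R a k)"
  proof (rule supergradient_on_suminf[OF _ a(1) _ c0 smc zero_Y])
    show "supergradient_on Y (\<lambda>u. p (u - w k)) v (a k)" for k
      by (rule supergradient_on_shift[OF a(2)])
    fix h assume h: "h \<in> Y" "norm h \<le> 1"
    have eq: "v + h - w k = v - w k + h" for k by simp
    have vh: "v - w k + h \<in> Y" for k using Y vw h(1) by (rule subspace_add)
    show "p (v + h - w k) \<le> p (v - w k) + 8 * norm h" for k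
    proof -
      have "p (v - w k + h) \<le> p (v - w k) + 2 * norm (v - w k + h) * norm h"
        using p_lipschitz[OF vh vw, of k k] by simp
      moreover have "2 * norm (v - w k + h) * norm h \<le> 8 * norm h"
        using hn[OF h(2), of k] by (intro mult_right_mono) auto
      ultimately show ?thesis unfolding eq by linarith
    qed
    show "summable (\<lambda>k. c k * p (v + h - w k))"
    proof (rule summable_comparison_test)
      show "summable (\<lambda>k. c k * 5)" using smc by (rule summable_mult2)
      show "\<exists>N. \<forall>n\<ge>N. norm (c n * p (v + h - w n)) \<le> c n * 5"
        using p2[OF vh hn[OF h(2)]] c0 unfolding eq by (intro exI[of _ 0] allI impI) (simp add: mult_left_mono)
    qed
  qed
  moreover have "norm (\<Sum>k. c k *\<^sub>R a k) \<le> (\<Sum>k. c k * 8)"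
  proof (rule norm_suminf_le)
    show "summable (\<lambda>k. c k * 8)" using smc by (rule summable_mult2)
    show "norm (c k *\<^sub>R a k) \<le> c k * 8" for k using a(1) c0 by (simp add: mult_left_mono)
  qed
  moreover have "(\<Sum>k. c k * 8) = 16 * t"
    using sums_unique[OF sums_mult2[OF cs, of 8]] by simp
  ultimately show ?thesis using that[of "\<Sum>k. c k *\<^sub>R a k"] by (simp add: c_def)
qed

text \<open>
  The coupling term \<open>lam * p (u - w)\<close> replaces the constraint \<open>u = w\<close>. Since \<open>g\<close> is Lipschitz and \<open>p\<close>
  dominates a multiple of the squared norm, \<open>(x, x)\<close> minimizes the decoupled function up to an error of
  order \<open>1 / lam\<close>. The variational principle yields an exact minimizer \<open>(y, v)\<close> of a slightly perturbed
  function. In the two partial subgradients the contributions of the coupling term cancel, and the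
  contributions of the perturbation are small.
\<close>

lemma fuzzy_sum_on_subspace:
  fixes F g :: "'a \<Rightarrow> real"
  assumes complete: "complete (UNIV :: 'a set)" and clY: "closed Y"
    and lsc: "\<And>s z a. (\<forall>n. s n \<in> S0) \<Longrightarrow> s \<longlonglongrightarrow> z \<Longrightarrow> (\<forall>n. F (s n) \<le> a) \<Longrightarrow> z \<in> S0 \<and> F z \<le> a"
    and x: "x \<in> Y" "x \<in> S0" and r: "0 < r"
    and min: "\<And>u. u \<in> S0 \<Longrightarrow> norm (u - x) \<le> r \<Longrightarrow> F x + g x \<le> F u + g u"
    and glip: "\<And>u v. norm (u - x) \<le> r \<Longrightarrow> norm (v - x) \<le> r \<Longrightarrow> \<bar>g u - g v\<bar> \<le> L * norm (u - v)"
    and L: "0 \<le> L" and e: "0 < e"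
  obtains y z a b where "y \<in> Y" "y \<in> S0" "z \<in> Y" "norm (y - x) < e" "norm (z - x) < e" "\<bar>F y - F x\<bar> < e"
    "subgradient_on F S0 Y y a" "subgradient_on g UNIV Y z b" "norm (a + b) \<le> e"
proof -
  define R where "R = min r 1"
  have R: "0 < R" "R \<le> r" "R \<le> 1" using r by (auto simp: R_def)
  (* Points within \<rho> of x stay in the ball, and g changes by less than e there. *)
  define \<rho> where "\<rho> = min R (min e (e / (L + 1)))"
  have \<rho>: "0 < \<rho>" "\<rho> \<le> R" "\<rho> \<le> e" using R e L by (auto simp: \<rho>_def)
  have L\<rho>: "(L + 1) * \<rho> \<le> e"
    using L unfolding \<rho>_def by (metis add_nonneg_pos min.cobounded2 mult.commute pos_le_divide_eq zero_less_one min.coboundedI2)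
  (* Each of the two perturbations has a supergradient of norm at most 16 * t. *)
  define t where "t = e / 32"
  have t: "0 < t" using e by (simp add: t_def)
  (* Chosen so that the gap 5 * L^2 / (2 * lam) is less than t * \<rho>^2 / 10, the smallest penalty
     of a point at distance \<rho> from x. *)
  define lam where "lam = (25 * L\<^sup>2 + 1) / (t * \<rho>\<^sup>2)"
  have lam: "0 < lam" using t \<rho> by (simp add: lam_def add_nonneg_pos)
  define S where "S = {(u, w). u \<in> S0 \<and> u \<in> Y \<and> w \<in> Y \<and> norm (u - x) \<le> R \<and> norm (w - x) \<le> R}"
  define \<theta> where "\<theta> = (\<lambda>(u, w) (u', w'). p (u - u') + p (w - w'))"
  define G where "G = (\<lambda>(u, w). F u + g w + lam * p (u - w))"
  define c where "c k = t * (1/2)^k" for k :: nat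
  have c: "0 < c k" for k using t by (simp add: c_def)
  have smc: "summable c"
    unfolding c_def using summable_mult[OF summable_geometric[of "1/2::real"], of t] by simp
  have diffY: "u - v \<in> Y" if "u \<in> Y" "v \<in> Y" for u v using Y that by (rule subspace_diff)
  have n2: "norm (u - v) \<le> 2" if "norm (u - x) \<le> R" "norm (v - x) \<le> R" for u v
    using norm_triangle_ineq4[of "u - x" "v - x"] that R(3) by simp
  have p2: "p z \<le> 2" if "z \<in> Y" "norm z \<le> 2" for z
  proof -
    have "(norm z)\<^sup>2 \<le> 2\<^sup>2" using that by (intro power_mono) auto
    then show "p z \<le> 2" using p_le[OF that(1)] by simp
  qed
  have gap: "F x + g x - 5 * L\<^sup>2 / (2 * lam) \<le> G (u, w)" if uw: "(u, w) \<in> S" for u w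
  proof -
    define k where "k = norm (u - w)"
    have "F x + g x \<le> F u + g u" using uw R by (intro min) (auto simp: S_def)
    moreover have "g u - g w \<le> L * k"
      using glip[of u w] uw R by (simp add: S_def k_def abs_le_iff)
    moreover have "lam * (k\<^sup>2 / 10) \<le> lam * p (u - w)"
      using p_ge[OF diffY] uw lam by (intro mult_left_mono) (auto simp: S_def k_def)
    moreover have "L * k - lam * (k\<^sup>2 / 10) \<le> 5 * L\<^sup>2 / (2 * lam)"
    proof -
      have "0 \<le> (lam * k - 5 * L)\<^sup>2" by simp
      then have "10 * lam * (L * k) - (lam * k)\<^sup>2 \<le> 25 * L\<^sup>2" by (simp add: power2_eq_square algebra_simps)
      then have "(10 * lam * (L * k) - (lam * k)\<^sup>2) / (10 * lam) \<le> 25 * L\<^sup>2 / (10 * lam)"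
        using lam by (intro divide_right_mono) auto
      moreover have "(10 * lam * (L * k) - (lam * k)\<^sup>2) / (10 * lam) = L * k - lam * (k\<^sup>2 / 10)"
        using lam by (simp add: field_simps power2_eq_square)
      moreover have "25 * L\<^sup>2 / (10 * lam) = 5 * L\<^sup>2 / (2 * lam)" by simp
      ultimately show ?thesis by linarith
    qed
    ultimately show ?thesis by (simp add: G_def)
  qed
  have p0: "p 0 = 0" using p_le[OF zero_Y] p_nonneg[OF zero_Y] by simp
  have xS: "(x, x) \<in> S" using x R by (simp add: S_def)
  obtain z w where z: "z \<in> S" and w: "\<And>k. w k \<in> S" "w 0 = (x, x)"
    and zle: "G z + (\<Sum>k. c k * \<theta> z (w k)) \<le> G (x, x)"
    and zmin: "\<And>u. u \<in> S \<Longrightarrow> G z + (\<Sum>k. c k * \<theta> z (w k)) \<le> G u + (\<Sum>k. c k * \<theta> u (w k))"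
  proof (rule smooth_variational_principle[of S G "F x + g x - 5 * L\<^sup>2 / (2 * lam)" \<theta> 4 c "(x, x)"])
    fix s assume "\<forall>n. s n \<in> S" and C: "Cauchy s"
    have "Cauchy (\<lambda>n. fst (s n))" "Cauchy (\<lambda>n. snd (s n))" using C by (auto intro: Cauchy_fst Cauchy_snd)
    then obtain z1 z2 where "(\<lambda>n. fst (s n)) \<longlonglongrightarrow> z1" "(\<lambda>n. snd (s n)) \<longlonglongrightarrow> z2"
      using complete unfolding complete_def by blast
    from tendsto_Pair[OF this] have "s \<longlonglongrightarrow> (z1, z2)" by simp
    then show "\<exists>z. s \<longlonglongrightarrow> z" ..
  next
    fix s z a assume sS: "\<forall>n. s n \<in> S" and s: "s \<longlonglongrightarrow> z" and le: "\<forall>n. G (s n) \<le> a"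
    define s1 where "s1 n = fst (s n)" for n
    define s2 where "s2 n = snd (s n)" for n
    have s12: "s1 \<longlonglongrightarrow> fst z" "s2 \<longlonglongrightarrow> snd z" unfolding s1_def s2_def using s by (auto intro: tendsto_fst tendsto_snd)
    have mem: "s1 n \<in> S0" "s1 n \<in> Y" "s2 n \<in> Y" "norm (s1 n - x) \<le> R" "norm (s2 n - x) \<le> R"
      and Gs: "F (s1 n) + g (s2 n) + lam * p (s1 n - s2 n) \<le> a" for n
      using sS[rule_format, of n] le[rule_format, of n] by (auto simp: S_def s1_def s2_def G_def split: prod.splits)
    have zY: "fst z \<in> Y" "snd z \<in> Y"
      using closed_sequentially[OF clY mem(2) s12(1)] closed_sequentially[OF clY mem(3) s12(2)] by auto
    have zR: "norm (fst z - x) \<le> R" "norm (snd z - x) \<le> R"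
      by (rule LIMSEQ_le_const2[OF tendsto_norm[OF tendsto_diff[OF s12(1) tendsto_const]]], use mem in blast)
        (rule LIMSEQ_le_const2[OF tendsto_norm[OF tendsto_diff[OF s12(2) tendsto_const]]], use mem in blast)
    have glim: "(\<lambda>n. g (s2 n)) \<longlonglongrightarrow> g (snd z)"
    proof (rule LIM_zero_cancel, rule Lim_null_comparison)
      show "eventually (\<lambda>n. norm (g (s2 n) - g (snd z)) \<le> L * norm (s2 n - snd z)) sequentially"
        using glip mem(5) zR(2) R(2) by (intro always_eventually allI) (simp add: order_trans[OF _ R(2)])
      have "(\<lambda>n. L * norm (s2 n - snd z)) \<longlonglongrightarrow> L * 0"
        using s12(2) by (intro tendsto_mult_left tendsto_norm_zero LIM_zero)
      then show "(\<lambda>n. L * norm (s2 n - snd z)) \<longlonglongrightarrow> 0" by simp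
    qed
    have plim: "(\<lambda>n. p (s1 n - s2 n)) \<longlonglongrightarrow> p (fst z - snd z)"
      by (intro p_tendsto tendsto_diff s12 diffY mem zY)
    define l where "l = g (snd z) + lam * p (fst z - snd z)"
    have lim: "(\<lambda>n. g (s2 n) + lam * p (s1 n - s2 n)) \<longlonglongrightarrow> l"
      unfolding l_def by (intro tendsto_intros glim plim)
    have close: "fst z \<in> S0 \<and> F (fst z) \<le> (a - l) + h" if h: "0 < h" for h
    proof -
      have "eventually (\<lambda>n. l - h < g (s2 n) + lam * p (s1 n - s2 n)) sequentially"
        using order_tendstoD(1)[OF lim, of "l - h"] h by simp
      then obtain N where N: "\<And>n. N \<le> n \<Longrightarrow> l - h < g (s2 n) + lam * p (s1 n - s2 n)"
        unfolding eventually_sequentially by blast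
      have "F (s1 (n + N)) \<le> (a - l) + h" for n using N[of "n + N"] Gs[of "n + N"] by simp
      then show ?thesis
        using mem(1) LIMSEQ_ignore_initial_segment[OF s12(1), of N] by (intro lsc[of "\<lambda>n. s1 (n + N)"]) auto
    qed
    have "fst z \<in> S0" using close[OF zero_less_one] by simp
    moreover have "F (fst z) \<le> a - l" by (rule field_le_epsilon) (rule conjunct2[OF close])
    ultimately show "z \<in> S \<and> G z \<le> a" using zY zR by (auto simp: S_def G_def l_def split: prod.splits)
  next
    fix u assume "u \<in> S"
    then show "F x + g x - 5 * L\<^sup>2 / (2 * lam) \<le> G u" using gap by (cases u) auto
  next
    fix u v assume uv: "u \<in> S" "v \<in> S"
    then have Yd: "fst u - fst v \<in> Y" "snd u - snd v \<in> Y" and nd: "norm (fst u - fst v) \<le> 2" "norm (snd u - snd v) \<le> 2"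
      by (auto simp: S_def intro: diffY n2)
    show "0 \<le> \<theta> u v" using p_nonneg[OF Yd(1)] p_nonneg[OF Yd(2)] by (auto simp: \<theta>_def split: prod.splits)
    show "\<theta> u v \<le> 4" using p2[OF Yd(1) nd(1)] p2[OF Yd(2) nd(2)] by (auto simp: \<theta>_def split: prod.splits)
  next
    fix u assume "u \<in> S"
    then show "\<theta> u u = 0" by (auto simp: \<theta>_def p0 split: prod.splits)
  next
    fix s z v assume sS: "\<forall>n. s n \<in> S" and s: "s \<longlonglongrightarrow> z" and zv: "z \<in> S" "v \<in> S"
    have m: "fst (s n) \<in> Y" "snd (s n) \<in> Y" for n using sS[rule_format, of n] by (auto simp: S_def split: prod.splits)
    have zv': "fst z \<in> Y" "snd z \<in> Y" "fst v \<in> Y" "snd v \<in> Y" using zv by (auto simp: S_def)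
    have "(\<lambda>n. p (fst (s n) - fst v) + p (snd (s n) - snd v)) \<longlonglongrightarrow> p (fst z - fst v) + p (snd z - snd v)"
      by (intro tendsto_add p_tendsto tendsto_diff tendsto_const tendsto_fst tendsto_snd s diffY m zv')
    then show "(\<lambda>n. \<theta> (s n) v) \<longlonglongrightarrow> \<theta> z v" by (simp add: \<theta>_def case_prod_beta)
  next
    fix d :: real assume d: "0 < d"
    have small: "norm h < d / 2" if "h \<in> Y" "p h < d\<^sup>2 / 40" for h
    proof -
      have "(d / 2)\<^sup>2 = d\<^sup>2 / 4" by (simp add: power_divide)
      then have "(norm h)\<^sup>2 < (d / 2)\<^sup>2" using p_ge[OF that(1)] that(2) by linarith
      then show ?thesis by (rule power_less_imp_less_base) (use d in simp)
    qed
    show "\<exists>k>0. \<forall>u\<in>S. \<forall>v\<in>S. \<theta> u v < k \<longrightarrow> dist u v < d"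
    proof (intro exI[of _ "d\<^sup>2 / 40"] conjI ballI impI)
      fix u v assume uv: "u \<in> S" "v \<in> S" and th: "\<theta> u v < d\<^sup>2 / 40"
      then have Yd: "fst u - fst v \<in> Y" "snd u - snd v \<in> Y"
        by (auto simp: S_def intro: diffY)
      have "p (fst u - fst v) + p (snd u - snd v) < d\<^sup>2 / 40" using th by (simp add: \<theta>_def case_prod_beta)
      then have "norm (fst u - fst v) < d / 2" "norm (snd u - snd v) < d / 2"
        using p_nonneg[OF Yd(1)] p_nonneg[OF Yd(2)] by (intro small Yd; linarith)+
      moreover have "dist u v \<le> norm (fst u - fst v) + norm (snd u - snd v)"
        using norm_Pair_le[of "fst u - fst v" "snd u - snd v"] by (simp add: dist_norm minus_prod_def)
      ultimately show "dist u v < d" by simp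
    qed (use d in auto)
  qed (use c smc xS in auto)
  obtain y v where zyv: "z = (y, v)" by fastforce
  define w1 where "w1 k = fst (w k)" for k
  define w2 where "w2 k = snd (w k)" for k
  have wkk: "w k = (w1 k, w2 k)" for k by (simp add: w1_def w2_def)
  have wm: "w1 k \<in> Y" "w2 k \<in> Y" "norm (w1 k - x) \<le> R" "norm (w2 k - x) \<le> R" for k
    using w(1)[of k] by (auto simp: S_def wkk)
  have yv: "y \<in> S0" "y \<in> Y" "v \<in> Y" "norm (y - x) \<le> R" "norm (v - x) \<le> R" using z by (auto simp: S_def zyv)
  define Q where "Q ww u = (\<Sum>k. c k * p (u - ww k))" for ww and u :: 'a
  have smp: "summable (\<lambda>k. c k * p (u - ww k))"
    if "u \<in> Y" "norm (u - x) \<le> R" "\<And>k. ww k \<in> Y" "\<And>k. norm (ww k - x) \<le> R" for u ww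
  proof (rule summable_comparison_test)
    show "summable (\<lambda>k. c k * 2)" using smc by (rule summable_mult2)
    show "\<exists>N. \<forall>n\<ge>N. norm (c n * p (u - ww n)) \<le> c n * 2"
      using p2[OF diffY n2] p_nonneg[OF diffY] that c
      by (intro exI[of _ 0] allI impI) (simp add: abs_mult less_imp_le mult_left_mono)
  qed
  have Qsplit: "(\<Sum>k. c k * \<theta> (u, h) (w k)) = Q w1 u + Q w2 h"
    if "u \<in> Y" "h \<in> Y" "norm (u - x) \<le> R" "norm (h - x) \<le> R" for u h
    unfolding Q_def using suminf_add[OF smp[of u w1] smp[of h w2]] that wm
    by (simp add: \<theta>_def wkk distrib_left)
  have Qge: "c 0 * p (u - ww 0) \<le> Q ww u"
    if "u \<in> Y" "norm (u - x) \<le> R" "\<And>k. ww k \<in> Y" "\<And>k. norm (ww k - x) \<le> R" for u ww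
    unfolding Q_def using sum_le_suminf[OF smp[OF that], of "{0}"] p_nonneg[OF diffY[OF that(1,3)]] c
    by (simp add: less_imp_le)
  have zle': "G (y, v) + (Q w1 y + Q w2 v) \<le> F x + g x"
    using zle Qsplit[OF yv(2,3,4,5)] by (simp add: zyv G_def p0)
  have w0: "w1 0 = x" "w2 0 = x" using w(2) by (auto simp: w1_def w2_def)
  have Q1: "t * p (y - x) \<le> Q w1 y" using Qge[of y w1] yv wm w0 by (simp add: c_def)
  have Q2: "t * p (v - x) \<le> Q w2 v" using Qge[of v w2] yv wm w0 by (simp add: c_def)
  have yx: "y - x \<in> Y" "v - x \<in> Y" using yv x by (auto intro: diffY)
  have pp: "0 \<le> t * p (y - x)" "0 \<le> t * p (v - x)" using p_nonneg[OF yx(1)] p_nonneg[OF yx(2)] t by auto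
  have gapb: "t * p (y - x) + t * p (v - x) \<le> 5 * L\<^sup>2 / (2 * lam)"
    using zle' Q1 Q2 gap[of y v] z zyv by simp
  have gapr: "5 * L\<^sup>2 / (2 * lam) < t * (\<rho>\<^sup>2 / 10)"
  proof -
    define k where "k = 25 * L\<^sup>2 + 1"
    have k: "0 < k" by (simp add: k_def add_nonneg_pos)
    have "5 * L\<^sup>2 / (2 * lam) = (25 * L\<^sup>2 / k) * (t * (\<rho>\<^sup>2 / 10))"
      unfolding lam_def k_def[symmetric] using k t \<rho> by (simp add: field_simps)
    also have "\<dots> < 1 * (t * (\<rho>\<^sup>2 / 10))"
      using t \<rho> k by (intro mult_strict_right_mono) (auto simp: divide_less_eq k_def)
    finally show ?thesis by simp
  qed
  have near: "norm h < \<rho>" if "h \<in> Y" "t * p h < t * (\<rho>\<^sup>2 / 10)" for h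
  proof -
    have "p h < \<rho>\<^sup>2 / 10" using that(2) t by (simp only: mult_less_cancel_left_pos)
    then have "(norm h)\<^sup>2 < \<rho>\<^sup>2" using p_ge[OF that(1)] by simp
    then show ?thesis by (rule power_less_imp_less_base) (use \<rho> in simp)
  qed
  have ny: "norm (y - x) < \<rho>" and nv: "norm (v - x) < \<rho>"
    using near[OF yx(1)] near[OF yx(2)] gapb gapr pp by auto
  have Fy: "\<bar>F y - F x\<bar> < e"
  proof -
    have "G (y, v) \<le> F x + g x" using zle' Q1 Q2 pp by simp
    moreover have "0 \<le> lam * p (y - v)" using lam p_nonneg[OF diffY[OF yv(2,3)]] by simp
    moreover have Lb: "\<bar>g h - g x\<bar> < e" if "norm (h - x) < \<rho>" for h
    proof -
      have "\<bar>g h - g x\<bar> \<le> L * norm (h - x)" using that \<rho> R r by (intro glip) auto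
      also have "\<dots> \<le> L * \<rho>" using that L by (intro mult_left_mono) auto
      also have "\<dots> < (L + 1) * \<rho>" using \<rho> by (simp add: algebra_simps)
      finally show ?thesis using L\<rho> by simp
    qed
    moreover have "F x + g x \<le> F y + g y" using yv R by (intro min) auto
    ultimately show ?thesis using Lb[OF ny] Lb[OF nv] by (simp add: G_def abs_less_iff)
  qed
  have yvY: "y - v \<in> Y" using yv by (intro diffY)
  obtain a0 where a0: "supergradient_on Y p (y - v) a0" by (rule p_supergradient[OF yvY])
  have R1: "norm (w1 k - x) \<le> 1" "norm (w2 k - x) \<le> 1" for k using wm[of k] R by auto
  have yv1: "norm (y - x) \<le> 1" "norm (v - x) \<le> 1" using yv R by auto
  have Qeq: "Q ww = (\<lambda>u. \<Sum>k. t * (1/2)^k * p (u - ww k))" for ww by (simp add: Q_def[abs_def] c_def)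
  obtain a1 where a1: "norm a1 \<le> 16 * t" "supergradient_on Y (Q w1) y a1"
    unfolding Qeq by (rule perturbation_supergradient[OF wm(1) R1(1) yv(2) yv1(1) t])
  obtain a2 where a2: "norm a2 \<le> 16 * t" "supergradient_on Y (Q w2) v a2"
    unfolding Qeq by (rule perturbation_supergradient[OF wm(2) R1(2) yv(3) yv1(2) t])
  have sy: "supergradient_on Y (\<lambda>u. lam * p (u - v) + Q w1 u) y (lam *\<^sub>R a0 + a1)"
    by (intro supergradient_on_add supergradient_on_scale supergradient_on_shift a0 a1 lam)
  have sv: "supergradient_on Y (\<lambda>u. lam * p (y - u) + Q w2 u) v (lam *\<^sub>R (- a0) + a2)"
    by (intro supergradient_on_add supergradient_on_scale supergradient_on_reflect a0 a2 lam Y)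
  have subF: "subgradient_on F S0 Y y (- (lam *\<^sub>R a0 + a1))"
  proof (rule subgradient_on_of_min[OF sy, of "R - norm (y - x)"])
    show "0 < R - norm (y - x)" using ny \<rho> by simp
    fix h assume h: "h \<in> Y" "norm h < R - norm (y - x)" "y + h \<in> S0"
    have yh: "y + h \<in> Y" using Y yv(2) h(1) by (rule subspace_add)
    have nh: "norm (y + h - x) \<le> R" using norm_triangle_ineq[of "y - x" h] h(2) by (simp add: algebra_simps)
    have "(y + h, v) \<in> S" using yh nh h yv by (simp add: S_def)
    from zmin[OF this] show "F y + (lam * p (y - v) + Q w1 y) \<le> F (y + h) + (lam * p (y + h - v) + Q w1 (y + h))"
      using Qsplit[OF yv(2,3,4,5)] Qsplit[OF yh yv(3) nh yv(5)] by (simp add: zyv G_def)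
  qed
  have subg: "subgradient_on g UNIV Y v (- (lam *\<^sub>R (- a0) + a2))"
  proof (rule subgradient_on_of_min[OF sv, of "R - norm (v - x)"])
    show "0 < R - norm (v - x)" using nv \<rho> by simp
    fix h assume h: "h \<in> Y" "norm h < R - norm (v - x)"
    have vh: "v + h \<in> Y" using Y yv(3) h(1) by (rule subspace_add)
    have nh: "norm (v + h - x) \<le> R" using norm_triangle_ineq[of "v - x" h] h(2) by (simp add: algebra_simps)
    have "(y, v + h) \<in> S" using vh nh h yv by (simp add: S_def)
    from zmin[OF this] show "g v + (lam * p (y - v) + Q w2 v) \<le> g (v + h) + (lam * p (y - (v + h)) + Q w2 (v + h))"
      using Qsplit[OF yv(2,3,4,5)] Qsplit[OF yv(2) vh yv(4) nh] by (simp add: zyv G_def)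
  qed
  have "norm (- (lam *\<^sub>R a0 + a1) + - (lam *\<^sub>R (- a0) + a2)) = norm (a1 + a2)"
    by (simp add: norm_minus_commute[of 0] flip: norm_minus_cancel[of "a1 + a2"])
  also have "\<dots> \<le> e" using norm_triangle_ineq[of a1 a2] a1(1) a2(1) by (simp add: t_def)
  finally show ?thesis
    using yv ny nv \<rho> Fy subF subg by (intro that[of y v]) auto
qed

end

section \<open>Separable reduction of Frechet subgradients\<close>

text \<open>
  A Loewenheim-Skolem argument: iterate the countably many operations \<open>\<omega>\<close> times.
\<close>

lemma countable_closure_under:
  fixes op :: "'a \<Rightarrow> 'a \<Rightarrow> 'p::countable \<Rightarrow> 'a set"
  assumes op: "\<And>x y q. countable (op x y q)" and C0: "countable C0"
  obtains C where "countable C" "C0 \<subseteq> C" "\<And>x y q. x \<in> C \<Longrightarrow> y \<in> C \<Longrightarrow> op x y q \<subseteq> C"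
proof -
  define step where "step A = A \<union> (\<Union>x\<in>A. \<Union>y\<in>A. \<Union>q. op x y q)" for A
  define Cn where "Cn n = (step ^^ n) C0" for n
  have mono: "Cn n \<subseteq> Cn (Suc n)" for n by (auto simp: Cn_def step_def)
  have le: "Cn n \<subseteq> Cn m" if "n \<le> m" for n m using that mono by (rule lift_Suc_mono_le[rotated])
  have cn: "countable (Cn n)" for n
    by (induction n) (auto simp: Cn_def step_def C0 op)
  show ?thesis
  proof (rule that[of "\<Union>n. Cn n"])
    show "countable (\<Union>n. Cn n)" using cn by auto
    show "C0 \<subseteq> (\<Union>n. Cn n)" using UN_upper[of 0 UNIV Cn] by (simp add: Cn_def)
    fix x y q assume "x \<in> (\<Union>n. Cn n)" "y \<in> (\<Union>n. Cn n)"
    then obtain i j where ij: "x \<in> Cn i" "y \<in> Cn j" by auto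
    define k where "k = max i j"
    have "x \<in> Cn k" "y \<in> Cn k" using ij le[of i k] le[of j k] by (auto simp: k_def)
    then have "op x y q \<subseteq> Cn (Suc k)" by (auto simp: Cn_def step_def)
    then show "op x y q \<subseteq> (\<Union>n. Cn n)" by blast
  qed
qed

text \<open>
  A list entry \<open>(t, n, u)\<close> stands for \<open>t\<close> times the constraint
  \<open>b (u - w) \<le> F u - F w + norm (u - w) / Suc n\<close> on a functional \<open>b\<close>, where \<open>\<alpha>\<close> approximates \<open>F w\<close>.
  \<open>quot_sum\<close> and \<open>dir_sum\<close> add up the right-hand sides and the directions.
\<close>

definition quot_sum :: "('a::real_normed_vector \<Rightarrow> real) \<Rightarrow> real \<Rightarrow> 'a \<Rightarrow> (real \<times> nat \<times> 'a) list \<Rightarrow> real" where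
  "quot_sum F \<alpha> w l = (\<Sum>(t, n, u)\<leftarrow>l. t * (F u - \<alpha> + norm (u - w) / Suc n))"

definition dir_sum :: "'a::real_normed_vector \<Rightarrow> (real \<times> nat \<times> 'a) list \<Rightarrow> 'a" where
  "dir_sum w l = (\<Sum>(t, n, u)\<leftarrow>l. t *\<^sub>R (u - w))"

definition admissible :: "'a::real_normed_vector set \<Rightarrow> 'a \<Rightarrow> (nat \<Rightarrow> real) \<Rightarrow> nat \<Rightarrow> (real \<times> nat \<times> 'a) list \<Rightarrow> bool" where
  "admissible S0 w d N l \<longleftrightarrow> (\<forall>(t, n, u)\<in>set l. 0 < t \<and> n < N \<and> u \<in> S0 \<and> norm (u - w) < d n)"

definition cost :: "('a::real_normed_vector \<Rightarrow> real) \<Rightarrow> real \<Rightarrow> 'a \<Rightarrow> 'a \<Rightarrow> real \<Rightarrow> (real \<times> nat \<times> 'a) list \<Rightarrow> real" where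
  "cost F \<alpha> w v c l = quot_sum F \<alpha> w l + c * norm (v - dir_sum w l)"

text \<open>
  A violation of the consistency condition for extending a subgradient, with all data but the list
  itself taken from a countable set: radii, bound \<open>c\<close>, approximate value \<open>\<alpha>\<close>, total weight \<open>T\<close> and
  threshold \<open>\<rho>\<close> are rational. The weights in the list are arbitrary reals; the bound on their sum is what
  keeps the errors of the rational approximations under control.
\<close>

definition good_list :: "('a::real_normed_vector \<Rightarrow> real) \<Rightarrow> 'a set \<Rightarrow> 'a \<Rightarrow> 'a \<Rightarrow> rat list \<times> rat \<times> rat \<times> rat \<times> rat
    \<Rightarrow> (real \<times> nat \<times> 'a) list \<Rightarrow> bool" where
  "good_list F S0 w v = (\<lambda>(ds, c, \<alpha>, T, \<rho>) l. admissible S0 w (\<lambda>n. of_rat (ds ! n)) (length ds) l \<and>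
     sum_list (map fst l) \<le> of_rat T \<and> cost F (of_rat \<alpha>) w v (of_rat c) l < of_rat \<rho>)"

definition points :: "(real \<times> nat \<times> 'a) list \<Rightarrow> 'a set" where
  "points l = (\<lambda>(t, n, u). u) ` set l"

text \<open>
  Every violation that occurs in the whole space is matched by a violation inside \<open>C\<close>.
\<close>

definition reflects :: "('a::real_normed_vector \<Rightarrow> real) \<Rightarrow> 'a set \<Rightarrow> 'a set \<Rightarrow> bool" where
  "reflects F S0 C \<longleftrightarrow> (\<forall>w\<in>C. \<forall>v\<in>C. \<forall>q. (\<exists>l. good_list F S0 w v q l) \<longrightarrow> (\<exists>l. good_list F S0 w v q l \<and> points l \<subseteq> C))"

lemma ex_reflecting_set:
  fixes F g :: "'a::real_normed_vector \<Rightarrow> real"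
  assumes C0: "countable C0"
  obtains C where "countable C" "C0 \<subseteq> C" "reflects F S0 C" "reflects g S1 C"
    "\<And>x y r s. x \<in> C \<Longrightarrow> y \<in> C \<Longrightarrow> of_rat r *\<^sub>R x + of_rat s *\<^sub>R y \<in> C"
proof -
  define op where "op = (\<lambda>x y ((r, s), q). {of_rat r *\<^sub>R x + of_rat s *\<^sub>R y} \<union>
     points (SOME l. good_list F S0 x y q l) \<union> points (SOME l. good_list g S1 x y q l))"
  have "countable (op x y q)" for x y and q :: "(rat \<times> rat) \<times> rat list \<times> rat \<times> rat \<times> rat \<times> rat"
    by (auto simp: op_def points_def intro: countable_finite split: prod.splits)
  then obtain C where C: "countable C" "C0 \<subseteq> C"
    and cl: "\<And>x y q. x \<in> C \<Longrightarrow> y \<in> C \<Longrightarrow> op x y q \<subseteq> C"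
    by (rule countable_closure_under[OF _ C0, of op]) blast
  show ?thesis
  proof (rule that[OF C])
    show "reflects F S0 C"
      unfolding reflects_def
    proof (intro ballI allI impI)
      fix w v q assume wv: "w \<in> C" "v \<in> C" and ex: "\<exists>l. good_list F S0 w v q l"
      have "points (SOME l. good_list F S0 w v q l) \<subseteq> C"
        using cl[OF wv, of "((0, 0), q)"] by (auto simp: op_def)
      then show "\<exists>l. good_list F S0 w v q l \<and> points l \<subseteq> C" using someI_ex[OF ex] by blast
    qed
    show "reflects g S1 C"
      unfolding reflects_def
    proof (intro ballI allI impI)
      fix w v q assume wv: "w \<in> C" "v \<in> C" and ex: "\<exists>l. good_list g S1 w v q l"
      have "points (SOME l. good_list g S1 w v q l) \<subseteq> C"
        using cl[OF wv, of "((0, 0), q)"] by (auto simp: op_def)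
      then show "\<exists>l. good_list g S1 w v q l \<and> points l \<subseteq> C" using someI_ex[OF ex] by blast
    qed
    show "of_rat r *\<^sub>R x + of_rat s *\<^sub>R y \<in> C" if "x \<in> C" "y \<in> C" for x y r s
      using cl[OF that, of "((r, s), ([], 0, 0, 0, 0))"] by (auto simp: op_def)
  qed
qed

lemma subspace_closure_rational:
  fixes C :: "'a::real_normed_vector set"
  assumes ne: "C \<noteq> {}" and comb: "\<And>x y r s. x \<in> C \<Longrightarrow> y \<in> C \<Longrightarrow> of_rat r *\<^sub>R x + of_rat s *\<^sub>R y \<in> C"
  shows "subspace (closure C)"
proof (rule subspaceI)
  obtain x where "x \<in> C" using ne by blast
  then have "0 \<in> C" using comb[of x x 0 0] by simp
  then show "0 \<in> closure C" using closure_subset by blast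
next
  fix x y assume "x \<in> closure C" "y \<in> closure C"
  then obtain f h where "\<forall>n. f n \<in> C" "f \<longlonglongrightarrow> x" "\<forall>n. h n \<in> C" "h \<longlonglongrightarrow> y"
    unfolding closure_sequential by blast
  then have "\<forall>n. f n + h n \<in> C" "(\<lambda>n. f n + h n) \<longlonglongrightarrow> x + y"
    using comb[of _ _ 1 1] by (auto intro: tendsto_add)
  then show "x + y \<in> closure C" unfolding closure_sequential by (intro exI[of _ "\<lambda>n. f n + h n"] conjI)
next
  fix t :: real and x assume "x \<in> closure C"
  then obtain f where f: "\<forall>n. f n \<in> C" "f \<longlonglongrightarrow> x" unfolding closure_sequential by blast
  have "\<exists>r. t < of_rat r \<and> of_rat r < t + 1 / Suc n" for n
    by (rule of_rat_dense) simp
  then obtain r where r: "\<And>n. t < of_rat (r n)" "\<And>n. of_rat (r n) < t + 1 / real (Suc n)" by metis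
  have "(\<lambda>n. t + 1 / real (Suc n)) \<longlonglongrightarrow> t + 0"
    using tendsto_add[OF tendsto_const[of t] LIMSEQ_inverse_real_of_nat] by (simp only: inverse_eq_divide)
  then have lim: "(\<lambda>n. t + 1 / real (Suc n)) \<longlonglongrightarrow> t" by (simp only: add_0_right)
  have "(\<lambda>n. of_rat (r n) :: real) \<longlonglongrightarrow> t"
  proof (rule tendsto_sandwich[OF _ _ tendsto_const lim])
    show "eventually (\<lambda>n. t \<le> of_rat (r n)) sequentially"
      by (rule always_eventually) (blast intro: less_imp_le r(1))
    show "eventually (\<lambda>n. of_rat (r n) \<le> t + 1 / real (Suc n)) sequentially"
      by (rule always_eventually) (blast intro: less_imp_le r(2))
  qed
  then have "(\<lambda>n. of_rat (r n) *\<^sub>R f n) \<longlonglongrightarrow> t *\<^sub>R x" using f(2) by (rule tendsto_scaleR)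
  moreover have "\<forall>n. of_rat (r n) *\<^sub>R f n \<in> C" using f(1) comb[of _ _ _ 0] by force
  ultimately show "t *\<^sub>R x \<in> closure C"
    unfolding closure_sequential by (intro exI[of _ "\<lambda>n. of_rat (r n) *\<^sub>R f n"] conjI)
qed

lemma quot_sum_perturb:
  assumes "\<forall>z\<in>set l. 0 < fst z" "\<bar>\<alpha> - \<alpha>'\<bar> \<le> h" "norm (w - w') \<le> h"
  shows "quot_sum F \<alpha>' w' l \<le> quot_sum F \<alpha> w l + 2 * h * sum_list (map fst l)"
  using assms(1)
proof (induction l)
  case Nil
  then show ?case by (simp add: quot_sum_def)
next
  case (Cons z l)
  obtain t n u where z: "z = (t, n, u)" by (cases z) auto
  have t: "0 < t" using Cons.prems by (simp add: z)
  have "norm (u - w') / Suc n \<le> (norm (u - w) + h) / Suc n"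
    using norm_triangle_ineq[of "u - w" "w - w'"] assms(3) by (intro divide_right_mono) auto
  also have "\<dots> = norm (u - w) / Suc n + h / Suc n" by (rule add_divide_distrib)
  also have "h / Suc n \<le> h / 1" using assms(2) by (intro divide_left_mono) auto
  finally have "F u - \<alpha>' + norm (u - w') / Suc n \<le> F u - \<alpha> + norm (u - w) / Suc n + 2 * h"
    using assms(2) by (simp add: abs_le_iff)
  from mult_left_mono[OF this, of t] t
  have "t * (F u - \<alpha>' + norm (u - w') / Suc n) \<le> t * (F u - \<alpha> + norm (u - w) / Suc n) + 2 * h * t"
    by (simp add: distrib_left mult.commute[of t "2 * h"] del: of_nat_Suc)
  moreover have "quot_sum F \<alpha>' w' l \<le> quot_sum F \<alpha> w l + 2 * h * sum_list (map fst l)"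
    using Cons by simp
  ultimately show ?case by (simp add: quot_sum_def z distrib_left del: of_nat_Suc)
qed

lemma dir_sum_perturb:
  assumes "\<forall>z\<in>set l. 0 < fst z" "norm (w - w') \<le> h"
  shows "norm (dir_sum w l - dir_sum w' l) \<le> h * sum_list (map fst l)"
  using assms(1)
proof (induction l)
  case Nil
  then show ?case by (simp add: dir_sum_def)
next
  case (Cons z l)
  obtain t n u where z: "z = (t, n, u)" by (cases z) auto
  have t: "0 < t" using Cons.prems by (simp add: z)
  have "dir_sum w (z # l) - dir_sum w' (z # l) = t *\<^sub>R (w' - w) + (dir_sum w l - dir_sum w' l)"
    by (simp add: dir_sum_def z algebra_simps)
  also have "norm \<dots> \<le> norm (t *\<^sub>R (w' - w)) + norm (dir_sum w l - dir_sum w' l)" by (rule norm_triangle_ineq)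
  also have "\<dots> \<le> t * h + h * sum_list (map fst l)"
  proof (rule add_mono)
    show "norm (t *\<^sub>R (w' - w)) \<le> t * h"
      using t assms(2) by (simp add: norm_minus_commute mult_left_mono)
    show "norm (dir_sum w l - dir_sum w' l) \<le> h * sum_list (map fst l)"
      using Cons by simp
  qed
  finally show ?case by (simp add: z algebra_simps)
qed

lemma cost_perturb:
  assumes pos: "\<forall>z\<in>set l. 0 < fst z" and T: "sum_list (map fst l) \<le> T"
    and h: "\<bar>\<alpha> - \<alpha>'\<bar> \<le> h" "norm (w - w') \<le> h" "norm (v - v') \<le> h" and c: "0 \<le> c"
  shows "cost F \<alpha>' w' v' c l \<le> cost F \<alpha> w v c l + (2 * T + c + c * T) * h"
proof -
  have h0: "0 \<le> h" using h(1) by simp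
  have hT: "h * sum_list (map fst l) \<le> h * T" using T h0 by (rule mult_left_mono)
  have "v' - dir_sum w' l = (v - dir_sum w l) + ((v' - v) + (dir_sum w l - dir_sum w' l))" by simp
  then have "norm (v' - dir_sum w' l) \<le> norm (v - dir_sum w l) + (norm (v' - v) + norm (dir_sum w l - dir_sum w' l))"
    using norm_triangle_ineq[of "v - dir_sum w l" "(v' - v) + (dir_sum w l - dir_sum w' l)"]
      norm_triangle_ineq[of "v' - v" "dir_sum w l - dir_sum w' l"] by simp
  also have "\<dots> \<le> norm (v - dir_sum w l) + (h + h * T)"
    using dir_sum_perturb[OF pos h(2)] hT h(3) by (simp add: norm_minus_commute)
  finally have "c * norm (v' - dir_sum w' l) \<le> c * (norm (v - dir_sum w l) + (h + h * T))"
    using c by (rule mult_left_mono)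
  then show ?thesis
    using quot_sum_perturb[OF pos h(1,2), of F] hT by (simp add: cost_def algebra_simps)
qed

text \<open>
  The consistency condition holds for lists of points at which \<open>a\<close> satisfies the subgradient
  inequality.
\<close>

lemma cost_ge_on_subspace:
  fixes a :: "'a::real_normed_vector \<Rightarrow>\<^sub>L real"
  assumes pos: "\<forall>(t, n, u)\<in>set l. 0 < t \<and> blinfun_apply a (u - w) \<le> F u - \<alpha> + norm (u - w) / Suc n"
    and c: "norm a \<le> c"
  shows "blinfun_apply a v \<le> cost F \<alpha> w v c l"
proof -
  have "blinfun_apply a (dir_sum w l) \<le> quot_sum F \<alpha> w l"
    using pos
  proof (induction l)
    case Nil
    then show ?case by (simp add: dir_sum_def quot_sum_def blinfun.zero_right)
  next
    case (Cons z l)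
    obtain t n u where z: "z = (t, n, u)" by (cases z) auto
    have "t * blinfun_apply a (u - w) \<le> t * (F u - \<alpha> + norm (u - w) / Suc n)"
      using Cons.prems by (intro mult_left_mono) (auto simp: z)
    moreover have "blinfun_apply a (dir_sum w l) \<le> quot_sum F \<alpha> w l"
      by (rule Cons.IH) (use Cons.prems in simp)
    moreover have "dir_sum w (z # l) = t *\<^sub>R (u - w) + dir_sum w l"
      "quot_sum F \<alpha> w (z # l) = t * (F u - \<alpha> + norm (u - w) / Suc n) + quot_sum F \<alpha> w l"
      by (simp_all add: z dir_sum_def quot_sum_def)
    ultimately show ?case by (simp only: blinfun.add_right blinfun.scaleR_right real_scaleR_def add_mono)
  qed
  moreover have "blinfun_apply a (v - dir_sum w l) \<le> c * norm (v - dir_sum w l)"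
    using norm_blinfun[of a "v - dir_sum w l"] mult_right_mono[OF c norm_ge_zero, of "v - dir_sum w l"] by (simp add: abs_le_iff)
  ultimately show ?thesis by (simp add: cost_def blinfun.diff_right)
qed

text \<open>
  Fix radii \<open>dr n\<close> on which \<open>a\<close> satisfies the subgradient inequality along \<open>Y\<close> with slope error
  \<open>1 / Suc n\<close>. An extension \<open>b\<close> of \<open>a\<close> that satisfies these inequalities on half the radii, for all
  increments, is a solution of a conic system of constraints, so by \<open>functional_below_cone\<close> it is
  enough to exclude violations of the consistency condition (the fact \<open>key\<close>). A violation by a list of
  arbitrary points would be reflected by a violation by points of \<open>C\<close>, hence of \<open>Y\<close>, where the
  subgradient inequality of \<open>a\<close> rules it out.
\<close>

lemma subgradient_extension:
  fixes F :: "'a::real_normed_vector \<Rightarrow> real" and a :: "'a \<Rightarrow>\<^sub>L real"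
  assumes refl: "reflects F S0 C" and Y: "subspace Y" "Y = closure C" and y: "y \<in> Y" "y \<in> S0"
    and sub: "subgradient_on F S0 Y y a"
  obtains b where "\<And>x. x \<in> Y \<Longrightarrow> blinfun_apply b x = blinfun_apply a x" "subgradient_on F S0 UNIV y b"
proof -
  have "\<exists>r::rat. 0 < r \<and> (\<forall>h\<in>Y. norm h < of_rat r \<longrightarrow> y + h \<in> S0 \<longrightarrow> F y + blinfun_apply a h - 1 / Suc n * norm h \<le> F (y + h))" for n :: nat
  proof -
    have "0 < 1 / real (Suc n)" by simp
    then obtain d where d: "0 < d" "\<forall>h\<in>Y. norm h < d \<longrightarrow> y + h \<in> S0 \<longrightarrow> F y + blinfun_apply a h - 1 / Suc n * norm h \<le> F (y + h)"
      using sub unfolding subgradient_on_def by blast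
    obtain r where r: "0 < real_of_rat r" "of_rat r < d" using of_rat_dense[OF d(1)] by blast
    show ?thesis
      by (rule exI[of _ r]) (use r d(2) in \<open>auto simp del: of_nat_Suc\<close>)
  qed
  then obtain dl :: "nat \<Rightarrow> rat" where dl0: "\<And>n. 0 < dl n"
    and dl: "\<And>n. \<forall>h\<in>Y. norm h < of_rat (dl n) \<longrightarrow> y + h \<in> S0 \<longrightarrow> F y + blinfun_apply a h - 1 / Suc n * norm h \<le> F (y + h)"
    by metis
  define dr where "dr n = (of_rat (dl n) :: real)" for n
  have dr0: "0 < dr n" for n using dl0 by (simp add: dr_def)
  have slope: "blinfun_apply a (u - y) \<le> F u - F y + norm (u - y) / Suc n" if "u \<in> Y" "u \<in> S0" "norm (u - y) < dr n" for u n
    using dl[of n, rule_format, of "u - y"] that Y y by (simp add: subspace_diff dr_def del: of_nat_Suc)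
  obtain cq :: rat where cq: "norm a < of_rat cq" using of_rat_dense[of "norm a" "norm a + 1"] by auto
  define c where "c = (of_rat cq :: real)"
  have c: "norm a \<le> c" "0 \<le> c" using cq norm_ge_zero[of a] unfolding c_def by linarith+
  define adm where "adm l \<longleftrightarrow> (\<forall>(t, n, u)\<in>set l. 0 < t \<and> u \<in> S0 \<and> norm (u - y) < dr n / 2)" for l :: "(real \<times> nat \<times> 'a) list"
  have key: "blinfun_apply a v \<le> cost F (F y) y v c l" if l: "adm l" and v: "v \<in> Y" for l v
  proof (rule ccontr)
    assume violated: "\<not> ?thesis"
    define gap where "gap = blinfun_apply a v - cost F (F y) y v c l"
    have gap: "0 < gap" using violated by (simp add: gap_def)
    define N where "N = Suc (Max (insert 0 ((\<lambda>(t, n, u). n) ` set l)))"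
    have N: "n < N" if "(t, n, u) \<in> set l" for t n u
    proof -
      have "n \<le> Max (insert 0 ((\<lambda>(t, n, u). n) ` set l))" using that by (intro Max_ge) force+
      then show ?thesis by (simp add: N_def)
    qed
    define s where "s = sum_list (map fst l)"
    have pos: "\<forall>z\<in>set l. 0 < fst z" using l by (auto simp: adm_def)
    obtain T :: rat where T: "max 0 s < of_rat T" using of_rat_dense[of "max 0 s" "max 0 s + 1"] by auto
    define K where "K = 2 * of_rat T + c + c * of_rat T"
    have K0: "0 \<le> K" using T c by (simp add: K_def)
    (* Replacing y, v and F y by approximations within h changes the cost by at most gap / 4, and h is
       small enough for points within dr n / 2 of y to be within 3/4 * dr n of w, and for those to be
       within dr n of y. *)
    define h where "h = min (gap / (4 * (K + 1))) (Min (insert 1 ((\<lambda>n. dr n / 4) ` {..<N})))"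
    have hpos: "0 < h" using gap K0 dr0 by (simp add: h_def)
    have hdr: "h \<le> dr n / 4" if "n < N" for n
      unfolding h_def using that by (intro min.coboundedI2 Min_le) auto
    have Kh: "K * h \<le> gap / 4"
    proof -
      have "K * h \<le> (K + 1) * h" using hpos by (intro mult_right_mono) auto
      also have "\<dots> \<le> (K + 1) * (gap / (4 * (K + 1)))" using K0 by (intro mult_left_mono) (auto simp: h_def)
      also have "\<dots> = gap / 4" using K0 by (simp add: field_simps)
      finally show ?thesis .
    qed
    obtain w where w: "w \<in> C" "norm (w - y) < h"
      using y(1) hpos unfolding Y(2) closure_approachable dist_norm by blast
    obtain v' where v': "v' \<in> C" "norm (v' - v) < h"
      using v hpos unfolding Y(2) closure_approachable dist_norm by blast
    obtain \<alpha> :: rat where \<alpha>: "F y < of_rat \<alpha>" "of_rat \<alpha> < F y + h" using of_rat_dense[of "F y" "F y + h"] hpos by auto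
    have "blinfun_apply a v - gap + gap / 4 < blinfun_apply a v - gap / 4" using gap by simp
    then obtain \<rho> :: rat where \<rho>: "blinfun_apply a v - gap + gap / 4 < of_rat \<rho>" "of_rat \<rho> < blinfun_apply a v - gap / 4"
      using of_rat_dense by blast
    define q where "q = (map (\<lambda>n. 3/4 * dl n) [0..<N], cq, \<alpha>, T, \<rho>)"
    have rad: "of_rat (map (\<lambda>n. 3/4 * dl n) [0..<N] ! n) = 3/4 * dr n" if "n < N" for n
      using that by (simp add: dr_def of_rat_mult of_rat_divide)
    have "good_list F S0 w v' q l"
      unfolding good_list_def q_def prod.case
    proof (intro conjI)
      show "admissible S0 w (\<lambda>n. of_rat (map (\<lambda>n. 3/4 * dl n) [0..<N] ! n)) (length (map (\<lambda>n. 3/4 * dl n) [0..<N])) l"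
        unfolding admissible_def
      proof (intro ballI)
        fix z assume z: "z \<in> set l"
        obtain t n u where tz: "z = (t, n, u)" by (cases z) auto
        have n: "n < N" using N z tz by blast
        have u: "0 < t" "u \<in> S0" "norm (u - y) < dr n / 2" using l z by (auto simp: adm_def tz)
        have "norm (u - w) \<le> norm (u - y) + norm (w - y)" using norm_triangle_ineq4[of "u - y" "w - y"] by simp
        also have "\<dots> < 3/4 * dr n" using u(3) w(2) hdr[OF n] by linarith
        finally show "case z of (t, n, u) \<Rightarrow> 0 < t \<and> n < length (map (\<lambda>n. 3/4 * dl n) [0..<N]) \<and> u \<in> S0 \<and>
            norm (u - w) < of_rat (map (\<lambda>n. 3/4 * dl n) [0..<N] ! n)"
          using u n rad[OF n] by (simp add: tz)
      qed
      show "sum_list (map fst l) \<le> of_rat T" using T by (simp add: s_def)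
      have "cost F (of_rat \<alpha>) w v' c l \<le> cost F (F y) y v c l + K * h"
        unfolding K_def
      proof (rule cost_perturb[OF pos _ _ _ _ c(2)])
        show "sum_list (map fst l) \<le> of_rat T" using T by (simp add: s_def)
      qed (use \<alpha> w v' in \<open>auto simp: norm_minus_commute\<close>)
      then show "cost F (of_rat \<alpha>) w v' (of_rat cq) l < of_rat \<rho>"
        using Kh \<rho>(1) gap_def unfolding c_def[symmetric] by linarith
    qed
    then obtain l' where l': "good_list F S0 w v' q l'" "points l' \<subseteq> C"
      using refl w(1) v'(1) unfolding reflects_def by blast
    have adm': "admissible S0 w (\<lambda>n. of_rat (map (\<lambda>n. 3/4 * dl n) [0..<N] ! n)) N l'"
      and T': "sum_list (map fst l') \<le> of_rat T" and cost': "cost F (of_rat \<alpha>) w v' c l' < of_rat \<rho>"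
      using l'(1) by (auto simp: good_list_def q_def c_def)
    have elem: "0 < t \<and> blinfun_apply a (u - y) \<le> F u - F y + norm (u - y) / Suc n" if tnu: "(t, n, u) \<in> set l'" for t n u
    proof -
      have n: "n < N" and t: "0 < t" and u: "u \<in> S0" "norm (u - w) < 3/4 * dr n"
      proof -
        from bspec[OF adm'[unfolded admissible_def] tnu]
        have *: "0 < t" "n < N" "u \<in> S0" "norm (u - w) < of_rat (map (\<lambda>n. 3/4 * dl n) [0..<N] ! n)"
          unfolding prod.case by blast+
        show "n < N" "0 < t" "u \<in> S0" "norm (u - w) < 3/4 * dr n"
          using * unfolding rad[OF *(2)] by blast+
      qed
      have "u \<in> C" using l'(2) tnu by (force simp: points_def)
      then have "u \<in> Y" using closure_subset[of C] Y(2) by blast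
      moreover have "norm (u - y) < dr n"
        using norm_triangle_ineq[of "u - w" "w - y"] u(2) w(2) hdr[OF n] by simp
      ultimately show ?thesis using slope u(1) t by blast
    qed
    then have "blinfun_apply a v \<le> cost F (F y) y v c l'"
      by (intro cost_ge_on_subspace c(1)) auto
    also have "\<dots> \<le> cost F (of_rat \<alpha>) w v' c l' + K * h"
      unfolding K_def
    proof (rule cost_perturb[OF _ T' _ _ _ c(2)])
      show "\<forall>z\<in>set l'. 0 < fst z" using elem by auto
    qed (use \<alpha> w v' in \<open>auto simp: norm_minus_commute\<close>)
    also have "\<dots> < blinfun_apply a v" using cost' \<rho>(2) Kh by simp
    finally show False by simp
  qed
  define Tc where "Tc = {(dir_sum y l - v, quot_sum F (F y) y l - blinfun_apply a v) |l v. adm l \<and> v \<in> Y}"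
  have Y0: "0 \<in> Y" using Y(1) by (rule subspace_0)
  obtain b :: "'a \<Rightarrow>\<^sub>L real" where b: "\<And>h r. (h, r) \<in> Tc \<Longrightarrow> blinfun_apply b h \<le> r"
  proof (rule functional_below_cone[of Tc c])
    show "(0, 0) \<in> Tc"
      unfolding Tc_def using Y0 by (auto intro!: exI[of _ "[]"] exI[of _ 0] simp: dir_sum_def quot_sum_def adm_def blinfun.zero_right)
    fix h r assume "(h, r) \<in> Tc"
    then obtain l v where l: "adm l" "v \<in> Y" and h: "h = dir_sum y l - v" and r: "r = quot_sum F (F y) y l - blinfun_apply a v"
      unfolding Tc_def by blast
    show "0 \<le> r + c * norm h"
      using key[OF l] by (simp add: h r cost_def norm_minus_commute)
    {
      fix k s assume "(k, s) \<in> Tc"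
      then obtain l' v' where l': "adm l'" "v' \<in> Y" and k: "k = dir_sum y l' - v'" and s: "s = quot_sum F (F y) y l' - blinfun_apply a v'"
        unfolding Tc_def by blast
      have "adm (l @ l')" using l l' by (auto simp: adm_def)
      moreover have "v + v' \<in> Y" using l l' Y(1) by (simp add: subspace_add)
      moreover have "h + k = dir_sum y (l @ l') - (v + v')" by (simp add: h k dir_sum_def)
      moreover have "r + s = quot_sum F (F y) y (l @ l') - blinfun_apply a (v + v')"
        by (simp add: r s quot_sum_def blinfun.add_right)
      ultimately show "(h + k, r + s) \<in> Tc" unfolding Tc_def by blast
    }
    {
      fix t :: real assume t: "0 < t"
      define l' where "l' = map (\<lambda>(s, n, u). (t * s, n, u)) l"
      have "adm l'" using l t by (auto simp: adm_def l'_def)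
      moreover have "t *\<^sub>R v \<in> Y" using l Y(1) by (simp add: subspace_scale)
      moreover have "dir_sum y l' = t *\<^sub>R dir_sum y l"
        unfolding l'_def dir_sum_def by (induction l) (auto simp: scaleR_add_right)
      moreover have "quot_sum F (F y) y l' = t * quot_sum F (F y) y l"
        unfolding l'_def quot_sum_def by (induction l) (auto simp: distrib_left simp del: of_nat_Suc)
      ultimately show "(t *\<^sub>R h, t * r) \<in> Tc"
        unfolding Tc_def by (auto intro!: exI[of _ l'] exI[of _ "t *\<^sub>R v"] simp: h r scaleR_diff_right right_diff_distrib blinfun.scaleR_right)
    }
  qed (use c(2) in auto)
  show ?thesis
  proof (rule that[of b])
    fix x assume x: "x \<in> Y"
    have le: "blinfun_apply b (- v) \<le> - blinfun_apply a v" if "v \<in> Y" for v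
    proof (rule b)
      show "(- v, - blinfun_apply a v) \<in> Tc"
        unfolding Tc_def using that by (auto intro!: exI[of _ "[]"] exI[of _ v] simp: dir_sum_def quot_sum_def adm_def)
    qed
    show "blinfun_apply b x = blinfun_apply a x"
      using le[OF x] le[of "- x"] x Y(1) by (simp add: subspace_neg blinfun.minus_right)
  next
    show "subgradient_on F S0 UNIV y b"
      unfolding subgradient_on_def
    proof (intro allI impI)
      fix e :: real assume "0 < e"
      then obtain n where n: "inverse (real (Suc n)) < e" using reals_Archimedean by blast
      show "\<exists>d>0. \<forall>h\<in>UNIV. norm h < d \<longrightarrow> y + h \<in> S0 \<longrightarrow> F y + blinfun_apply b h - e * norm h \<le> F (y + h)"
      proof (intro exI[of _ "dr n / 2"] conjI ballI impI)
        show "0 < dr n / 2" using dr0 by simp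
        fix h assume h: "norm h < dr n / 2" "y + h \<in> S0"
        have "(h, F (y + h) - F y + norm h / Suc n) \<in> Tc"
          unfolding Tc_def using h Y0
          by (auto intro!: exI[of _ "[(1, n, y + h)]"] exI[of _ 0] simp: dir_sum_def quot_sum_def adm_def blinfun.zero_right simp del: of_nat_Suc)
        then have "blinfun_apply b h \<le> F (y + h) - F y + norm h / Suc n" by (rule b)
        moreover have "norm h / Suc n \<le> e * norm h"
          using mult_right_mono[OF less_imp_le[OF n], of "norm h"] by (simp add: divide_inverse mult.commute del: of_nat_Suc)
        ultimately show "F y + blinfun_apply b h - e * norm h \<le> F (y + h)" by simp
      qed
    qed
  qed
qed

section \<open>Frechet and convex subgradients\<close>

text \<open>
  The loss of a factor \<open>2\<close> in the second implication absorbs the passage from a weak to a strict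
  inequality.
\<close>

lemma frechet_quotient_iff:
  fixes f :: ereal and c k n e :: real
  assumes "0 < n" "0 < e"
  shows "ereal (- e) < (f - ereal c - ereal k) / ereal n \<Longrightarrow> ereal (c + k - e * n) \<le> f"
    and "ereal (c + k - e / 2 * n) \<le> f \<Longrightarrow> ereal (- e) < (f - ereal c - ereal k) / ereal n"
proof -
  show "ereal (c + k - e * n) \<le> f" if "ereal (- e) < (f - ereal c - ereal k) / ereal n"
  proof (cases f)
    case (real r)
    then have "- e < (r - c - k) / n" using that assms by simp
    then have "- e * n < r - c - k" using assms by (simp add: pos_less_divide_eq)
    then show ?thesis using real by simp
  qed (use that assms in auto)
  show "ereal (- e) < (f - ereal c - ereal k) / ereal n" if "ereal (c + k - e / 2 * n) \<le> f"
  proof (cases f)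
    case (real r)
    then have "- (e / 2) * n \<le> r - c - k" using that by simp
    moreover have "0 < e / 2 * n" using assms by simp
    ultimately have "- e * n < r - c - k" by (simp add: algebra_simps)
    then have "- e < (r - c - k) / n" using assms by (simp add: pos_less_divide_eq)
    then show ?thesis using real assms by simp
  qed (use that assms in auto)
qed

lemma frechet_subdiff_iff:
  fixes f :: "'a::real_normed_vector \<Rightarrow> ereal"
  assumes fx: "f x = ereal c"
  shows "a \<in> frechet_subdiff f x \<longleftrightarrow>
    (\<forall>e>0. \<exists>d>0. \<forall>u. norm (u - x) < d \<longrightarrow> ereal (c + blinfun_apply a (u - x) - e * norm (u - x)) \<le> f u)"
    (is "_ \<longleftrightarrow> ?R")
proof -
  define Q where "Q u = (f u - f x - ereal (blinfun_apply a (u - x))) / ereal (norm (u - x))" for u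
  have mem: "a \<in> frechet_subdiff f x \<longleftrightarrow> (\<forall>y<0. eventually (\<lambda>u. y < Q u) (at x))"
    unfolding frechet_subdiff_def Q_def using fx by (simp add: le_Liminf_iff)
  show ?thesis
  proof
    assume "a \<in> frechet_subdiff f x"
    then have ev: "eventually (\<lambda>u. y < Q u) (at x)" if "y < 0" for y using mem that by blast
    show ?R
    proof (intro allI impI)
      fix e :: real assume e: "0 < e"
      have "eventually (\<lambda>u. ereal (- e) < Q u) (at x)" using e by (intro ev) simp
      then obtain d where d: "0 < d" "\<And>u. u \<noteq> x \<Longrightarrow> dist u x < d \<Longrightarrow> ereal (- e) < Q u"
        unfolding eventually_at by auto
      show "\<exists>d>0. \<forall>u. norm (u - x) < d \<longrightarrow> ereal (c + blinfun_apply a (u - x) - e * norm (u - x)) \<le> f u"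
      proof (intro exI[of _ d] conjI allI impI d(1))
        fix u assume u: "norm (u - x) < d"
        show "ereal (c + blinfun_apply a (u - x) - e * norm (u - x)) \<le> f u"
        proof (cases "u = x")
          case True
          then show ?thesis by (simp add: fx blinfun.zero_right)
        next
          case False
          then have "ereal (- e) < Q u" using d(2) u by (simp add: dist_norm)
          then show ?thesis using False e unfolding Q_def fx by (intro frechet_quotient_iff(1)) auto
        qed
      qed
    qed
  next
    assume R: ?R
    show "a \<in> frechet_subdiff f x"
      unfolding mem
    proof (intro allI impI)
      fix y :: ereal assume "y < 0"
      then obtain e where e: "0 < e" "y \<le> ereal (- e)"
      proof (cases y)
        case (real r)
        then show ?thesis using that[of "- r"] \<open>y < 0\<close> by simp
      next
        case MInf
        then show ?thesis using that[of 1] by simp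
      qed auto
      then obtain d where d: "0 < d"
        "\<forall>u. norm (u - x) < d \<longrightarrow> ereal (c + blinfun_apply a (u - x) - e / 2 * norm (u - x)) \<le> f u"
        using R half_gt_zero by blast
      show "eventually (\<lambda>u. y < Q u) (at x)"
        unfolding eventually_at
      proof (intro exI[of _ d] conjI ballI impI d(1))
        fix u assume u: "u \<noteq> x \<and> dist u x < d"
        have "ereal (- e) < Q u"
          using u e d(2) unfolding Q_def fx by (intro frechet_quotient_iff(2)) (auto simp: dist_norm)
        then show "y < Q u" using e(2) by simp
      qed
    qed
  qed
qed

lemma frechet_subdiff_of_subgradient_on:
  fixes f :: "'a::real_normed_vector \<Rightarrow> ereal"
  assumes nm: "\<And>u. f u \<noteq> -\<infinity>" and x: "f x \<noteq> \<infinity>"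
    and sub: "subgradient_on (\<lambda>u. real_of_ereal (f u)) {u. f u \<noteq> \<infinity>} UNIV x a"
  shows "a \<in> frechet_subdiff f x"
proof -
  have fr: "f u = ereal (real_of_ereal (f u))" if "f u \<noteq> \<infinity>" for u
    using that nm[of u] by (cases "f u") auto
  show ?thesis
    unfolding frechet_subdiff_iff[where f=f and x=x and c="real_of_ereal (f x)", OF fr[OF x]]
  proof (intro allI impI)
    fix e :: real assume "0 < e"
    then obtain d where d: "0 < d" "\<forall>h\<in>UNIV. norm h < d \<longrightarrow> x + h \<in> {u. f u \<noteq> \<infinity>} \<longrightarrow>
        real_of_ereal (f x) + blinfun_apply a h - e * norm h \<le> real_of_ereal (f (x + h))"
      using sub unfolding subgradient_on_def by blast
    show "\<exists>d>0. \<forall>u. norm (u - x) < d \<longrightarrow> ereal (real_of_ereal (f x) + blinfun_apply a (u - x) - e * norm (u - x)) \<le> f u"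
    proof (intro exI[of _ d] conjI allI impI d(1))
      fix u assume u: "norm (u - x) < d"
      show "ereal (real_of_ereal (f x) + blinfun_apply a (u - x) - e * norm (u - x)) \<le> f u"
      proof (cases "f u = \<infinity>")
        case False
        then have "real_of_ereal (f x) + blinfun_apply a (u - x) - e * norm (u - x) \<le> real_of_ereal (f u)"
          using d(2)[rule_format, of "u - x"] u by simp
        then show ?thesis using fr[OF False] by (metis ereal_less_eq(3))
      qed simp
    qed
  qed
qed

text \<open>
  For a convex function a local first-order lower bound is global: move from \<open>z\<close> a short way towards
  \<open>u\<close> and compare with the chord.
\<close>

lemma fenchel_of_subgradient_on:
  fixes g :: "'a::real_normed_vector \<Rightarrow> real"
  assumes cv: "convex_on UNIV g" and sub: "subgradient_on g UNIV UNIV z b"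
  shows "b \<in> fenchel_subdiff g z"
  unfolding fenchel_subdiff_def
proof (intro CollectI allI)
  fix u
  show "g z + blinfun_apply b (u - z) \<le> g u"
  proof (rule field_le_epsilon)
    fix e :: real assume e: "0 < e"
    define k where "k = e / (norm (u - z) + 1)"
    have n1: "0 < norm (u - z) + 1" using norm_ge_zero[of "u - z"] by linarith
    have k: "0 < k" using e n1 by (simp add: k_def)
    then obtain d where d: "0 < d" "\<And>h. norm h < d \<Longrightarrow> g z + blinfun_apply b h - k * norm h \<le> g (z + h)"
      using sub unfolding subgradient_on_def by auto
    define t where "t = min (1/2) (d / 2 / (norm (u - z) + 1))"
    have t: "0 < t" "t < 1" using d n1 by (auto simp: t_def)
    have "t * norm (u - z) \<le> d / 2 / (norm (u - z) + 1) * norm (u - z)"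
      by (intro mult_right_mono) (auto simp: t_def)
    also have "\<dots> \<le> d / 2" using d n1 by (simp add: field_simps)
    finally have "norm (t *\<^sub>R (u - z)) < d" using t d by simp
    from d(2)[OF this] have "g z + t * blinfun_apply b (u - z) - k * (t * norm (u - z)) \<le> g (z + t *\<^sub>R (u - z))"
      using t by (simp add: blinfun.scaleR_right)
    also have "z + t *\<^sub>R (u - z) = (1 - t) *\<^sub>R z + t *\<^sub>R u" by (simp add: algebra_simps)
    also have "g \<dots> \<le> (1 - t) * g z + t * g u"
      using convex_onD[OF cv, of t z u] t by simp
    finally have "t * (g z + blinfun_apply b (u - z)) \<le> t * (g u + k * norm (u - z))"
      by (simp add: algebra_simps)
    then have "g z + blinfun_apply b (u - z) \<le> g u + k * norm (u - z)" using t by simp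
    moreover have "k * norm (u - z) \<le> k * (norm (u - z) + 1)" using k by (intro mult_left_mono) auto
    moreover have "k * (norm (u - z) + 1) = e" using n1 by (simp add: k_def)
    ultimately show "g z + blinfun_apply b (u - z) \<le> g u + e" by linarith
  qed
qed

text \<open>
  If \<open>g\<close> varies by less than \<open>1\<close> from \<open>g x\<close> on a ball of radius \<open>3 * r\<close>, extend the segment from \<open>u\<close> to \<open>v\<close>
  beyond \<open>v\<close> by the length \<open>r\<close> and use the three-chord inequality.
\<close>

lemma convex_continuous_locally_lipschitz:
  fixes g :: "'a::real_normed_vector \<Rightarrow> real"
  assumes cv: "convex_on UNIV g" and ct: "continuous_on UNIV g"
  obtains r L where "0 < r" "0 \<le> L"
    "\<And>u v. norm (u - x) \<le> r \<Longrightarrow> norm (v - x) \<le> r \<Longrightarrow> \<bar>g u - g v\<bar> \<le> L * norm (u - v)"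
proof -
  obtain d where d: "0 < d" "\<And>u. dist u x < d \<Longrightarrow> dist (g u) (g x) < 1"
    using ct unfolding continuous_on_iff by (metis UNIV_I zero_less_one)
  define r where "r = d / 3"
  have r: "0 < r" using d by (simp add: r_def)
  have one: "g v - g u \<le> 2 / r * norm (u - v)" if u: "norm (u - x) \<le> r" and v: "norm (v - x) \<le> r" for u v
  proof (cases "u = v")
    case True
    then show ?thesis by simp
  next
    case False
    define m where "m = norm (v - u)"
    have m: "0 < m" using False by (simp add: m_def)
    define w where "w = v + (r / m) *\<^sub>R (v - u)"
    define s where "s = m / (m + r)"
    have s: "0 < s" "s < 1" using m r by (auto simp: s_def)
    have "norm (w - x) \<le> norm (v - x) + norm ((r / m) *\<^sub>R (v - u))"
      unfolding w_def by (metis add_diff_eq diff_add_eq norm_triangle_ineq)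
    also have "norm ((r / m) *\<^sub>R (v - u)) = r" using m r by (simp add: m_def)
    finally have "norm (w - x) < d" using v d by (simp add: r_def)
    then have gw: "\<bar>g w - g x\<bar> < 1" using d(2)[of w] by (simp add: dist_norm)
    have gu: "\<bar>g u - g x\<bar> < 1" using d(2)[of u] u d(1) by (simp add: dist_norm r_def)
    have "1 + r / m = (m + r) / m" "m + r \<noteq> 0" using m r by (simp_all add: add_divide_distrib)
    then have "s * (1 + r / m) = 1" using m by (simp add: s_def)
    then have "v = (1 - s) *\<^sub>R u + s *\<^sub>R w"
      unfolding w_def by (simp add: algebra_simps flip: scaleR_add_left)
    then have "g v \<le> (1 - s) * g u + s * g w" using convex_onD[OF cv, of s u w] s by simp
    then have "g v - g u \<le> s * (g w - g u)" by (simp add: algebra_simps)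
    also have "\<dots> \<le> s * 2" using gw gu s by (intro mult_left_mono) auto
    also have "\<dots> \<le> m / r * 2" using m r by (intro mult_right_mono) (auto simp: s_def intro: divide_left_mono)
    finally show ?thesis by (simp add: m_def norm_minus_commute mult.commute[of _ 2])
  qed
  show ?thesis
  proof (rule that[of r "2 / r"])
    fix u v assume "norm (u - x) \<le> r" "norm (v - x) \<le> r"
    then show "\<bar>g u - g v\<bar> \<le> 2 / r * norm (u - v)" using one[of u v] one[of v u] by (simp add: abs_le_iff norm_minus_commute)
  qed (use r in auto)
qed

lemma lsc_sublevel_closed:
  fixes f :: "'a::real_normed_vector \<Rightarrow> ereal"
  assumes lsc: "lsc_at f z" and s: "s \<longlonglongrightarrow> z" and le: "\<And>n. f (s n) \<le> a"
  shows "f z \<le> a"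
proof (rule ccontr)
  assume n: "\<not> f z \<le> a"
  then have "a < Liminf (at z) f" using lsc unfolding lsc_at_def by (meson less_le_trans not_le)
  then have "eventually (\<lambda>u. a < f u) (at z)" using le_Liminf_iff[of "Liminf (at z) f" "at z" f] by blast
  then have "eventually (\<lambda>u. u \<noteq> z \<longrightarrow> a < f u) (nhds z)" by (simp add: eventually_at_filter)
  then have "eventually (\<lambda>u. a < f u) (nhds z)"
    by (rule eventually_mono) (use n in auto)
  then have "eventually (\<lambda>n. a < f (s n)) sequentially" using s by (rule eventually_compose_filterlim)
  then obtain n where "a < f (s n)" by (metis eventually_sequentially order_refl)
  then show False using le[of n] by simp
qed

section \<open>Outer limits\<close>

text \<open>
  A base of weak-star neighbourhoods is indexed by finite sets of vectors and tolerances, which serves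
  as the directed set of the required net.
\<close>

lemma outer_limit_criterion:
  fixes D :: "('a::real_normed_vector \<Rightarrow> ereal) \<Rightarrow> 'a \<Rightarrow> ('a \<Rightarrow>\<^sub>L real) set"
  assumes fx: "f x = ereal c"
    and ex: "\<And>Ls e. finite Ls \<Longrightarrow> 0 < e \<Longrightarrow> \<exists>y ys. ys \<in> D f y \<and> norm (y - x) < e \<and> ereal (c - e) \<le> f y \<and> f y \<le> ereal (c + e) \<and>
      (\<forall>h\<in>Ls. \<bar>blinfun_apply ys h - blinfun_apply xs h\<bar> < e)"
  shows "xs \<in> outer_limit D f x"
proof -
  define I where "I = {L :: 'a set. finite L} \<times> (UNIV :: nat set)"
  define ge where "ge = (\<lambda>i j :: 'a set \<times> nat. fst i \<subseteq> fst j \<and> snd i \<le> snd j)"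
  have "\<exists>p. snd p \<in> D f (fst p) \<and> norm (fst p - x) < 1 / Suc (snd i) \<and> ereal (c - 1 / Suc (snd i)) \<le> f (fst p) \<and>
      f (fst p) \<le> ereal (c + 1 / Suc (snd i)) \<and> (\<forall>h\<in>fst i. \<bar>blinfun_apply (snd p) h - blinfun_apply xs h\<bar> < 1 / Suc (snd i))"
    if "i \<in> I" for i
    using ex[of "fst i" "1 / Suc (snd i)"] that by (auto simp: I_def)
  then obtain p where p: "\<And>i. i \<in> I \<Longrightarrow> snd (p i) \<in> D f (fst (p i)) \<and> norm (fst (p i) - x) < 1 / Suc (snd i) \<and>
      ereal (c - 1 / Suc (snd i)) \<le> f (fst (p i)) \<and> f (fst (p i)) \<le> ereal (c + 1 / Suc (snd i)) \<and>
      (\<forall>h\<in>fst i. \<bar>blinfun_apply (snd (p i)) h - blinfun_apply xs h\<bar> < 1 / Suc (snd i))" by metis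
  have dir: "directed_set I ge"
    unfolding directed_set_def
  proof (intro conjI ballI)
    show "I \<noteq> {}" by (auto simp: I_def)
    show "reflp_on I ge" "transp_on I ge" by (auto simp: ge_def reflp_on_def transp_on_def)
    fix i j assume "i \<in> I" "j \<in> I"
    then show "\<exists>k\<in>I. ge i k \<and> ge j k"
      by (intro bexI[of _ "(fst i \<union> fst j, max (snd i) (snd j))"]) (auto simp: I_def ge_def)
  qed
  have small: "eventually (\<lambda>i. i \<in> I \<and> H \<subseteq> fst i \<and> 1 / real (Suc (snd i)) < e) (net_filter I ge)" if e0: "0 < e" and H: "finite H" for e H
  proof -
    obtain n where n: "inverse (real (Suc n)) < e" using reals_Archimedean[OF e0] by blast
    have "1 / real (Suc m) < e" if "n \<le> m" for m
    proof -
      have "1 / real (Suc m) \<le> 1 / real (Suc n)" using that by (intro divide_left_mono) auto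
      then show ?thesis using n by (simp add: inverse_eq_divide)
    qed
    then show ?thesis
      unfolding eventually_net_filter[OF dir] using H by (intro bexI[of _ "(H, n)"]) (auto simp: I_def ge_def)
  qed
  have "outer_limit_net D f x xs I ge (\<lambda>i. fst (p i)) (\<lambda>i. snd (p i))"
    unfolding outer_limit_net_def
  proof (intro conjI ballI dir)
    show "snd (p i) \<in> D f (fst (p i))" if "i \<in> I" for i using p[OF that] by simp
    show "((\<lambda>i. fst (p i)) \<longlongrightarrow> x) (net_filter I ge)"
    proof (rule tendstoI)
      fix e :: real assume "0 < e"
      then show "eventually (\<lambda>i. dist (fst (p i)) x < e) (net_filter I ge)"
        by (rule eventually_mono[OF small[OF _ finite.emptyI]]) (use p in \<open>force simp: dist_norm\<close>)
    qed
    show "limitin weak_star_topology (\<lambda>i. snd (p i)) xs (net_filter I ge)"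
      unfolding limitin_weak_star_iff
    proof
      fix u
      show "((\<lambda>i. blinfun_apply (snd (p i)) u) \<longlongrightarrow> blinfun_apply xs u) (net_filter I ge)"
      proof (rule tendstoI)
        fix e :: real assume "0 < e"
        then show "eventually (\<lambda>i. dist (blinfun_apply (snd (p i)) u) (blinfun_apply xs u) < e) (net_filter I ge)"
          by (rule eventually_mono[OF small[of _ "{u}"]]) (use p in \<open>force simp: dist_real_def\<close>)+
      qed
    qed
    show "((\<lambda>i. f (fst (p i))) \<longlongrightarrow> f x) (net_filter I ge)"
      unfolding fx
    proof (rule order_tendstoI)
      fix b assume b: "b < ereal c"
      then obtain r where r: "b < ereal r" "r < c" using ereal_dense2[of b "ereal c"] by auto
      have "eventually (\<lambda>i. i \<in> I \<and> {} \<subseteq> fst i \<and> 1 / real (Suc (snd i)) < c - r) (net_filter I ge)"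
        using r by (intro small) auto
      then show "eventually (\<lambda>i. b < f (fst (p i))) (net_filter I ge)"
      proof eventually_elim
        case (elim i)
        then have "ereal r < ereal (c - 1 / real (Suc (snd i)))" by simp
        also have "\<dots> \<le> f (fst (p i))" using p elim by blast
        finally show ?case using r(1) by simp
      qed
    next
      fix b assume b: "ereal c < b"
      then obtain r where r: "ereal r < b" "c < r" using ereal_dense2[of "ereal c" b] by auto
      have "eventually (\<lambda>i. i \<in> I \<and> {} \<subseteq> fst i \<and> 1 / real (Suc (snd i)) < r - c) (net_filter I ge)"
        using r by (intro small) auto
      then show "eventually (\<lambda>i. f (fst (p i)) < b) (net_filter I ge)"
      proof eventually_elim
        case (elim i)
        have "f (fst (p i)) \<le> ereal (c + 1 / real (Suc (snd i)))" using p elim by blast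
        also have "\<dots> < ereal r" using elim by simp
        finally show ?case using r(1) by simp
      qed
    qed
  qed
  then show ?thesis by (rule outer_limitI)
qed

lemma outer_limit_approx:
  assumes xs: "xs \<in> outer_limit D f x" and fx: "f x = ereal c" and Ls: "finite Ls" and e: "0 < e"
  obtains y ys where "ys \<in> D f y" "norm (y - x) < e" "ereal (c - e) < f y" "f y < ereal (c + e)"
    "\<And>h. h \<in> Ls \<Longrightarrow> \<bar>blinfun_apply ys h - blinfun_apply xs h\<bar> < e"
proof -
  obtain I :: "('a \<times> ('a \<Rightarrow>\<^sub>L real)) set set" and le y ys where net: "outer_limit_net D f x xs I le y ys"
    using xs unfolding outer_limit_def by blast
  define F where "F = net_filter I le"
  have dir: "directed_set I le" and D: "\<And>i. i \<in> I \<Longrightarrow> ys i \<in> D f (y i)" and y: "(y \<longlongrightarrow> x) F"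
    and ysl: "limitin weak_star_topology ys xs F" and fy: "((\<lambda>i. f (y i)) \<longlongrightarrow> f x) F"
    using net by (auto simp: outer_limit_net_def F_def)
  have 1: "eventually (\<lambda>i. dist (y i) x < e) F" using y e by (rule tendstoD)
  have 2: "eventually (\<lambda>i. ereal (c - e) < f (y i)) F" "eventually (\<lambda>i. f (y i) < ereal (c + e)) F"
    using order_tendstoD[OF fy, of "ereal (c - e)"] order_tendstoD[OF fy, of "ereal (c + e)"] e by (auto simp: fx)
  have 3: "eventually (\<lambda>i. \<forall>h\<in>Ls. dist (blinfun_apply (ys i) h) (blinfun_apply xs h) < e) F"
    using ysl e by (intro eventually_ball_finite Ls ballI) (auto simp: limitin_weak_star_iff intro: tendstoD)
  have "eventually (\<lambda>i. dist (y i) x < e \<and> (ereal (c - e) < f (y i) \<and> f (y i) < ereal (c + e)) \<and>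
      (\<forall>h\<in>Ls. dist (blinfun_apply (ys i) h) (blinfun_apply xs h) < e)) F"
    using 1 2 3 by (intro eventually_conj)
  then obtain i where i: "i \<in> I" "\<And>j. j \<in> I \<Longrightarrow> le i j \<Longrightarrow> dist (y j) x < e \<and> (ereal (c - e) < f (y j) \<and> f (y j) < ereal (c + e)) \<and>
      (\<forall>h\<in>Ls. dist (blinfun_apply (ys j) h) (blinfun_apply xs h) < e)"
    unfolding F_def eventually_net_filter[OF dir] by blast
  have "le i i" using i(1) dir by (auto simp: directed_set_def dest: reflp_onD)
  from i(2)[OF i(1) this] show ?thesis
    using D[OF i(1)] by (intro that[of "ys i" "y i"]) (auto simp: dist_norm dist_real_def)
qed

section \<open>The Frechet subdifferential in Asplund spaces\<close>

text \<open>
  The separable subspace \<open>Y\<close> contains \<open>x\<close> and \<open>Ls\<close> and reflects both \<open>f\<close> and \<open>g\<close>. The subgradients found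
  along \<open>Y\<close> extend to the whole space without changing on \<open>Ls\<close>. For \<open>g\<close> the extension is a Frechet
  subgradient of a convex function, hence a subgradient in the sense of convex analysis.
\<close>

lemma asplund_weak_fuzzy_sum:
  fixes f :: "'a::real_normed_vector \<Rightarrow> ereal" and g :: "'a \<Rightarrow> real"
  assumes asp: "asplund_space TYPE('a)" and f: "proper f" "lsc f"
    and g: "convex_on UNIV g" "continuous_on UNIV g" and fx: "\<bar>f x\<bar> \<noteq> \<infinity>"
    and min: "eventually (\<lambda>u. f x + ereal (g x) \<le> f u + ereal (g u)) (nhds x)"
    and Ls: "finite Ls" and e: "0 < e"
  obtains y z a b where "f y \<noteq> \<infinity>" "norm (y - x) < e" "norm (z - x) < e" "\<bar>real_of_ereal (f y) - real_of_ereal (f x)\<bar> < e"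
    "a \<in> frechet_subdiff f y" "b \<in> fenchel_subdiff g z" "\<forall>h\<in>Ls. \<bar>blinfun_apply a h + blinfun_apply b h\<bar> \<le> e"
proof -
  define F where "F u = real_of_ereal (f u)" for u
  define S0 where "S0 = {u. f u \<noteq> \<infinity>}"
  have nm: "f u \<noteq> -\<infinity>" for u using f(1) by (simp add: proper_def)
  have fF: "f u = ereal (F u)" if "u \<in> S0" for u
    using that nm[of u] unfolding F_def S0_def by (cases "f u") auto
  have xS0: "x \<in> S0" using fx by (auto simp: S0_def)
  obtain C where C: "countable C" "insert x Ls \<subseteq> C" and rF: "reflects F S0 C" and rg: "reflects g UNIV C"
    and comb: "\<And>x y r s. x \<in> C \<Longrightarrow> y \<in> C \<Longrightarrow> of_rat r *\<^sub>R x + of_rat s *\<^sub>R y \<in> C"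
    by (rule ex_reflecting_set[of "insert x Ls" F S0 g UNIV]) (use Ls in \<open>auto intro: countable_finite\<close>)
  have Cne: "C \<noteq> {}" using C(2) by blast
  define Y where "Y = closure C"
  have Y: "subspace Y" unfolding Y_def by (rule subspace_closure_rational[OF Cne comb])
  have CY: "C \<subseteq> Y" unfolding Y_def by (rule closure_subset)
  obtain D :: "('a \<Rightarrow>\<^sub>L real) set" where D: "countable D"
    "\<And>a e. 0 < e \<Longrightarrow> \<exists>d\<in>D. \<forall>y\<in>Y. \<bar>blinfun_apply a y - blinfun_apply d y\<bar> \<le> e * norm y"
    by (rule asplund_separable_dual[OF asp C(1) CY]) (simp_all add: Y_def)
  have Dne: "D \<noteq> {}" using D(2)[of 1 0] by auto
  have rC: "range (from_nat_into C) = C" and rD: "range (from_nat_into D) = D"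
    using Cne Dne C(1) D(1) by (auto intro: range_from_nat_into)
  interpret separable_dual_subspace Y "from_nat_into C" "from_nat_into D"
  proof
    show "subspace Y" by (rule Y)
    show "from_nat_into C k \<in> Y" for k using rC CY by blast
    show "Y \<subseteq> closure (range (from_nat_into C))" by (simp add: rC Y_def)
    show "\<exists>n. \<forall>y\<in>Y. \<bar>blinfun_apply a y - blinfun_apply (from_nat_into D n) y\<bar> \<le> e * norm y" if e0: "0 < e" for e a
    proof -
      obtain d where d: "d \<in> D" "\<forall>y\<in>Y. \<bar>blinfun_apply a y - blinfun_apply d y\<bar> \<le> e * norm y" using D(2)[OF e0] by blast
      then obtain n where "d = from_nat_into D n" using rD by (metis imageE)
      then show ?thesis using d(2) by blast
    qed
  qed
  obtain r1 where r1: "0 < r1" "\<And>u. dist u x < r1 \<Longrightarrow> f x + ereal (g x) \<le> f u + ereal (g u)"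
    using min unfolding eventually_nhds_metric by blast
  obtain r2 L where r2: "0 < r2" "0 \<le> L" and lip: "\<And>u v. norm (u - x) \<le> r2 \<Longrightarrow> norm (v - x) \<le> r2 \<Longrightarrow> \<bar>g u - g v\<bar> \<le> L * norm (u - v)"
    by (rule convex_continuous_locally_lipschitz[OF g, of x]) blast
  define r where "r = min (r1 / 2) r2"
  have r: "0 < r" "r < r1" "r \<le> r2" using r1 r2 by (auto simp: r_def)
  define m where "m = 1 + (\<Sum>h\<in>Ls. norm h)"
  have m1: "1 \<le> m" unfolding m_def by (simp add: sum_nonneg)
  define e' where "e' = e / m"
  have e': "0 < e'" "e' \<le> e" using e m1 by (auto simp: e'_def divide_le_eq mult_le_cancel_left1)
  have compl: "complete (UNIV :: 'a set)" using asp by (simp add: asplund_space_def)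
  obtain y z a b where yz: "y \<in> Y" "y \<in> S0" "z \<in> Y" "norm (y - x) < e'" "norm (z - x) < e'" "\<bar>F y - F x\<bar> < e'"
    and sub: "subgradient_on F S0 Y y a" "subgradient_on g UNIV Y z b" and ab: "norm (a + b) \<le> e'"
  proof (rule fuzzy_sum_on_subspace[OF compl, of S0 F x r g L e'])
    show "closed Y" by (simp add: Y_def)
    show "x \<in> Y" using C(2) CY by blast
    show "u \<in> S0 \<and> F u \<le> c" if s: "\<forall>n. s n \<in> S0" "s \<longlonglongrightarrow> u" "\<forall>n. F (s n) \<le> c" for s u c
    proof -
      have "f u \<le> ereal c"
      proof (rule lsc_sublevel_closed[OF _ s(2)])
        show "lsc_at f u" using f(2) by (simp add: lsc_def)
        show "f (s n) \<le> ereal c" for n using fF[of "s n"] s by simp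
      qed
      then have "u \<in> S0" by (auto simp: S0_def)
      then show ?thesis using \<open>f u \<le> ereal c\<close> fF[of u] by simp
    qed
    show "F x + g x \<le> F u + g u" if "u \<in> S0" "norm (u - x) \<le> r" for u
      using r1(2)[of u] that r(2) fF[OF xS0] fF[of u] by (simp add: dist_norm)
    show "\<bar>g u - g v\<bar> \<le> L * norm (u - v)" if "norm (u - x) \<le> r" "norm (v - x) \<le> r" for u v
      using that r(3) by (intro lip) auto
  qed (use xS0 r r2 e' in auto)
  obtain a' where a': "\<And>x. x \<in> Y \<Longrightarrow> blinfun_apply a' x = blinfun_apply a x" "subgradient_on F S0 UNIV y a'"
    by (rule subgradient_extension[OF rF Y Y_def yz(1,2) sub(1)]) blast
  obtain b' where b': "\<And>x. x \<in> Y \<Longrightarrow> blinfun_apply b' x = blinfun_apply b x" "subgradient_on g UNIV UNIV z b'"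
    by (rule subgradient_extension[OF rg Y Y_def yz(3) UNIV_I sub(2)]) blast
  show ?thesis
  proof (rule that[of y z a' b'])
    show "f y \<noteq> \<infinity>" using yz(2) by (simp add: S0_def)
    show "a' \<in> frechet_subdiff f y"
      using a'(2) yz(2) by (intro frechet_subdiff_of_subgradient_on nm) (simp_all add: S0_def F_def[abs_def])
    show "b' \<in> fenchel_subdiff g z" by (rule fenchel_of_subgradient_on[OF g(1) b'(2)])
    show "\<forall>h\<in>Ls. \<bar>blinfun_apply a' h + blinfun_apply b' h\<bar> \<le> e"
    proof
      fix h assume h: "h \<in> Ls"
      have "blinfun_apply a' h + blinfun_apply b' h = blinfun_apply (a + b) h"
        using a'(1)[of h] b'(1)[of h] h C(2) CY by (auto simp: plus_blinfun.rep_eq)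
      also have "\<bar>\<dots>\<bar> \<le> norm (a + b) * norm h" using norm_blinfun[of "a + b" h] by simp
      also have "\<dots> \<le> e' * m"
      proof (rule mult_mono[OF ab])
        show "norm h \<le> m" unfolding m_def using member_le_sum[OF h, of norm] Ls by simp
      qed (use e' in auto)
      also have "e' * m = e" using m1 by (simp add: e'_def)
      finally show "\<bar>blinfun_apply a' h + blinfun_apply b' h\<bar> \<le> e" .
    qed
  qed (use yz e' in \<open>auto simp: F_def\<close>)
qed

text \<open>
  A Lipschitz bound for \<open>g - l\<close> near \<open>z\<close> bounds the distance of the subgradients of \<open>g\<close> at \<open>z\<close> from \<open>l\<close>.
\<close>

lemma fenchel_subdiff_norm_le:
  fixes g :: "'a::real_normed_vector \<Rightarrow> real"
  assumes b: "b \<in> fenchel_subdiff g z" and r: "0 < r" and L: "0 \<le> L"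
    and lip: "\<And>h. norm h \<le> r \<Longrightarrow> g (z + h) - g z \<le> blinfun_apply l h + L * norm h"
  shows "norm (b - l) \<le> L"
proof (rule norm_blinfun_bound[OF L])
  have one: "blinfun_apply (b - l) h \<le> L * norm h" for h
  proof (cases "h = 0")
    case False
    define t where "t = r / norm h"
    have t: "0 < t" using False r by (simp add: t_def)
    have n: "norm (t *\<^sub>R h) = r" using False r by (simp add: t_def)
    have "g z + blinfun_apply b (t *\<^sub>R h) \<le> g (z + t *\<^sub>R h)"
      using b by (simp add: fenchel_subdiff_def spec[of _ "z + t *\<^sub>R h"])
        (metis add_diff_cancel_left')
    moreover have "g (z + t *\<^sub>R h) - g z \<le> blinfun_apply l (t *\<^sub>R h) + L * norm (t *\<^sub>R h)"
      using n by (intro lip) simp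
    ultimately have "blinfun_apply b (t *\<^sub>R h) - blinfun_apply l (t *\<^sub>R h) \<le> L * norm (t *\<^sub>R h)" by simp
    then have "t * blinfun_apply (b - l) h \<le> t * (L * norm h)"
      using t by (simp add: blinfun.scaleR_right minus_blinfun.rep_eq right_diff_distrib mult.left_commute)
    then show ?thesis using t by simp
  qed (simp add: blinfun.zero_right)
  show "norm (blinfun_apply (b - l) h) \<le> L * norm h" for h
    using one[of h] one[of "- h"] by (simp add: blinfun.minus_right abs_le_iff)
qed

text \<open>
  Each finite set \<open>Ls\<close> and each tolerance give a pair of subgradients with small sum on \<open>Ls\<close>. The
  subgradients \<open>b\<close> of \<open>g\<close> are bounded by the local Lipschitz constant, so by weak-star compactness they
  have a cluster point \<open>\<beta>\<close>. It is a subgradient of \<open>g\<close> at \<open>x\<close>, and \<open>- \<beta>\<close> is a weak-star limit of Frechet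
  subgradients of \<open>f\<close>.
\<close>

theorem asplund_abstract_subdifferential:
  assumes asp: "asplund_space TYPE('a::real_normed_vector)"
  shows "abstract_subdifferential_on (frechet_subdiff :: ('a \<Rightarrow> ereal) \<Rightarrow> 'a \<Rightarrow> ('a \<Rightarrow>\<^sub>L real) set) {h. proper h \<and> lsc h}"
  unfolding abstract_subdifferential_on_def
proof (intro ballI allI impI, elim conjE)
  fix f :: "'a \<Rightarrow> ereal" and g :: "'a \<Rightarrow> real" and x :: 'a
  assume f: "f \<in> {h. proper h \<and> lsc h}" and g: "convex_on UNIV g" "continuous_on UNIV g" and fx: "\<bar>f x\<bar> \<noteq> \<infinity>"
    and min: "eventually (\<lambda>u. f x + ereal (g x) \<le> f u + ereal (g u)) (nhds x)"
  have f': "proper f" "lsc f" using f by auto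
  define c where "c = real_of_ereal (f x)"
  have c: "f x = ereal c" using fx by (cases "f x") (auto simp: c_def)
  have nm: "f u \<noteq> -\<infinity>" for u using f' by (simp add: proper_def)
  obtain r L where r: "0 < r" and L: "0 \<le> L"
    and lip: "\<And>u v. norm (u - x) \<le> r \<Longrightarrow> norm (v - x) \<le> r \<Longrightarrow> \<bar>g u - g v\<bar> \<le> L * norm (u - v)"
    by (rule convex_continuous_locally_lipschitz[OF g, of x]) blast
  define I where "I = {Ls :: 'a set. finite Ls} \<times> (UNIV :: nat set)"
  (* The bound r / 2 keeps all points in the ball on which g is Lipschitz. *)
  define eps where "eps n = min (r / 2) (1 / Suc n)" for n :: nat
  have eps: "0 < eps n" "eps n \<le> r / 2" "eps n \<le> 1 / Suc n" for n using r by (auto simp: eps_def)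
  define ok where "ok i y z a b \<longleftrightarrow> f y \<noteq> \<infinity> \<and> norm (y - x) < eps (snd i) \<and> norm (z - x) < eps (snd i) \<and>
      \<bar>real_of_ereal (f y) - real_of_ereal (f x)\<bar> < eps (snd i) \<and> a \<in> frechet_subdiff f y \<and> b \<in> fenchel_subdiff g z \<and>
      (\<forall>h\<in>fst i. \<bar>blinfun_apply a h + blinfun_apply b h\<bar> \<le> eps (snd i))" for i y z a b
  have "\<exists>y z a b. ok i y z a b" if i: "i \<in> I" for i
  proof -
    have "finite (fst i)" using i by (auto simp: I_def)
    then show ?thesis
      unfolding ok_def by (rule asplund_weak_fuzzy_sum[OF asp f' g fx min _ eps(1)[of "snd i"]]) blast
  qed
  then obtain y z a b where ok: "\<And>i. i \<in> I \<Longrightarrow> ok i (y i) (z i) (a i) (b i)" by metis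
  have bL: "norm (b i) \<le> L" if "i \<in> I" for i
  proof -
    have "norm (b i - 0) \<le> L"
    proof (rule fenchel_subdiff_norm_le[of _ g "z i" "r / 2"])
      show "b i \<in> fenchel_subdiff g (z i)" using ok[OF that] by (simp add: ok_def)
      fix h :: 'a assume h: "norm h \<le> r / 2"
      have zi: "norm (z i - x) < r / 2" using ok[OF that] eps(2)[of "snd i"] by (simp add: ok_def)
      have "norm (z i + h - x) \<le> r" using norm_triangle_ineq[of "z i - x" h] zi h by (simp add: algebra_simps)
      then have "\<bar>g (z i + h) - g (z i)\<bar> \<le> L * norm (z i + h - z i)" using zi r by (intro lip) auto
      then show "g (z i + h) - g (z i) \<le> blinfun_apply 0 h + L * norm h" by (simp add: abs_le_iff)
    qed (use r L in auto)
    then show ?thesis by simp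
  qed
  define tail where "tail i = {blinfun_apply (b j) |j. j \<in> I \<and> fst i \<subseteq> fst j \<and> snd i \<le> snd j}" for i
  have "dual_ball L \<inter> (\<Inter>i\<in>I. closure (tail i)) \<noteq> {}"
  proof (rule compact_imp_fip_image[OF compact_dual_ball])
    fix J assume J: "finite J" "J \<subseteq> I"
    define j where "j = (\<Union>(fst ` J), Max (insert 0 (snd ` J)))"
    have jI: "j \<in> I" using J by (auto simp: j_def I_def)
    have "blinfun_apply (b j) \<in> tail i" if "i \<in> J" for i
    proof -
      have "fst i \<subseteq> fst j" "snd i \<le> snd j" using that J(1) by (auto simp: j_def)
      then show ?thesis unfolding tail_def using jI by blast
    qed
    then have "blinfun_apply (b j) \<in> (\<Inter>i\<in>J. closure (tail i))" using closure_subset by blast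
    moreover have "blinfun_apply (b j) \<in> dual_ball L" using bL[OF jI] by (rule blinfun_mem_dual_ball)
    ultimately show "dual_ball L \<inter> (\<Inter>i\<in>J. closure (tail i)) \<noteq> {}" by blast
  qed auto
  then obtain \<phi> where \<phi>: "\<phi> \<in> dual_ball L" "\<And>i. i \<in> I \<Longrightarrow> \<phi> \<in> closure (tail i)" by blast
  obtain \<beta> where \<beta>: "blinfun_apply \<beta> = \<phi>" using dual_ball_blinfun[OF \<phi>(1) L] by blast
  have approx: "\<exists>j\<in>I. Ls \<subseteq> fst j \<and> n \<le> snd j \<and> (\<forall>h\<in>Ls. \<bar>blinfun_apply (b j) h - blinfun_apply \<beta> h\<bar> < e)"
    if Ls: "finite Ls" and e: "0 < e" for Ls n e
  proof -
    define U where "U = {\<psi> :: 'a \<Rightarrow> real. \<forall>h\<in>Ls. \<psi> h \<in> ball (\<phi> h) e}"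
    have "open U"
    proof -
      have "open {\<psi> :: 'a \<Rightarrow> real. \<psi> (id h) \<in> ball (\<phi> h) e}" for h
        using open_vimage[OF open_ball[of "\<phi> h" e] continuous_on_product_coordinates[of h]] by (simp add: vimage_def)
      moreover have "U = (\<Inter>h\<in>Ls. {\<psi>. \<psi> (id h) \<in> ball (\<phi> h) e})" by (auto simp: U_def)
      ultimately show ?thesis using Ls by (simp only:) (intro open_INT ballI, auto)
    qed
    moreover have "\<phi> \<in> U" using e by (simp add: U_def)
    moreover have "\<phi> \<in> closure (tail (Ls, n))" using Ls by (intro \<phi>(2)) (simp add: I_def)
    ultimately have "U \<inter> tail (Ls, n) \<noteq> {}" using open_Int_closure_eq_empty[of U "tail (Ls, n)"] by blast
    then obtain j where j: "j \<in> I" "Ls \<subseteq> fst j" "n \<le> snd j" "blinfun_apply (b j) \<in> U" by (auto simp: tail_def)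
    then show ?thesis
      by (intro bexI[of _ j]) (auto simp: U_def \<beta> dist_real_def abs_minus_commute)
  qed
  have small: "\<exists>n. \<forall>m\<ge>n. eps m < e" if e: "0 < e" for e
  proof -
    obtain n where n: "inverse (real (Suc n)) < e" using reals_Archimedean[OF e] by blast
    have "eps m < e" if "n \<le> m" for m
    proof -
      have "1 / real (Suc m) \<le> 1 / real (Suc n)" using that by (intro divide_left_mono) auto
      then show ?thesis using n eps(3)[of m] by (simp add: inverse_eq_divide)
    qed
    then show ?thesis by blast
  qed
  have "\<beta> \<in> fenchel_subdiff g x"
    unfolding fenchel_subdiff_def
  proof (intro CollectI allI)
    fix u
    show "g x + blinfun_apply \<beta> (u - x) \<le> g u"
    proof (rule field_le_epsilon)
      fix e :: real assume e: "0 < e"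
      define k where "k = e / 2 / (2 * L + 1)"
      have k: "0 < k" using e L by (simp add: k_def)
      obtain n where n: "\<And>m. n \<le> m \<Longrightarrow> eps m < k" using small[OF k] by blast
      obtain j where j: "j \<in> I" "n \<le> snd j" "\<bar>blinfun_apply (b j) (u - x) - blinfun_apply \<beta> (u - x)\<bar> < e / 2"
        using approx[of "{u - x}" "e / 2" n] e by auto
      have zj: "norm (z j - x) < k" "norm (z j - x) < r" and bz: "b j \<in> fenchel_subdiff g (z j)"
        using ok[OF j(1)] n[OF j(2)] eps(2)[of "snd j"] r by (auto simp: ok_def)
      have "g (z j) + blinfun_apply (b j) (u - z j) \<le> g u" using bz by (simp add: fenchel_subdiff_def)
      moreover have "blinfun_apply (b j) (u - z j) = blinfun_apply (b j) (u - x) - blinfun_apply (b j) (z j - x)"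
        by (simp add: blinfun.diff_right)
      moreover have "\<bar>blinfun_apply (b j) (z j - x)\<bar> \<le> L * k"
      proof -
        have "\<bar>blinfun_apply (b j) (z j - x)\<bar> \<le> norm (b j) * norm (z j - x)" using norm_blinfun[of "b j" "z j - x"] by simp
        also have "\<dots> \<le> L * k" using bL[OF j(1)] zj L by (intro mult_mono) auto
        finally show ?thesis .
      qed
      moreover have "\<bar>g (z j) - g x\<bar> \<le> L * k"
      proof -
        have "\<bar>g (z j) - g x\<bar> \<le> L * norm (z j - x)" using zj r by (intro lip) auto
        also have "\<dots> \<le> L * k" using zj L by (intro mult_left_mono) auto
        finally show ?thesis .
      qed
      moreover have "2 * (L * k) \<le> e / 2"
      proof -
        have "2 * (L * k) \<le> (2 * L + 1) * k" using k by (simp add: algebra_simps)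
        also have "\<dots> = e / 2" unfolding k_def using L by (intro mult_divide_cancel) linarith
        finally show ?thesis .
      qed
      ultimately show "g x + blinfun_apply \<beta> (u - x) \<le> g u + e" using j(3) by (simp only: abs_le_iff abs_less_iff) linarith
    qed
  qed
  moreover have "- \<beta> \<in> outer_limit frechet_subdiff f x"
  proof (rule outer_limit_criterion[where f=f and x=x and c=c, OF c])
    fix Ls :: "'a set" and e :: real assume Ls: "finite Ls" and e: "0 < e"
    obtain n where n: "\<And>m. n \<le> m \<Longrightarrow> eps m < e / 2" using small[of "e / 2"] e by auto
    obtain j where j: "j \<in> I" "Ls \<subseteq> fst j" "n \<le> snd j" "\<forall>h\<in>Ls. \<bar>blinfun_apply (b j) h - blinfun_apply \<beta> h\<bar> < e / 2"
      using approx[OF Ls, of "e / 2" n] e by auto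
    have ej: "eps (snd j) < e / 2" using n j(3) by simp
    have okj: "ok j (y j) (z j) (a j) (b j)" by (rule ok[OF j(1)])
    have o: "f (y j) \<noteq> \<infinity>" "norm (y j - x) < e / 2" "\<bar>real_of_ereal (f (y j)) - c\<bar> < e / 2" "a j \<in> frechet_subdiff f (y j)"
      using okj ej by (auto simp: ok_def c_def)
    have ab: "\<bar>blinfun_apply (a j) h + blinfun_apply (b j) h\<bar> \<le> e / 2" if "h \<in> Ls" for h
      using okj that j(2) ej unfolding ok_def by (meson less_imp_le order_trans subsetD)
    obtain dj where dj: "f (y j) = ereal dj" using o(1) nm[of "y j"] by (cases "f (y j)") auto
    show "\<exists>y ys. ys \<in> frechet_subdiff f y \<and> norm (y - x) < e \<and> ereal (c - e) \<le> f y \<and> f y \<le> ereal (c + e) \<and>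
        (\<forall>h\<in>Ls. \<bar>blinfun_apply ys h - blinfun_apply (- \<beta>) h\<bar> < e)"
    proof (intro exI conjI ballI)
      show "a j \<in> frechet_subdiff f (y j)" by (rule o(4))
      show "norm (y j - x) < e" using o(2) e by simp
      show "ereal (c - e) \<le> f (y j)" "f (y j) \<le> ereal (c + e)"
        using o(3) e unfolding dj real_of_ereal.simps ereal_less_eq(3) by linarith+
      fix h assume h: "h \<in> Ls"
      show "\<bar>blinfun_apply (a j) h - blinfun_apply (- \<beta>) h\<bar> < e"
        using ab[OF h] bspec[OF j(4) h] unfolding uminus_blinfun.rep_eq by linarith
    qed
  qed
  ultimately show "0 \<in> outer_limit frechet_subdiff f x + fenchel_subdiff g x"
    using set_plus_intro[of "- \<beta>" "outer_limit frechet_subdiff f x" \<beta> "fenchel_subdiff g x"] by simp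
qed

section \<open>Core, Frechet and limiting subdifferentials\<close>

text \<open>
  For each \<open>e\<close> take an admissible radius that exceeds half the supremum of the admissible radii in
  \<open>(0, 1]\<close>. Since for each fixed \<open>n\<close> the radius \<open>n * e\<close> is admissible for small \<open>e\<close>, the quotient of radius and \<open>e\<close> tends to
  infinity.
\<close>

lemma frechet_subset_core:
  fixes f :: "'a::real_normed_vector \<Rightarrow> ereal"
  assumes fx: "\<bar>f x0\<bar> \<noteq> \<infinity>"
  shows "frechet_subdiff f x0 \<subseteq> core_subdiff f x0"
proof
  fix a assume a: "a \<in> frechet_subdiff f x0"
  define c where "c = real_of_ereal (f x0)"
  have c: "f x0 = ereal c" using fx by (cases "f x0") (auto simp: c_def)
  have fr: "\<exists>d>0. \<forall>u. norm (u - x0) < d \<longrightarrow> ereal (c + blinfun_apply a (u - x0) - e * norm (u - x0)) \<le> f u" if "0 < e" for e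
    using a that unfolding frechet_subdiff_iff[where f=f and x=x0 and c=c, OF c] by blast
  define P where "P e d \<longleftrightarrow> (\<forall>u\<in>cball x0 d. f x0 + ereal (blinfun_apply a (u - x0)) \<le> f u + ereal e)" for e d
  define A where "A e = {d. 0 < d \<and> d \<le> 1 \<and> P e d}" for e
  have PI: "P e d" if d: "\<forall>u. norm (u - x0) < d' \<longrightarrow> ereal (c + blinfun_apply a (u - x0) - k * norm (u - x0)) \<le> f u"
    "d < d'" "k * d \<le> e" "0 \<le> k" for e d d' k
    unfolding P_def
  proof
    fix u assume u: "u \<in> cball x0 d"
    then have n: "norm (u - x0) \<le> d" by (simp add: dist_norm norm_minus_commute)
    have "k * norm (u - x0) \<le> k * d" using n d(4) by (rule mult_left_mono)
    then have "ereal (c + blinfun_apply a (u - x0) - e) \<le> ereal (c + blinfun_apply a (u - x0) - k * norm (u - x0))"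
      using d(3) by simp
    also have "\<dots> \<le> f u" using d(1,2) n by simp
    finally show "f x0 + ereal (blinfun_apply a (u - x0)) \<le> f u + ereal e"
      by (cases "f u") (auto simp: c)
  qed
  have Ane: "A e \<noteq> {}" if e: "0 < e" for e
  proof -
    obtain d where d: "0 < d" "\<forall>u. norm (u - x0) < d \<longrightarrow> ereal (c + blinfun_apply a (u - x0) - 1 * norm (u - x0)) \<le> f u"
      using fr[OF zero_less_one] by blast
    have "min 1 (min (d / 2) e) \<in> A e"
      unfolding A_def using d e by (auto intro!: PI[OF d(2)])
    then show ?thesis by blast
  qed
  have Abdd: "bdd_above (A e)" for e by (rule bdd_aboveI[of _ 1]) (auto simp: A_def)
  have "\<exists>d. 0 < e \<longrightarrow> d \<in> A e \<and> Sup (A e) / 2 < d" for e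
  proof (cases "0 < e")
    case True
    obtain d where d: "d \<in> A e" using Ane[OF True] by blast
    then have "0 < Sup (A e)" using cSup_upper[OF d Abdd] by (simp add: A_def)
    then have "Sup (A e) / 2 < Sup (A e)" by simp
    then show ?thesis using less_cSup_iff[OF Ane[OF True] Abdd] by blast
  qed auto
  then obtain \<delta> where \<delta>: "\<And>e. 0 < e \<Longrightarrow> \<delta> e \<in> A e \<and> Sup (A e) / 2 < \<delta> e" by metis
  have "((\<lambda>e. ereal (\<delta> e / e)) \<longlongrightarrow> \<infinity>) (at_right 0)"
    unfolding tendsto_PInfty
  proof
    fix R :: real
    obtain n where n: "max 1 (2 * R) \<le> real n" using real_arch_simple by blast
    have n1: "1 \<le> real n" "2 * R \<le> real n" using n by auto
    obtain d where d: "0 < d" "\<forall>u. norm (u - x0) < d \<longrightarrow> ereal (c + blinfun_apply a (u - x0) - 1 / real n * norm (u - x0)) \<le> f u"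
      using fr[of "1 / real n"] n1 by auto
    have "eventually (\<lambda>e. e < min (d / n) (1 / n)) (at_right 0)"
      using d n1 by (intro order_tendstoD(2)[OF tendsto_ident_at]) auto
    moreover have "eventually (\<lambda>e. (0::real) < e) (at_right 0)" by (simp add: eventually_at_right_less)
    ultimately show "eventually (\<lambda>e. ereal R < ereal (\<delta> e / e)) (at_right 0)"
    proof eventually_elim
      case (elim e)
      have e: "0 < e" "n * e < d" "n * e \<le> 1" using elim n1 by (auto simp: field_simps)
      have "P e (n * e)" using e n1 by (intro PI[OF d(2)]) auto
      then have "n * e \<in> A e" using e n1 by (simp add: A_def)
      then have "n * e \<le> Sup (A e)" by (rule cSup_upper[OF _ Abdd])
      then have "n * e / 2 < \<delta> e" using \<delta>[OF e(1)] by linarith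
      moreover have "R * e \<le> n * e / 2" using mult_right_mono[OF n1(2), of e] e(1) by simp
      ultimately have "R * e < \<delta> e" by linarith
      then show ?case using e(1) by (simp add: pos_less_divide_eq)
    qed
  qed
  then have "Limsup (at_right 0) (\<lambda>e. ereal (\<delta> e / e)) = \<infinity>"
    by (intro lim_imp_Limsup) auto
  moreover have "\<forall>e>0. 0 < \<delta> e" using \<delta> by (auto simp: A_def)
  moreover have "\<forall>e>0. \<forall>u\<in>cball x0 (\<delta> e). f x0 + ereal (blinfun_apply a (u - x0)) \<le> f u + ereal e"
    using \<delta> by (auto simp: A_def P_def)
  ultimately show "a \<in> core_subdiff f x0"
    unfolding core_subdiff_def using fx by blast
qed

lemma convex_norm_series:
  fixes w :: "nat \<Rightarrow> 'a::real_normed_vector" and c :: "nat \<Rightarrow> real"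
  assumes c: "\<And>k. 0 \<le> c k" "c sums C" and w: "\<And>k. norm (w k - x) \<le> r"
  shows "convex_on UNIV (\<lambda>u. \<Sum>k. c k * norm (u - w k))"
    and "\<And>u. summable (\<lambda>k. c k * norm (u - w k))"
    and "\<And>u v. (\<Sum>k. c k * norm (u - w k)) \<le> (\<Sum>k. c k * norm (v - w k)) + C * norm (u - v)"
proof -
  have smc: "summable c" using c(2) by (rule sums_summable)
  show sm: "summable (\<lambda>k. c k * norm (u - w k))" for u
  proof (rule summable_comparison_test)
    show "summable (\<lambda>k. c k * (norm (u - x) + r))" using smc by (rule summable_mult2)
    have "norm (u - w k) \<le> norm (u - x) + r" for k
      using norm_triangle_ineq4[of "u - x" "w k - x"] w[of k] by simp
    then show "\<exists>N. \<forall>n\<ge>N. norm (c n * norm (u - w n)) \<le> c n * (norm (u - x) + r)"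
      using c(1) by (intro exI[of _ 0] allI impI) (simp add: mult_left_mono)
  qed
  show "convex_on UNIV (\<lambda>u. \<Sum>k. c k * norm (u - w k))"
  proof (rule convex_onI)
    fix t :: real and u v :: 'a assume t: "0 < t" "t < 1"
    have sr: "(\<lambda>k. (1 - t) * (c k * norm (u - w k)) + t * (c k * norm (v - w k))) sums
        ((1 - t) * (\<Sum>k. c k * norm (u - w k)) + t * (\<Sum>k. c k * norm (v - w k)))"
      by (intro sums_add sums_mult summable_sums sm)
    show "(\<Sum>k. c k * norm ((1 - t) *\<^sub>R u + t *\<^sub>R v - w k))
        \<le> (1 - t) * (\<Sum>k. c k * norm (u - w k)) + t * (\<Sum>k. c k * norm (v - w k))"
    proof (rule sums_le[OF _ summable_sums[OF sm] sr])
      fix k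
      have "(1 - t) *\<^sub>R u + t *\<^sub>R v - w k = (1 - t) *\<^sub>R (u - w k) + t *\<^sub>R (v - w k)"
        by (simp add: algebra_simps)
      then have "norm ((1 - t) *\<^sub>R u + t *\<^sub>R v - w k) \<le> (1 - t) * norm (u - w k) + t * norm (v - w k)"
        using norm_triangle_ineq[of "(1 - t) *\<^sub>R (u - w k)" "t *\<^sub>R (v - w k)"] t by simp
      from mult_left_mono[OF this c(1)[of k]]
      show "c k * norm ((1 - t) *\<^sub>R u + t *\<^sub>R v - w k) \<le> (1 - t) * (c k * norm (u - w k)) + t * (c k * norm (v - w k))"
        by (simp add: algebra_simps)
    qed
  qed simp
  show "(\<Sum>k. c k * norm (u - w k)) \<le> (\<Sum>k. c k * norm (v - w k)) + C * norm (u - v)" for u v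
  proof (rule sums_le[OF _ summable_sums[OF sm]])
    show "(\<lambda>k. c k * norm (v - w k) + c k * norm (u - v)) sums ((\<Sum>k. c k * norm (v - w k)) + C * norm (u - v))"
      by (intro sums_add sums_mult2 summable_sums sm c(2))
    fix k
    have "norm (u - w k) \<le> norm (v - w k) + norm (u - v)"
      using norm_triangle_ineq[of "u - v" "v - w k"] by simp
    from mult_left_mono[OF this c(1)[of k]]
    show "c k * norm (u - w k) \<le> c k * norm (v - w k) + c k * norm (u - v)" by (simp add: distrib_left)
  qed
qed

lemma limsup_infinity_ex:
  fixes \<delta> :: "real \<Rightarrow> real"
  assumes L: "Limsup (at_right 0) (\<lambda>e. ereal (\<delta> e / e)) = \<infinity>" and b: "0 < b"
  obtains e where "0 < e" "e < b" "R < \<delta> e / e"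
proof (rule ccontr)
  assume n: "\<not> thesis"
  have "eventually (\<lambda>e. ereal (\<delta> e / e) \<le> ereal R) (at_right 0)"
    unfolding eventually_at_right_field using b n that by (intro exI[of _ b]) (auto simp: not_less[symmetric])
  then have "Limsup (at_right 0) (\<lambda>e. ereal (\<delta> e / e)) \<le> ereal R" by (rule Limsup_bounded)
  then show False using L by simp
qed

text \<open>
  With \<open>M = 2 / e\<close> and \<open>\<delta> h / h > M\<close>, the first penalty \<open>e / 2 * norm (u - x0)\<close> of the variational
  principle outweighs the gap \<open>h\<close> before \<open>u\<close> reaches the boundary of the ball of radius \<open>\<delta> h\<close>. So the
  minimizer is an interior point, and the whole perturbation is convex with Lipschitz constant \<open>e\<close>.
\<close>

lemma core_subdiff_approx:
  fixes f :: "'a::real_normed_vector \<Rightarrow> ereal"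
  assumes complete: "complete (UNIV :: 'a set)" and lsc: "lsc_near f x0"
    and abs: "abstract_subdifferential_on frechet_subdiff \<F>" and fF: "f \<in> \<F>"
    and c: "f x0 = ereal c" and xs: "xs \<in> core_subdiff f x0" and e: "0 < e"
  obtains z d zs where "norm (z - x0) \<le> e" "f z = ereal d" "\<bar>d - c\<bar> \<le> e"
    "zs \<in> outer_limit frechet_subdiff f z" "norm (zs - xs) \<le> e"
proof -
  obtain \<delta> where \<delta>_all: "\<forall>e>0. 0 < \<delta> e" and lim: "Limsup (at_right 0) (\<lambda>e. ereal (\<delta> e / e)) = \<infinity>"
    and core_all: "\<forall>e>0. \<forall>u\<in>cball x0 (\<delta> e). f x0 + ereal (blinfun_apply xs (u - x0)) \<le> f u + ereal e"
    using xs unfolding core_subdiff_def by blast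
  have \<delta>: "0 < \<delta> e" if "0 < e" for e using \<delta>_all that by blast
  have core: "f x0 + ereal (blinfun_apply xs (u - x0)) \<le> f u + ereal e" if "0 < e" "u \<in> cball x0 (\<delta> e)" for e u
    using core_all that by blast
  obtain r0 where r0: "0 < r0" "\<And>u. dist u x0 < r0 \<Longrightarrow> lsc_at f u"
    using lsc unfolding lsc_near_def eventually_nhds_metric by blast
  (* Within \<rho> of x0 the function is lower semicontinuous and xs varies by at most e / 2. *)
  define \<rho> where "\<rho> = min (r0 / 2) (min e (e / 2 / (norm xs + 1)))"
  have n1: "0 < norm xs + 1" using norm_ge_zero[of xs] by linarith
  have \<rho>: "0 < \<rho>" "\<rho> < r0" "\<rho> \<le> e" using r0 e n1 by (auto simp: \<rho>_def)
  have xs\<rho>: "norm xs * \<rho> \<le> e / 2"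
  proof -
    have "norm xs * \<rho> \<le> (norm xs + 1) * \<rho>" using \<rho> by (intro mult_right_mono) auto
    also have "\<dots> \<le> (norm xs + 1) * (e / 2 / (norm xs + 1))" using n1 by (intro mult_left_mono) (auto simp: \<rho>_def)
    also have "\<dots> = e / 2" using n1 by (intro mult_divide_cancel) linarith
    finally show ?thesis .
  qed
  define M where "M = 2 / e"
  have M: "0 < M" using e by (simp add: M_def)
  obtain h where h: "0 < h" "h < min (e / 2) (\<rho> / M)" "M < \<delta> h / h"
    using limsup_infinity_ex[OF lim, of "min (e / 2) (\<rho> / M)" M] e \<rho> M by auto
  define \<eta> where "\<eta> = min (\<delta> h) \<rho>"
  have \<eta>: "0 < \<eta>" "\<eta> \<le> \<rho>" "\<eta> \<le> \<delta> h" using \<delta>[OF h(1)] \<rho> by (auto simp: \<eta>_def)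
  have Mh: "M * h < \<eta>"
  proof -
    have "M * h < \<delta> h" using h(1,3) by (simp add: pos_less_divide_eq)
    moreover have "M * h < \<rho>" using h(2) M by (simp add: pos_less_divide_eq mult.commute)
    ultimately show ?thesis by (simp add: \<eta>_def)
  qed
  define S where "S = {u. norm (u - x0) \<le> \<eta> \<and> f u \<noteq> \<infinity>}"
  define F where "F u = real_of_ereal (f u)" for u
  have low: "ereal (c + blinfun_apply xs (u - x0)) \<le> f u + ereal h" if "norm (u - x0) \<le> \<eta>" for u
    using core[OF h(1), of u] that \<eta> by (simp add: c dist_norm norm_minus_commute)
  have fS: "f u = ereal (F u)" if "u \<in> S" for u
    using that low[of u] unfolding F_def S_def by (cases "f u") auto
  define G where "G u = F u - blinfun_apply xs (u - x0)" for u
  have Glow: "c - h \<le> G u" if "u \<in> S" for u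
    using low[of u] that fS[OF that] by (simp add: S_def G_def)
  have x0S: "x0 \<in> S" using \<eta> by (simp add: S_def c)
  have Gx0: "G x0 = c" by (simp add: G_def F_def c blinfun.zero_right)
  define cc where "cc k = e / 2 * (1/2)^k" for k :: nat
  have cc: "0 < cc k" for k using e by (simp add: cc_def)
  have ccs: "cc sums e" unfolding cc_def using sums_mult[OF geometric_sums[of "1/2::real"], of "e / 2"] by simp
  have xb: "\<bar>blinfun_apply xs (u - x0)\<bar> \<le> e / 2" if "norm (u - x0) \<le> \<eta>" for u
  proof -
    have "\<bar>blinfun_apply xs (u - x0)\<bar> \<le> norm xs * norm (u - x0)" using norm_blinfun[of xs "u - x0"] by simp
    also have "\<dots> \<le> norm xs * \<rho>" using that \<eta> by (intro mult_left_mono) auto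
    finally show ?thesis using xs\<rho> by simp
  qed
  obtain z w where z: "z \<in> S" and w: "\<And>k. w k \<in> S" "w 0 = x0"
    and zle: "G z + (\<Sum>k. cc k * norm (z - w k)) \<le> G x0"
    and zmin: "\<And>u. u \<in> S \<Longrightarrow> G z + (\<Sum>k. cc k * norm (z - w k)) \<le> G u + (\<Sum>k. cc k * norm (u - w k))"
  proof (rule smooth_variational_principle[of S G "c - h" "\<lambda>u v. norm (u - v)" "2 * \<eta>" cc x0])
    show "\<exists>z. s \<longlonglongrightarrow> z" if "\<forall>n. s n \<in> S" "Cauchy s" for s
      using complete that(2) unfolding complete_def by auto
    fix s u b assume s: "\<forall>n. s n \<in> S" "s \<longlonglongrightarrow> u" "\<forall>n. G (s n) \<le> b"
    have uR: "norm (u - x0) \<le> \<eta>"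
      by (rule LIMSEQ_le_const2[OF tendsto_norm[OF tendsto_diff[OF s(2) tendsto_const]]]) (use s(1) in \<open>auto simp: S_def\<close>)
    have lu: "lsc_at f u" using uR \<eta> \<rho> by (intro r0(2)) (simp add: dist_norm)
    have bound: "f u \<le> ereal (b + blinfun_apply xs (u - x0) + t)" if t: "0 < t" for t
    proof -
      have "(\<lambda>n. blinfun_apply xs (s n - x0)) \<longlonglongrightarrow> blinfun_apply xs (u - x0)"
        by (intro blinfun.tendsto tendsto_const tendsto_diff s)
      then have "eventually (\<lambda>n. blinfun_apply xs (s n - x0) < blinfun_apply xs (u - x0) + t) sequentially"
        using t by (intro order_tendstoD) auto
      then obtain N where N: "\<And>n. N \<le> n \<Longrightarrow> blinfun_apply xs (s n - x0) < blinfun_apply xs (u - x0) + t"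
        unfolding eventually_sequentially by blast
      show ?thesis
      proof (rule lsc_sublevel_closed[OF lu LIMSEQ_ignore_initial_segment[OF s(2), of N]])
        fix n
        have "s (n + N) \<in> S" "G (s (n + N)) \<le> b" using s by auto
        then show "f (s (n + N)) \<le> ereal (b + blinfun_apply xs (u - x0) + t)"
          using N[of "n + N"] by (simp add: fS G_def)
      qed
    qed
    have uS: "u \<in> S" using bound[OF zero_less_one] uR by (auto simp: S_def)
    moreover have "G u \<le> b"
    proof (rule field_le_epsilon)
      fix t :: real assume "0 < t"
      then show "G u \<le> b + t" using bound[of t] by (simp add: fS[OF uS] G_def)
    qed
    ultimately show "u \<in> S \<and> G u \<le> b" ..
  next
    fix s :: "nat \<Rightarrow> 'a" and u v :: 'a assume "s \<longlonglongrightarrow> u"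
    then show "(\<lambda>n. norm (s n - v)) \<longlonglongrightarrow> norm (u - v)" by (intro tendsto_intros)
  next
    fix u v assume "u \<in> S" "v \<in> S"
    then show "norm (u - v) \<le> 2 * \<eta>" using norm_triangle_ineq4[of "u - x0" "v - x0"] by (simp add: S_def)
  next
    fix t :: real assume "0 < t"
    then show "\<exists>d>0. \<forall>u\<in>S. \<forall>v\<in>S. norm (u - v) < d \<longrightarrow> dist u v < t" by (auto simp: dist_norm)
  qed (use Glow cc ccs x0S in \<open>auto intro: sums_summable\<close>)
  have wR: "norm (w k - x0) \<le> \<eta>" for k using w(1)[of k] by (simp add: S_def)
  define N where "N u = (\<Sum>k. cc k * norm (u - w k))" for u
  have Ncv: "convex_on UNIV N" and Nsm: "\<And>u. summable (\<lambda>k. cc k * norm (u - w k))"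
    and Nlip: "\<And>u v. N u \<le> N v + e * norm (u - v)"
    using convex_norm_series[of cc e w x0 \<eta>] cc ccs wR unfolding N_def[abs_def] by (auto simp: less_imp_le)
  have N0: "cc 0 * norm (z - w 0) \<le> N z"
    unfolding N_def using sum_le_suminf[OF Nsm, of "{0}" z] cc by (simp add: less_imp_le)
  have Nz: "0 \<le> N z" using N0 mult_nonneg_nonneg[OF less_imp_le[OF cc] norm_ge_zero, of 0 "z - w 0"] by simp
  have zx: "norm (z - x0) < \<eta>"
  proof -
    have "G z + N z \<le> c" using zle unfolding N_def[symmetric] Gx0 .
    moreover have "e / 2 * norm (z - x0) \<le> N z" using N0 unfolding w(2) by (simp add: cc_def)
    ultimately have "e / 2 * norm (z - x0) \<le> h" using Glow[OF z] by linarith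
    then have "norm (z - x0) \<le> M * h" using e by (simp add: M_def field_simps)
    then show ?thesis using Mh by simp
  qed
  define g where "g u = N u + blinfun_apply (- xs) (u - x0)" for u
  have gcv: "convex_on UNIV g"
    unfolding g_def
  proof (intro convex_on_add Ncv)
    show "convex_on UNIV (\<lambda>u. blinfun_apply (- xs) (u - x0))"
    proof (rule convex_onI)
      fix t :: real and u v :: 'a
      have "(1 - t) *\<^sub>R u + t *\<^sub>R v - x0 = (1 - t) *\<^sub>R (u - x0) + t *\<^sub>R (v - x0)" by (simp add: algebra_simps)
      then show "blinfun_apply (- xs) ((1 - t) *\<^sub>R u + t *\<^sub>R v - x0)
          \<le> (1 - t) * blinfun_apply (- xs) (u - x0) + t * blinfun_apply (- xs) (v - x0)"
        by (simp only: blinfun.add_right blinfun.scaleR_right) simp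
    qed simp
  qed
  have gct: "continuous_on UNIV g"
  proof -
    have "e-lipschitz_on UNIV N"
    proof (rule lipschitz_onI)
      show "dist (N u) (N v) \<le> e * dist u v" for u v
        using Nlip[of u v] Nlip[of v u] by (simp add: dist_norm abs_le_iff norm_minus_commute)
    qed (use e in auto)
    then have "continuous_on UNIV N" by (rule lipschitz_on_continuous_on)
    then show ?thesis unfolding g_def by (intro continuous_intros)
  qed
  have fz: "f z = ereal (F z)" by (rule fS[OF z])
  have "lsc_near f z"
    unfolding lsc_near_def eventually_nhds_metric
  proof (intro exI[of _ "r0 - dist z x0"] conjI allI impI)
    show "0 < r0 - dist z x0" using zx \<eta> \<rho> by (simp add: dist_norm)
    fix u assume "dist u z < r0 - dist z x0"
    then show "lsc_at f u" using dist_triangle[of u x0 z] by (intro r0(2)) simp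
  qed
  moreover have "eventually (\<lambda>u. f z + ereal (g z) \<le> f u + ereal (g u)) (nhds z)"
    unfolding eventually_nhds_metric
  proof (intro exI[of _ "\<eta> - norm (z - x0)"] conjI allI impI)
    show "0 < \<eta> - norm (z - x0)" using zx by simp
    fix u assume "dist u z < \<eta> - norm (z - x0)"
    then have u: "norm (u - x0) \<le> \<eta>" using norm_triangle_ineq[of "u - z" "z - x0"] by (simp add: dist_norm)
    show "f z + ereal (g z) \<le> f u + ereal (g u)"
    proof (cases "f u = \<infinity>")
      case False
      then have uS: "u \<in> S" using u by (simp add: S_def)
      show ?thesis using zmin[OF uS] unfolding fz fS[OF uS] by (simp add: g_def N_def[symmetric] G_def uminus_blinfun.rep_eq)
    qed simp
  qed
  moreover have "\<bar>f z\<bar> \<noteq> \<infinity>" by (simp add: fz)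
  ultimately have "0 \<in> outer_limit frechet_subdiff f z + fenchel_subdiff g z"
    using abs[unfolded abstract_subdifferential_on_def, THEN bspec, OF fF, THEN spec[of _ g], THEN spec[of _ z]] gcv gct
    by simp
  then obtain zs b where "0 = zs + b" and zs: "zs \<in> outer_limit frechet_subdiff f z" and b: "b \<in> fenchel_subdiff g z"
    by (rule set_plus_elim)
  then have beq: "b = - zs" by (simp add: eq_neg_iff_add_eq_0 add.commute)
  have "norm (b - (- xs)) \<le> e"
  proof (rule fenchel_subdiff_norm_le[OF b zero_less_one])
    show "g (z + k) - g z \<le> blinfun_apply (- xs) k + e * norm k" for k
      using Nlip[of "z + k" z] by (simp add: g_def uminus_blinfun.rep_eq blinfun.add_right blinfun.diff_right)
  qed (use e in simp)
  then have nz: "norm (zs - xs) \<le> e" by (simp add: beq norm_minus_commute)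
  have "G z \<le> c" using zle Nz by (simp add: Gx0 N_def)
  then have "\<bar>F z - c\<bar> \<le> e"
  proof -
    have "\<bar>blinfun_apply xs (z - x0)\<bar> \<le> e / 2" using zx by (intro xb) simp
    moreover have "h < e / 2" using h(2) by simp
    moreover have "G z = F z - blinfun_apply xs (z - x0)" by (rule G_def)
    ultimately show ?thesis using Glow[OF z] \<open>G z \<le> c\<close> by linarith
  qed
  then show ?thesis
    using zx \<eta> \<rho> fz zs nz by (intro that[of z "F z" zs]) auto
qed

text \<open>
  The approximating points \<open>z\<close> carry limiting subgradients close to \<open>xs\<close>, and these are in turn
  weak-star approximated by Frechet subgradients at points close to \<open>z\<close>.
\<close>

lemma core_subset_limiting:
  fixes f :: "'a::real_normed_vector \<Rightarrow> ereal"
  assumes fx: "\<bar>f x0\<bar> \<noteq> \<infinity>" and complete: "complete (UNIV :: 'a set)" and lsc: "lsc_near f x0"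
    and abs: "abstract_subdifferential_on frechet_subdiff \<F>" and fF: "f \<in> \<F>"
  shows "core_subdiff f x0 \<subseteq> limiting_subdiff f x0"
proof
  fix xs assume xs: "xs \<in> core_subdiff f x0"
  obtain c where c: "f x0 = ereal c" using fx by (cases "f x0") auto
  show "xs \<in> limiting_subdiff f x0"
    unfolding limiting_subdiff_def
  proof (rule outer_limit_criterion[where f=f and x=x0 and c=c, OF c])
    fix Ls :: "'a set" and e :: real assume Ls: "finite Ls" and e: "0 < e"
    define m where "m = 2 * (1 + (\<Sum>h\<in>Ls. norm h))"
    have m: "2 \<le> m" unfolding m_def by (simp add: sum_nonneg)
    define k where "k = e / m"
    have k: "0 < k" "k \<le> e / 2"
      unfolding k_def using e m by (simp, intro divide_left_mono) auto
    obtain z d zs where z: "norm (z - x0) \<le> k" "f z = ereal d" "\<bar>d - c\<bar> \<le> k"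
      and zs: "zs \<in> outer_limit frechet_subdiff f z" "norm (zs - xs) \<le> k"
      by (rule core_subdiff_approx[where f=f and ?x0.0=x0 and c=c, OF complete lsc abs fF c xs k(1)])
    have half: "0 < e / 2" using e by simp
    obtain y ys where ys: "ys \<in> frechet_subdiff f y" "norm (y - z) < e / 2" "ereal (d - e / 2) < f y" "f y < ereal (d + e / 2)"
      and ysL: "\<And>h. h \<in> Ls \<Longrightarrow> \<bar>blinfun_apply ys h - blinfun_apply zs h\<bar> < e / 2"
      by (rule outer_limit_approx[where f=f and x=z and c=d, OF zs(1) z(2) Ls half]) blast
    show "\<exists>y ys. ys \<in> frechet_subdiff f y \<and> norm (y - x0) < e \<and> ereal (c - e) \<le> f y \<and> f y \<le> ereal (c + e) \<and>
        (\<forall>h\<in>Ls. \<bar>blinfun_apply ys h - blinfun_apply xs h\<bar> < e)"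
    proof (intro exI conjI ballI)
      show "ys \<in> frechet_subdiff f y" by (rule ys(1))
      show "norm (y - x0) < e" using norm_triangle_ineq[of "y - z" "z - x0"] ys(2) z(1) k(2) by simp
      have "ereal (c - e) \<le> ereal (d - e / 2)" using z(3) k(2) by (simp add: abs_le_iff)
      also have "\<dots> < f y" by (rule ys(3))
      finally show "ereal (c - e) \<le> f y" by simp
      have "f y < ereal (d + e / 2)" by (rule ys(4))
      also have "\<dots> \<le> ereal (c + e)" using z(3) k(2) by (simp add: abs_le_iff)
      finally show "f y \<le> ereal (c + e)" by simp
      fix h assume h: "h \<in> Ls"
      have "norm h \<le> m / 2" unfolding m_def using member_le_sum[OF h, of norm] Ls by simp
      then have "norm (zs - xs) * norm h \<le> k * (m / 2)" using zs(2) k by (intro mult_mono) auto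
      also have "\<dots> = e / 2" using m by (simp add: k_def)
      finally have "\<bar>blinfun_apply zs h - blinfun_apply xs h\<bar> \<le> e / 2"
        using norm_blinfun[of "zs - xs" h] by (simp add: minus_blinfun.rep_eq)
      then show "\<bar>blinfun_apply ys h - blinfun_apply xs h\<bar> < e" using ysL[OF h] by linarith
    qed
  qed
qed

theorem theorem6:
  fixes f :: "'a::real_normed_vector \<Rightarrow> ereal" and x0 :: 'a
  assumes "\<bar>f x0\<bar> \<noteq> \<infinity>"
  shows "frechet_subdiff f x0 \<subseteq> core_subdiff f x0 \<and>
    (\<forall>\<F>. complete (UNIV :: 'a set) \<and> lsc_near f x0 \<and>
          abstract_subdifferential_on (frechet_subdiff :: ('a \<Rightarrow> ereal) \<Rightarrow> 'a \<Rightarrow> ('a \<Rightarrow>\<^sub>L real) set) \<F> \<and>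
          f \<in> \<F>
          \<longrightarrow> core_subdiff f x0 \<subseteq> limiting_subdiff f x0) \<and>
    (asplund_space TYPE('a) \<longrightarrow>
       abstract_subdifferential_on (frechet_subdiff :: ('a \<Rightarrow> ereal) \<Rightarrow> 'a \<Rightarrow> ('a \<Rightarrow>\<^sub>L real) set)
         {h. proper h \<and> lsc h} \<and>
       (proper f \<and> lsc f \<longrightarrow> core_subdiff f x0 \<subseteq> limiting_subdiff f x0))"
proof (intro conjI allI impI; (elim conjE)?)
  show "frechet_subdiff f x0 \<subseteq> core_subdiff f x0" by (rule frechet_subset_core[where f=f and ?x0.0=x0, OF assms])
  show "core_subdiff f x0 \<subseteq> limiting_subdiff f x0"
    if "complete (UNIV :: 'a set)" "lsc_near f x0" "abstract_subdifferential_on frechet_subdiff \<F>" "f \<in> \<F>" for \<F>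
    by (rule core_subset_limiting[where f=f and ?x0.0=x0, OF assms that])
  show "abstract_subdifferential_on (frechet_subdiff :: ('a \<Rightarrow> ereal) \<Rightarrow> 'a \<Rightarrow> ('a \<Rightarrow>\<^sub>L real) set) {h. proper h \<and> lsc h}"
    if "asplund_space TYPE('a)" using that by (rule asplund_abstract_subdifferential)
  show "core_subdiff f x0 \<subseteq> limiting_subdiff f x0" if asp: "asplund_space TYPE('a)" and f: "proper f" "lsc f"
  proof (rule core_subset_limiting[where f=f and ?x0.0=x0, OF assms _ _ asplund_abstract_subdifferential[OF asp]])
    show "complete (UNIV :: 'a set)" using asp by (simp add: asplund_space_def)
    show "lsc_near f x0" using f(2) by (simp add: lsc_near_def lsc_def always_eventually)
    show "f \<in> {h. proper h \<and> lsc h}" using f by simp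
  qed
qed

end
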